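(* Let $\alpha\in(1,2)$. One has $$\mathcal{D}(\hat L)=\Big\{x\mapsto \lambda_f\,F_\alpha(x)-(F_\alpha'\star f)(x),\quad f\in\mathcal{C}_0\Big\}$$ and $$\mathcal{D}(L)=\Big\{x\mapsto e^{-x}\int_0^x F_\alpha''(y)f(y)\,dy+\int_x^\infty\big(e^{-x}F_\alpha''(y)-F_\alpha'(y-x)\big)f(y)\,dy,\quad f\in\mathcal{C}_0\Big\}.$$
   Context: Fix $\alpha\in(1,2)$; $\mathbb{R}^+=[0,\infty)$. $\mathcal{C}_0$ is the set of continuous functions $\mathbb{R}^+\to\mathbb{R}$ tending to $0$ at infinity. $E_\alpha(x)=\sum_{n=0}^\infty \frac{x^n}{\Gamma(\alpha n+1)}$ is the Mittag-Leffler function of index $\alpha$, and $F_\alpha(x)=E_\alpha(x^\alpha)$ for $x\ge 0$. For $f\in\mathcal{C}_0$ set $\lambda_f=\int_0^\infty e^{-y}f(y)\,dy$, and $(F_\alpha'\star f)(x)=\int_0^x F_\alpha'(x-y)f(y)\,dy$. $Z$ is a spectrally negative $\alpha$-stable Lévy process started at $0$ under $\mathbb{P}$, with Lévy density $\nu_\alpha(y)=\frac{|y|^{-(\alpha+1)}}{\Gamma(-\alpha)}\mathbf{1}_{\{y<0\}}$, normalized so that $\mathbb{E}[e^{\lambda Z_t}]=e^{t\lambda^\alpha}$ for all $t,\lambda\ge0$. Let $S_t=\sup\{Z_s:\ s\le t\}$, $I_t=\inf\{Z_s:\ s\le t\}$, and consider the reflected processes $X_t=S_t-Z_t$ and $\hat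 X_t=Z_t-I_t$. Both are Feller processes on $\mathbb{R}^+$; $\mathbb{P}_x$, resp. $\hat{\mathbb{P}}_x$, denotes the law of $X$, resp. $\hat X$, started from $x\ge0$, i.e. the law under $\mathbb{P}$ of $\{(x\vee S_t)-Z_t,\ t\ge0\}$, resp. $\{Z_t+(x\vee(-I_t)),\ t\ge0\}$; the expectations are $\mathbb{E}_x$, $\hat{\mathbb{E}}_x$. The infinitesimal generators are $$Lf(x)=\lim_{t\to0}\frac{\mathbb{E}_x[f(X_t)]-f(x)}{t},\qquad \hat Lf(x)=\lim_{t\to0}\frac{\hat{\mathbb{E}}_x[f(\hat X_t)]-f(x)}{t},$$ and the Fellerian domains $\mathcal{D}(L)$, resp. $\mathcal{D}(\hat L)$, are the sets of functions $f\in\mathcal{C}_0$ for which the first, resp. second, limit exists uniformly in $x\in\mathbb{R}^+$. *)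

theory Defs
  imports "HOL-Probability.Probability"
begin

section \<open>Function spaces and the Mittag-Leffler function\<close>

text \<open>
  A function on the half-line is represented by the element of \<^term>\<open>extensional {0..}\<close> with
  the same values on \<^term>\<open>{0::real..}\<close>, so that equality of sets of such functions is
  equality of sets of functions on the half-line.
\<close>

definition C0 :: "(real \<Rightarrow> real) set" where
  "C0 = {f \<in> extensional {0..}. continuous_on {0..} f \<and> (f \<longlongrightarrow> 0) at_top}"

definition mittag_leffler :: "real \<Rightarrow> real \<Rightarrow> real" where
  "mittag_leffler \<alpha> x = (\<Sum>n. x ^ n / Gamma (\<alpha> * real n + 1))"

text \<open>
  Only the values at \<open>x \<ge> 0\<close> are meaningful. The derivatives below are consequently meaningful
  only at \<open>x > 0\<close>; they enter the main statement under integrals over subsets of the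
  half-line, where the single point \<open>0\<close> (at which the second derivative blows up) is irrelevant.
\<close>

definition FML :: "real \<Rightarrow> real \<Rightarrow> real" where
  "FML \<alpha> x = mittag_leffler \<alpha> (x powr \<alpha>)"

abbreviation FML' :: "real \<Rightarrow> real \<Rightarrow> real" where
  "FML' \<alpha> \<equiv> deriv (FML \<alpha>)"

abbreviation FML'' :: "real \<Rightarrow> real \<Rightarrow> real" where
  "FML'' \<alpha> \<equiv> deriv (deriv (FML \<alpha>))"

definition exp_mean :: "(real \<Rightarrow> real) \<Rightarrow> real" where
  "exp_mean f = (LBINT y:{0..}. exp (- y) * f y)"

definition half_line_conv :: "(real \<Rightarrow> real) \<Rightarrow> (real \<Rightarrow> real) \<Rightarrow> real \<Rightarrow> real" where
  "half_line_conv g f x = (LBINT y:{0..x}. g (x - y) * f y)"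


section \<open>Stable Levy processes\<close>

locale levy_process = prob_space M
  for M :: "'a measure" and Z :: "real \<Rightarrow> 'a \<Rightarrow> real" +
  assumes measurable_Z: "t \<ge> 0 \<Longrightarrow> Z t \<in> borel_measurable M"
    and start: "AE \<omega> in M. Z 0 \<omega> = 0"
    and indep_increments:
      "\<And>\<tau> n. 0 \<le> \<tau> 0 \<Longrightarrow> mono \<tau> \<Longrightarrow>
         indep_vars (\<lambda>_. borel) (\<lambda>i \<omega>. Z (\<tau> (Suc i)) \<omega> - Z (\<tau> i) \<omega>) {..<n::nat}"
    and stationary_increments:
      "s \<ge> 0 \<Longrightarrow> t \<ge> 0 \<Longrightarrow>
         distr M borel (\<lambda>\<omega>. Z (s + t) \<omega> - Z s \<omega>) = distr M borel (Z t)"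
    and right_continuous:
      "\<omega> \<in> space M \<Longrightarrow> t \<ge> 0 \<Longrightarrow> ((\<lambda>s. Z s \<omega>) \<longlongrightarrow> Z t \<omega>) (at_right t)"
    and left_limits:
      "\<omega> \<in> space M \<Longrightarrow> t > 0 \<Longrightarrow> \<exists>l. ((\<lambda>s. Z s \<omega>) \<longlongrightarrow> l) (at_left t)"

definition stable_process :: "'a measure \<Rightarrow> (real \<Rightarrow> 'a \<Rightarrow> real) \<Rightarrow> real \<Rightarrow> bool" where
  "stable_process M Z \<alpha> \<longleftrightarrow>
     (\<forall>c>0. \<forall>t\<ge>0. distr M borel (Z (c * t)) = distr M borel (\<lambda>\<omega>. c powr (1 / \<alpha>) * Z t \<omega>))"

text \<open>
  The function \<open>\<nu>\<close> is the Lebesgue density of the Levy measure in the Levy-Khintchine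
  formula; the drift \<open>a\<close> and the Gaussian coefficient \<open>\<sigma>\<close> are left free.
\<close>

definition has_levy_density :: "'a measure \<Rightarrow> (real \<Rightarrow> 'a \<Rightarrow> real) \<Rightarrow> (real \<Rightarrow> real) \<Rightarrow> bool" where
  "has_levy_density M Z \<nu> \<longleftrightarrow>
     \<nu> \<in> borel_measurable borel \<and> (\<forall>y. \<nu> y \<ge> 0) \<and>
     integrable lborel (\<lambda>y. min 1 (y\<^sup>2) * \<nu> y) \<and>
     (\<exists>a \<sigma> :: real. \<forall>t\<ge>0. \<forall>\<theta>. char (distr M borel (Z t)) \<theta> =
        exp (of_real t *
          (\<i> * of_real (a * \<theta>) - of_real (\<sigma>\<^sup>2 * \<theta>\<^sup>2 / 2) +
           (CLBINT y. (iexp (\<theta> * y) - 1 - \<i> * of_real (\<theta> * y * indicator {-1..1} y))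
                        * of_real (\<nu> y)))))"

definition stable_density :: "real \<Rightarrow> real \<Rightarrow> real" where
  "stable_density \<alpha> y = \<bar>y\<bar> powr (- (\<alpha> + 1)) / Gamma (- \<alpha>) * indicator {..<0} y"

text \<open>
  Spectral negativity is the fact that \<^const>\<open>stable_density\<close> vanishes on the positive half-line.
\<close>

definition spectrally_negative_stable ::
    "'a measure \<Rightarrow> (real \<Rightarrow> 'a \<Rightarrow> real) \<Rightarrow> real \<Rightarrow> bool" where
  "spectrally_negative_stable M Z \<alpha> \<longleftrightarrow>
     levy_process M Z \<and> stable_process M Z \<alpha> \<and> has_levy_density M Z (stable_density \<alpha>) \<and>
     (\<forall>t\<ge>0. \<forall>l\<ge>0. (\<integral>\<omega>. exp (l * Z t \<omega>) \<partial>M) = exp (t * l powr \<alpha>))"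


section \<open>Reflected processes and Fellerian domains\<close>

definition running_sup :: "(real \<Rightarrow> 'a \<Rightarrow> real) \<Rightarrow> real \<Rightarrow> 'a \<Rightarrow> real" where
  "running_sup Z t \<omega> = (SUP s\<in>{0..t}. Z s \<omega>)"

definition running_inf :: "(real \<Rightarrow> 'a \<Rightarrow> real) \<Rightarrow> real \<Rightarrow> 'a \<Rightarrow> real" where
  "running_inf Z t \<omega> = (INF s\<in>{0..t}. Z s \<omega>)"

text \<open>The first real argument is the starting point, the second one the time.\<close>

definition refl_sup :: "(real \<Rightarrow> 'a \<Rightarrow> real) \<Rightarrow> real \<Rightarrow> real \<Rightarrow> 'a \<Rightarrow> real" where
  "refl_sup Z x t \<omega> = max x (running_sup Z t \<omega>) - Z t \<omega>"

definition refl_inf :: "(real \<Rightarrow> 'a \<Rightarrow> real) \<Rightarrow> real \<Rightarrow> real \<Rightarrow> 'a \<Rightarrow> real" where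
  "refl_inf Z x t \<omega> = Z t \<omega> + max x (- running_inf Z t \<omega>)"

definition feller_domain ::
    "'a measure \<Rightarrow> (real \<Rightarrow> real \<Rightarrow> 'a \<Rightarrow> real) \<Rightarrow> (real \<Rightarrow> real) set" where
  "feller_domain M Y = {f \<in> C0. \<exists>g. uniform_limit {0..}
     (\<lambda>t x. ((\<integral>\<omega>. f (Y x t \<omega>) \<partial>M) - f x) / t) g (at_right 0)}"

end

theory Submission
  imports Defs
begin

text \<open>
  Since \<open>S\<^sub>t - Z\<^sub>t\<close> is \<open>Z\<^sub>t - I\<^sub>t\<close> for the process \<open>-Z\<close>, both reflected processes are instances of one
  construction, and most of the argument concerns the reflection \<open>Z\<^sub>t + max x (- I\<^sub>t)\<close> of an arbitrary
  Levy process. Its transition operators \<open>T t\<close> form a strongly continuous semigroup of positive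
  contractions of \<^const>\<open>C0\<close>, so that its Fellerian domain is the range of the resolvent
  \<open>U f = \<integral>\<^sub>0\<^sup>\<infinity> exp (- t) T t f dt\<close> (\<open>domain_eq_range_U\<close>). What has to be shown is that the two
  expressions of the theorem are \<open>U f\<close>.

  At times on a grid of mesh \<open>h\<close> the reflected process is approximated by the Lindley recursion
  \<open>W \<mapsto> max 0 (W + increment)\<close>, so \<open>T t\<close> is the limit of powers of the one-step operator
  \<open>P\<^sub>h f x = E f (max 0 (x + Z\<^sub>h))\<close> (\<open>refl_op_limit\<close>). This gives the semigroup property, and it shows that an
  expansion \<open>P\<^sub>h u = u + h g + o(h)\<close> carries over to \<open>T h\<close>, whence \<open>u = U (u - g)\<close>. Such expansions
  involve only the law of \<open>Z\<^sub>h\<close>, which enters through \<open>E exp (q Z\<^sub>h) = exp (h q\<^sup>\<alpha>)\<close> for \<open>q \<ge> 0\<close>. The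
  error terms that the truncation at \<open>0\<close> leaves are at most of the order of
  \<open>E (max 0 Z\<^sub>h)\<^sup>2 exp (q max 0 Z\<^sub>h) = O(h\<^bsup>2/\<alpha>\<^esup>)\<close>, and this is \<open>o(h)\<close> because \<open>\<alpha> < 2\<close>. This bound is the
  quantitative form of the absence of positive jumps.

  For the reflection at the supremum, \<open>u = exp (- \<theta> x) - \<theta> exp (- x)\<close> has vanishing derivative at the
  origin, and the expansion gives \<open>(1 - \<theta>\<^sup>\<alpha>) U exp (- \<theta> \<cdot>) = u\<close>. For the reflection at the infimum, the
  Laplace transform in the starting point turns \<open>P\<^sub>h\<close> into multiplication by \<open>exp (h q\<^sup>\<alpha>)\<close>, up to a
  boundary term; the transform of \<open>u = U f\<close> then satisfies
  \<open>(q\<^sup>\<alpha> - 1) u\<^sup>*(q) = q\<^bsup>\<alpha>-1\<^esup> u(0) - f\<^sup>*(q)\<close>, the value \<open>q = 1\<close> forces \<open>u(0) = \<lambda>\<^sub>f\<close>, and uniqueness of Laplace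
  transforms identifies \<open>u\<close> because \<open>F\<^sub>\<alpha>'\<close> has the transform \<open>1 / (q\<^sup>\<alpha> - 1)\<close>.

  Both computations thus determine \<open>U\<close> on exponentials \<open>exp (- n x)\<close>, in agreement with the claimed kernels.
  These kernels are built from exponentially growing functions, and their integrability rests on
  cancellations. It follows without asymptotics of \<open>F\<^sub>\<alpha>\<close>: a positive contractive functional
  on \<^const>\<open>C0\<close> that agrees on exponentials with integration against a continuous function \<open>r\<close> forces
  \<open>r\<close> to be nonnegative and integrable, and it is integration against \<open>r\<close> everywhere
  (\<open>density_representation\<close>).
\<close>

section \<open>Continuous functions vanishing at infinity\<close>

lemma C0_restrictI:
  assumes "continuous_on {0..} f" "(f \<longlongrightarrow> 0) at_top"
  shows "(\<lambda>x\<in>{0..}. f x) \<in> C0"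
proof -
  have "continuous_on {0..} (\<lambda>x\<in>{0..}. f x)"
    using assms(1) by (rule continuous_on_eq) auto
  moreover have "((\<lambda>x\<in>{0..}. f x) \<longlongrightarrow> 0) at_top"
    using assms(2) by (rule Lim_transform_eventually)
      (auto intro: eventually_mono[OF eventually_ge_at_top[of 0]])
  ultimately show ?thesis by (auto simp: C0_def)
qed

lemma C0_D:
  assumes "f \<in> C0"
  shows "continuous_on {0..} f" "(f \<longlongrightarrow> 0) at_top"
  using assms by (auto simp: C0_def)

lemma C0_restrict: "f \<in> C0 \<Longrightarrow> (\<lambda>x\<in>{0..}. f x) = f"
  by (auto simp: C0_def extensional_restrict)

lemma C0_lincomb:
  assumes "f \<in> C0" "g \<in> C0"
  shows "(\<lambda>x\<in>{0..}. a * f x + b * g x) \<in> C0"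
proof (rule C0_restrictI)
  show "continuous_on {0..} (\<lambda>x. a * f x + b * g x)"
    by (intro continuous_intros C0_D(1)[OF assms(1)] C0_D(1)[OF assms(2)])
  show "((\<lambda>x. a * f x + b * g x) \<longlongrightarrow> 0) at_top"
    using tendsto_add[OF tendsto_mult_left[OF C0_D(2)[OF assms(1)], of a] tendsto_mult_left[OF C0_D(2)[OF assms(2)], of b]]
    by simp
qed

lemma C0_diff_restrict:
  assumes "u \<in> C0" "(\<lambda>x\<in>{0..}. g x) \<in> C0"
  shows "(\<lambda>x\<in>{0..}. u x - g x) \<in> C0"
proof -
  have "(\<lambda>x\<in>{0..}. 1 * u x + -1 * (\<lambda>x\<in>{0..}. g x) x) = (\<lambda>x\<in>{0..}. u x - g x)"
    by (rule restrict_ext) simp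
  then show ?thesis using C0_lincomb[OF assms, of 1 "-1"] by metis
qed

lemma C0_tail:
  assumes "f \<in> C0" "0 < e"
  obtains K where "0 \<le> K" "\<And>x. x \<ge> K \<Longrightarrow> \<bar>f x\<bar> < e"
proof -
  have "\<forall>\<^sub>F x in at_top. \<bar>f x\<bar> < e"
    using tendstoD[OF C0_D(2)[OF assms(1)] assms(2)] by (simp add: dist_real_def)
  then obtain K where K: "\<And>x. x \<ge> K \<Longrightarrow> \<bar>f x\<bar> < e"
    by (auto simp: eventually_at_top_linorder)
  show ?thesis by (rule that[of "max 0 K"]) (auto intro: K)
qed

lemma C0_bounded:
  assumes "f \<in> C0"
  obtains B where "0 < B" "\<And>x. 0 \<le> x \<Longrightarrow> \<bar>f x\<bar> \<le> B"
proof -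
  obtain K where K: "0 \<le> K" "\<And>x. x \<ge> K \<Longrightarrow> \<bar>f x\<bar> < 1"
    using C0_tail[OF assms, of 1] by auto
  have "compact (f ` {0..K})"
    by (intro compact_continuous_image continuous_on_subset[OF C0_D(1)[OF assms]]) auto
  then obtain B where B: "\<And>y. y \<in> f ` {0..K} \<Longrightarrow> norm y \<le> B"
    using compact_imp_bounded bounded_iff by metis
  show ?thesis
  proof (rule that[of "max 1 B"])
    fix x :: real assume "0 \<le> x"
    then show "\<bar>f x\<bar> \<le> max 1 B"
      using K(2)[of x] B[of "f x"] by (cases "x \<le> K") auto
  qed auto
qed

lemma C0_uniformly_continuous:
  assumes "f \<in> C0" "0 < e"
  obtains d where "0 < d" "\<And>x y. 0 \<le> x \<Longrightarrow> 0 \<le> y \<Longrightarrow> \<bar>x - y\<bar> < d \<Longrightarrow> \<bar>f x - f y\<bar> < e"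
proof -
  obtain K where K: "0 \<le> K" "\<And>x. x \<ge> K \<Longrightarrow> \<bar>f x\<bar> < e/2"
    using C0_tail[OF assms(1), of "e/2"] assms(2) by auto
  have "uniformly_continuous_on {0..K+1} f"
    by (intro compact_uniformly_continuous continuous_on_subset[OF C0_D(1)[OF assms(1)]]) auto
  then obtain d where d: "0 < d" "\<And>x y. x \<in> {0..K+1} \<Longrightarrow> y \<in> {0..K+1} \<Longrightarrow> dist y x < d \<Longrightarrow> dist (f y) (f x) < e"
    unfolding uniformly_continuous_on_def using assms(2) by metis
  show ?thesis
  proof (rule that[of "min d 1"])
    fix x y :: real assume xy: "0 \<le> x" "0 \<le> y" "\<bar>x - y\<bar> < min d 1"
    show "\<bar>f x - f y\<bar> < e"
    proof (cases "x \<le> K+1 \<and> y \<le> K+1")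
      case True then show ?thesis using d(2)[of y x] xy by (auto simp: dist_real_def)
    next
      case False
      then have "K \<le> x" "K \<le> y" using xy by linarith+
      then have "\<bar>f x\<bar> < e/2" "\<bar>f y\<bar> < e/2" using K(2) by blast+
      then show ?thesis by linarith
    qed
  qed (use d in auto)
qed

lemma C0_borel_measurable [measurable_dest]:
  assumes "f \<in> C0" shows "f \<in> borel_measurable borel"
proof -
  have "(\<lambda>x. if x \<in> {0..} then f x else undefined) \<in> borel_measurable borel"
    by (intro borel_measurable_continuous_on_if C0_D assms continuous_intros) auto
  also have "(\<lambda>x. if x \<in> {0..} then f x else undefined) = f"
    using assms by (auto simp: C0_def extensional_def fun_eq_iff)
  finally show ?thesis .
qed

lemma C0_exp: "0 < c \<Longrightarrow> (\<lambda>x\<in>{0..}. exp (- (c * x))) \<in> C0" for c :: real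
proof (rule C0_restrictI)
  assume "0 < c"
  then show "((\<lambda>x. exp (- (c * x))) \<longlongrightarrow> 0) at_top"
    by (intro filterlim_compose[OF exp_at_bot])
       (auto intro!: filterlim_compose[OF filterlim_uminus_at_bot_at_top] filterlim_tendsto_pos_mult_at_top[OF tendsto_const] filterlim_ident simp: filterlim_uminus_at_top)
qed (auto intro!: continuous_intros)

lemma C0_mult_bounded:
  assumes f: "f \<in> C0" and g: "continuous_on {0..} g" "\<And>x. 0 \<le> x \<Longrightarrow> \<bar>g x\<bar> \<le> B"
  shows "(\<lambda>x\<in>{0..}. g x * f x) \<in> C0"
proof (rule C0_restrictI)
  show "continuous_on {0..} (\<lambda>x. g x * f x)"
    by (intro continuous_intros g(1) C0_D(1)[OF f])
  show "((\<lambda>x. g x * f x) \<longlongrightarrow> 0) at_top"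
  proof (rule Lim_null_comparison)
    show "\<forall>\<^sub>F x in at_top. norm (g x * f x) \<le> B * \<bar>f x\<bar>"
      using eventually_ge_at_top[of 0]
      by eventually_elim (auto simp: abs_mult intro!: mult_right_mono g)
    show "((\<lambda>x. B * \<bar>f x\<bar>) \<longlongrightarrow> 0) at_top"
      using tendsto_mult_left[OF tendsto_rabs_zero[OF C0_D(2)[OF f]], of B] by simp
  qed
qed

text \<open>After the change of variable \<open>s = exp (- x)\<close> this is Weierstrass on the unit interval.\<close>

lemma C0_exp_dense:
  assumes f: "f \<in> C0" and e: "0 < e"
  obtains a :: "nat \<Rightarrow> real" and N where
    "\<And>x. 0 \<le> x \<Longrightarrow> \<bar>f x - (\<Sum>n=1..N. a n * exp (- (real n * x)))\<bar> \<le> e"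
proof -
  \<comment> \<open>the substitution compactifies the half-line, with the point at infinity sent to 0\<close>
  define g where "g s = (if s \<le> 0 then 0 else f (- ln s))" for s :: real
  have "continuous_on {0..1} g"
    unfolding continuous_on_iff
  proof (intro ballI allI impI)
    fix s d :: real assume s: "s \<in> {0..1}" and d: "0 < d"
    show "\<exists>\<delta>>0. \<forall>x'\<in>{0..1}. dist x' s < \<delta> \<longrightarrow> dist (g x') (g s) < d"
    proof (cases "s = 0")
      case True
      obtain K where K: "0 \<le> K" "\<And>x. x \<ge> K \<Longrightarrow> \<bar>f x\<bar> < d"
        using C0_tail[OF f d] by auto
      have "dist (g t) (g s) < d" if "t \<in> {0..1}" "dist t s < exp (- K)" for t
      proof (cases "t = 0")
        case False
        then have "0 < t" "t < exp (- K)" using that True by (auto simp: dist_real_def)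
        then have "ln t < - K" by (metis ln_exp ln_less_cancel_iff exp_gt_zero)
        then show ?thesis using K(2)[of "- ln t"] \<open>0 < t\<close> True d by (auto simp: g_def dist_real_def)
      qed (use True d in \<open>auto simp: g_def\<close>)
      then show ?thesis by (intro exI[of _ "exp (- K)"]) auto
    next
      case False
      with s have s0: "0 < s" by auto
      have "continuous_on {0<..1} (\<lambda>t. f (- ln t))"
        by (rule continuous_on_compose2[OF C0_D(1)[OF f]]) (auto intro!: continuous_intros simp: ln_le_zero_iff)
      then have "continuous_on {0<..1} g"
        by (rule continuous_on_eq) (auto simp: g_def)
      then obtain \<delta> where \<delta>: "0 < \<delta>" "\<And>t. t \<in> {0<..1} \<Longrightarrow> dist t s < \<delta> \<Longrightarrow> dist (g t) (g s) < d"
        unfolding continuous_on_iff using s0 s d by (metis atLeastAtMost_iff greaterThanAtMost_iff)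
      show ?thesis
        by (rule exI[of _ "min \<delta> s"])
           (use \<delta> s0 in \<open>auto simp: dist_real_def intro!: \<delta>(2)\<close>)
    qed
  qed
  then obtain p where p: "real_polynomial_function p" "\<And>s. s \<in> {0..1} \<Longrightarrow> \<bar>g s - p s\<bar> < e/2"
    using Stone_Weierstrass_real_polynomial_function[of "{0..1}" g "e/2"] e by auto
  from p(1) obtain a N where pa: "p = (\<lambda>s. \<Sum>i\<le>N. a i * s ^ i)"
    by (auto simp: real_polynomial_function_iff_sum)
  have split: "p s = a 0 + (\<Sum>i=1..N. a i * s ^ i)" for s
    by (simp add: pa atMost_atLeast0 sum.atLeast_Suc_atMost)
  \<comment> \<open>the constant term is small because the transformed function vanishes at 0\<close>
  have a0: "\<bar>a 0\<bar> < e/2"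
    using p(2)[of 0] split[of 0] by (simp add: g_def zero_power sum.neutral)
  show ?thesis
  proof (rule that[of a N])
    fix x :: real assume x: "0 \<le> x"
    have "\<bar>f x - (a 0 + (\<Sum>i=1..N. a i * exp (- x) ^ i))\<bar> < e/2"
      using p(2)[of "exp (- x)"] x unfolding split by (simp add: g_def)
    moreover have "(\<Sum>i=1..N. a i * exp (- x) ^ i) = (\<Sum>n=1..N. a n * exp (- (real n * x)))"
      by (simp flip: exp_of_nat_mult)
    ultimately have "\<bar>f x - (a 0 + (\<Sum>n=1..N. a n * exp (- (real n * x))))\<bar> < e/2" by metis
    then show "\<bar>f x - (\<Sum>n=1..N. a n * exp (- (real n * x)))\<bar> \<le> e"
      using a0 by linarith
  qed
qed

lemma C0_sum:
  assumes "\<And>i. i \<in> I \<Longrightarrow> g i \<in> C0"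
  shows "(\<lambda>x\<in>{0..}. \<Sum>i\<in>I. a i * g i x) \<in> C0"
proof (rule C0_restrictI)
  show "continuous_on {0..} (\<lambda>x. \<Sum>i\<in>I. a i * g i x)"
    by (intro continuous_intros C0_D(1)[OF assms])
  have "((\<lambda>x. \<Sum>i\<in>I. a i * g i x) \<longlongrightarrow> (\<Sum>i\<in>I. a i * 0)) at_top"
    by (intro tendsto_intros C0_D(2)[OF assms])
  then show "((\<lambda>x. \<Sum>i\<in>I. a i * g i x) \<longlongrightarrow> 0) at_top" by simp
qed

section \<open>Positive functionals determined by their values on exponentials\<close>

lemma set_integral_abs_le: "\<bar>LBINT x:A. f x\<bar> \<le> (LBINT x:A. \<bar>f x\<bar>)" for f :: "real \<Rightarrow> real"
proof -
  have "\<bar>LBINT x:A. f x\<bar> \<le> (\<integral>x. \<bar>indicator A x *\<^sub>R f x\<bar> \<partial>lborel)"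
    unfolding set_lebesgue_integral_def using integral_norm_bound[of lborel "\<lambda>x. indicator A x *\<^sub>R f x"] by simp
  then show ?thesis by (simp add: set_lebesgue_integral_def abs_mult)
qed

text \<open>The functionals met below are values of a resolvent at a point, and normalised Laplace transforms.\<close>

locale C0_functional =
  fixes \<Lambda> :: "(real \<Rightarrow> real) \<Rightarrow> real"
  assumes lincomb: "f \<in> C0 \<Longrightarrow> g \<in> C0 \<Longrightarrow> \<Lambda> (\<lambda>x\<in>{0..}. a * f x + b * g x) = a * \<Lambda> f + b * \<Lambda> g"
    and bound: "f \<in> C0 \<Longrightarrow> (\<And>x. 0 \<le> x \<Longrightarrow> \<bar>f x\<bar> \<le> B) \<Longrightarrow> \<bar>\<Lambda> f\<bar> \<le> B"
begin

lemma zero: "\<Lambda> (\<lambda>x\<in>{0..}. 0) = 0"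
  using bound[of "\<lambda>x\<in>{0..}. 0" 0] C0_restrictI[of "\<lambda>_. 0"] by simp

lemma sum:
  assumes "finite I" "\<And>i. i \<in> I \<Longrightarrow> g i \<in> C0"
  shows "\<Lambda> (\<lambda>x\<in>{0..}. \<Sum>i\<in>I. a i * g i x) = (\<Sum>i\<in>I. a i * \<Lambda> (g i))"
  using assms
proof (induction I rule: finite_induct)
  case empty then show ?case using zero by (simp add: restrict_def)
next
  case (insert i I)
  have "(\<lambda>x\<in>{0..}. \<Sum>j\<in>insert i I. a j * g j x) =
      (\<lambda>x\<in>{0..}. a i * g i x + 1 * (\<lambda>x\<in>{0..}. \<Sum>j\<in>I. a j * g j x) x)"
    using insert.hyps by (auto simp: restrict_def fun_eq_iff)
  then have "\<Lambda> (\<lambda>x\<in>{0..}. \<Sum>j\<in>insert i I. a j * g j x) =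
      \<Lambda> (\<lambda>x\<in>{0..}. a i * g i x + 1 * (\<lambda>x\<in>{0..}. \<Sum>j\<in>I. a j * g j x) x)" by (rule arg_cong)
  also have "\<dots> = a i * \<Lambda> (g i) + 1 * \<Lambda> (\<lambda>x\<in>{0..}. \<Sum>j\<in>I. a j * g j x)"
    by (intro lincomb C0_sum insert.prems) auto
  finally show ?case using insert.hyps insert.IH insert.prems by (simp del: restrict_apply)
qed

lemma diff_bound:
  assumes "f \<in> C0" "g \<in> C0" "\<And>x. 0 \<le> x \<Longrightarrow> \<bar>f x - g x\<bar> \<le> B"
  shows "\<bar>\<Lambda> f - \<Lambda> g\<bar> \<le> B"
  using bound[OF C0_lincomb[OF assms(1,2), of 1 "-1"], of B] lincomb[OF assms(1,2), of 1 "-1"] assms(3)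
  by simp

text \<open>On the weighted functions \<open>exp (- 2 x) f x\<close> both sides are continuous in the sup norm of \<open>f\<close>, so the
  exponentials decide. The weight outgrows the two terms of the kernels of interest, each of the order of \<open>exp x\<close>; it
  shifts the exponents \<open>n \<ge> 1\<close> of the dense family to \<open>n \<ge> 3\<close>.\<close>

lemma weighted_representation:
  fixes r :: "real \<Rightarrow> real"
  assumes int: "set_integrable lborel {0..} (\<lambda>y. exp (- (2 * y)) * r y)"
    and eq: "\<And>n. 3 \<le> n \<Longrightarrow> \<Lambda> (\<lambda>x\<in>{0..}. exp (- (real n * x))) = (LBINT y:{0..}. exp (- (real n * y)) * r y)"
    and f: "f \<in> C0"
  shows "\<Lambda> (\<lambda>x\<in>{0..}. exp (- (2 * x)) * f x) = (LBINT y:{0..}. f y * (exp (- (2 * y)) * r y))"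
proof -
  let ?w = "\<lambda>y. exp (- (2 * y)) * r y"
  define I where "I = (LBINT y:{0..}. \<bar>?w y\<bar>)"
  have I0: "0 \<le> I" unfolding I_def set_lebesgue_integral_def by (intro Bochner_Integration.integral_nonneg) auto
  have intw: "set_integrable lborel {0..} (\<lambda>y. h y * ?w y)"
    if "h \<in> borel_measurable borel" "\<And>x. 0 \<le> x \<Longrightarrow> \<bar>h x\<bar> \<le> B" for h B
    unfolding set_integrable_def
  proof (rule Bochner_Integration.integrable_bound)
    show "integrable lborel (\<lambda>x. B * (indicator {0..} x *\<^sub>R ?w x))"
      using int unfolding set_integrable_def by (intro integrable_mult_right) auto
    have "(\<lambda>x. h x * (indicator {0..} x *\<^sub>R ?w x)) \<in> borel_measurable borel"
      using int that(1) unfolding set_integrable_def by (intro borel_measurable_times) (auto dest: borel_measurable_integrable)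
    then show "(\<lambda>x. indicat_real {0..} x *\<^sub>R (h x * ?w x)) \<in> borel_measurable lborel"
      by (simp add: mult_ac)
    show "AE x in lborel. norm (indicat_real {0..} x *\<^sub>R (h x * ?w x)) \<le> norm (B * (indicator {0..} x *\<^sub>R ?w x))"
      using order_trans[OF that(2) abs_ge_self] by (auto simp: abs_mult indicator_def intro!: mult_right_mono)
  qed
  have close: "\<bar>\<Lambda> (\<lambda>x\<in>{0..}. exp (- (2 * x)) * f x) - (LBINT y:{0..}. f y * ?w y)\<bar> \<le> e * (1 + I)" if e: "0 < e" for e
  proof -
    obtain a N where aN: "\<And>x. 0 \<le> x \<Longrightarrow> \<bar>f x - (\<Sum>n=1..N. a n * exp (- (real n * x)))\<bar> \<le> e"
      using C0_exp_dense[OF f e] by blast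
    define p where "p = (\<lambda>x. \<Sum>n=1..N. a n * exp (- (real n * x)))"
    define E where "E n = (\<lambda>x\<in>{0..}. exp (- (real n * x)))" for n :: nat
    have E: "E n \<in> C0" if "0 < n" for n unfolding E_def using that by (intro C0_exp) auto
    have expadd: "exp (- (2 * x)) * exp (- (real n * x)) = exp (- (real (n+2) * x))" for n x
      by (simp add: algebra_simps flip: exp_add)
    have p2: "exp (- (2 * x)) * p x = (\<Sum>n=1..N. a n * exp (- (real (n+2) * x)))" for x
      unfolding p_def sum_distrib_left mult.left_commute[of _ "a _"] expadd ..
    have pE: "exp (- (2 * x)) * p x = (\<Sum>n=1..N. a n * E (n + 2) x)" if "0 \<le> x" for x
      using that unfolding p2 by (simp add: E_def)
    have 1: "\<Lambda> (\<lambda>x\<in>{0..}. exp (- (2 * x)) * p x) = (\<Sum>n=1..N. a n * \<Lambda> (E (n + 2)))"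
      using sum[of "{1..N}" "\<lambda>n. E (n+2)" a] E by (simp add: pE cong: restrict_cong)
    have intE: "set_integrable lborel {0..} (\<lambda>y. exp (- (real (n+2) * y)) * r y)" for n
      using intw[of "\<lambda>y. exp (- (real n * y))" 1] expadd[of _ n]
      by (simp add: mult.commute[of "exp (- (real n * _))"] mult.assoc[symmetric] del: of_nat_add)
    have 2: "(LBINT y:{0..}. p y * ?w y) = (\<Sum>n=1..N. a n * (LBINT y:{0..}. exp (- (real (n+2) * y)) * r y))"
    proof -
      have "(LBINT y:{0..}. p y * ?w y) = (LBINT y:{0..}. \<Sum>n=1..N. a n * (exp (- (real (n+2) * y)) * r y))"
      proof (intro set_lebesgue_integral_cong allI impI)
        fix y :: real
        have "p y * ?w y = (exp (- (2 * y)) * p y) * r y" by simp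
        then show "p y * ?w y = (\<Sum>n=1..N. a n * (exp (- (real (n+2) * y)) * r y))"
          unfolding p2 by (simp only: sum_distrib_right mult.assoc)
      qed auto
      also have "\<dots> = (\<Sum>n=1..N. (LBINT y:{0..}. a n * (exp (- (real (n+2) * y)) * r y)))"
        unfolding set_lebesgue_integral_def scaleR_sum_right
        using set_integrable_mult_right[OF intE] unfolding set_integrable_def
        by (intro Bochner_Integration.integral_sum) (metis)
      finally show ?thesis by simp
    qed
    have 3: "\<Lambda> (\<lambda>x\<in>{0..}. exp (- (2 * x)) * p x) = (LBINT y:{0..}. p y * ?w y)"
      unfolding 1 2 E_def by (intro sum.cong refl arg_cong2[where f="(*)"] eq) auto
    have 4: "\<bar>\<Lambda> (\<lambda>x\<in>{0..}. exp (- (2 * x)) * f x) - \<Lambda> (\<lambda>x\<in>{0..}. exp (- (2 * x)) * p x)\<bar> \<le> e"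
    proof (rule diff_bound)
      show "(\<lambda>x\<in>{0..}. exp (- (2 * x)) * f x) \<in> C0"
        by (rule C0_mult_bounded[OF f, of _ 1]) (auto intro!: continuous_intros)
      show "(\<lambda>x\<in>{0..}. exp (- (2 * x)) * p x) \<in> C0"
        using C0_sum[of "{1..N}" "\<lambda>n. E (n+2)" a] E by (simp add: pE cong: restrict_cong)
      fix x :: real assume x: "0 \<le> x"
      have "\<bar>exp (- (2 * x)) * f x - exp (- (2 * x)) * p x\<bar> = exp (- (2 * x)) * \<bar>f x - p x\<bar>"
        by (simp add: abs_mult flip: right_diff_distrib)
      also have "\<dots> \<le> 1 * e" using aN[OF x] x by (intro mult_mono) (auto simp: p_def)
      finally show "\<bar>(\<lambda>x\<in>{0..}. exp (- (2 * x)) * f x) x - (\<lambda>x\<in>{0..}. exp (- (2 * x)) * p x) x\<bar> \<le> e" using x by simp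
    qed
    have 5: "\<bar>(LBINT y:{0..}. f y * ?w y) - (LBINT y:{0..}. p y * ?w y)\<bar> \<le> e * I"
    proof -
      obtain B where B: "\<And>x. 0 \<le> x \<Longrightarrow> \<bar>f x\<bar> \<le> B" using C0_bounded[OF f] by auto
      have pm: "p \<in> borel_measurable borel" unfolding p_def by measurable
      have pB: "\<bar>p x\<bar> \<le> B + e" if "0 \<le> x" for x using aN[OF that] B[OF that] by (simp add: p_def)
      note i = intw[OF C0_borel_measurable[OF f] B] intw[OF pm pB]
      have "\<bar>(LBINT y:{0..}. f y * ?w y) - (LBINT y:{0..}. p y * ?w y)\<bar> = \<bar>LBINT y:{0..}. (f y - p y) * ?w y\<bar>"
        by (simp add: i left_diff_distrib)
      also have "\<dots> \<le> (LBINT y:{0..}. \<bar>(f y - p y) * ?w y\<bar>)"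
        by (rule set_integral_abs_le)
      also have "\<dots> \<le> (LBINT y:{0..}. e * \<bar>?w y\<bar>)"
        using set_integral_diff(1)[OF i] int aN
        by (intro set_integral_mono set_integrable_abs set_integrable_mult_right)
           (auto simp: left_diff_distrib[symmetric] abs_mult p_def intro!: mult_right_mono simp del: mult_eq_0_iff)
      also have "\<dots> = e * I" by (simp add: I_def)
      finally show ?thesis .
    qed
    show ?thesis using 3 4 5 by (simp add: distrib_left)
  qed
  have "\<bar>\<Lambda> (\<lambda>x\<in>{0..}. exp (- (2 * x)) * f x) - (LBINT y:{0..}. f y * ?w y)\<bar> \<le> 0 + e" if "0 < e" for e
    using close[of "e / (1 + I)"] that I0 by simp
  from field_le_epsilon[OF this] show ?thesis by simp
qed

text \<open>A compactly supported function may be divided by the weight.\<close>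

lemma compact_support_representation:
  fixes r :: "real \<Rightarrow> real"
  assumes int: "set_integrable lborel {0..} (\<lambda>y. exp (- (2 * y)) * r y)"
    and eq: "\<And>n. 3 \<le> n \<Longrightarrow> \<Lambda> (\<lambda>x\<in>{0..}. exp (- (real n * x))) = (LBINT y:{0..}. exp (- (real n * y)) * r y)"
    and f: "f \<in> C0" and supp: "\<And>x. K \<le> x \<Longrightarrow> f x = 0"
  shows "\<Lambda> f = (LBINT y:{0..}. f y * r y)"
proof -
  define g where "g = (\<lambda>x\<in>{0..}. exp (2 * x) * f x)"
  have "g \<in> C0" unfolding g_def
  proof (rule C0_restrictI)
    show "continuous_on {0..} (\<lambda>x. exp (2 * x) * f x)"
      by (intro continuous_intros C0_D(1)[OF f])
    show "((\<lambda>x. exp (2 * x) * f x) \<longlongrightarrow> 0) at_top"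
      by (rule tendsto_eventually) (auto intro: eventually_mono[OF eventually_ge_at_top[of K]] simp: supp)
  qed
  from weighted_representation[OF int eq this]
  have "\<Lambda> (\<lambda>x\<in>{0..}. exp (- (2 * x)) * g x) = (LBINT y:{0..}. g y * (exp (- (2 * y)) * r y))" .
  also have "(\<lambda>x\<in>{0..}. exp (- (2 * x)) * g x) = (\<lambda>x\<in>{0..}. f x)"
    by (auto simp: g_def fun_eq_iff restrict_def exp_minus)
  also have "\<dots> = f" by (rule C0_restrict[OF f])
  also have "(LBINT y:{0..}. g y * (exp (- (2 * y)) * r y)) = (LBINT y:{0..}. f y * r y)"
    by (intro set_lebesgue_integral_cong) (auto simp: g_def exp_minus)
  finally show ?thesis .
qed

text \<open>Testing against
  bumps gives the sign of \<open>r\<close>, testing against functions increasing to \<open>1\<close> bounds its integral, and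
  then both sides are continuous in the sup norm on all of \<open>C0\<close>.\<close>

lemma density_representation:
  fixes r :: "real \<Rightarrow> real"
  assumes pos: "\<And>f. f \<in> C0 \<Longrightarrow> (\<And>x. 0 \<le> x \<Longrightarrow> 0 \<le> f x) \<Longrightarrow> 0 \<le> \<Lambda> f"
    and cont: "\<And>y. 0 < y \<Longrightarrow> isCont r y"
    and int: "set_integrable lborel {0..} (\<lambda>y. exp (- (2 * y)) * r y)"
    and eq: "\<And>n. 3 \<le> n \<Longrightarrow> \<Lambda> (\<lambda>x\<in>{0..}. exp (- (real n * x))) = (LBINT y:{0..}. exp (- (real n * y)) * r y)"
  shows "set_integrable lborel {0..} r"
    and "f \<in> C0 \<Longrightarrow> \<Lambda> f = (LBINT y:{0..}. f y * r y)"
    and "0 < y \<Longrightarrow> 0 \<le> r y"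
proof -
  note rep = compact_support_representation[OF int eq]
  have r_borel: "(\<lambda>y. indicator {0..} y * r y) \<in> borel_measurable borel"
  proof -
    have "(\<lambda>y. exp (2 * y) * (indicator {0..} y *\<^sub>R (exp (- (2 * y)) * r y))) \<in> borel_measurable borel"
      using borel_measurable_integrable[OF int[unfolded set_integrable_def]] by measurable
    then show ?thesis by (simp add: exp_minus field_simps)
  qed
  have intr: "set_integrable lborel {0..} (\<lambda>y. f y * r y)"
    if f: "f \<in> borel_measurable borel" "\<And>y. 0 \<le> y \<Longrightarrow> \<bar>f y\<bar> \<le> B" "\<And>y. K \<le> y \<Longrightarrow> f y = 0" for f B K
    unfolding set_integrable_def
  proof (rule Bochner_Integration.integrable_bound)
    show "integrable lborel (\<lambda>y. (B * exp (2 * K)) * (indicator {0..} y *\<^sub>R (exp (- (2 * y)) * r y)))"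
      using int unfolding set_integrable_def by (intro integrable_mult_right) auto
    have "(\<lambda>x. f x * (indicator {0..} x * r x)) \<in> borel_measurable borel"
      using f(1) r_borel by measurable
    then show "(\<lambda>x. indicat_real {0..} x *\<^sub>R (f x * r x)) \<in> borel_measurable lborel"
      by (simp add: mult_ac)
    show "AE y in lborel. norm (indicat_real {0..} y *\<^sub>R (f y * r y)) \<le> norm ((B * exp (2 * K)) * (indicator {0..} y *\<^sub>R (exp (- (2 * y)) * r y)))"
    proof (intro AE_I2)
      fix y
      show "norm (indicat_real {0..} y *\<^sub>R (f y * r y)) \<le> norm ((B * exp (2 * K)) * (indicator {0..} y *\<^sub>R (exp (- (2 * y)) * r y)))"
      proof (cases "0 \<le> y \<and> y < K")
        case True
        then have "\<bar>f y\<bar> * 1 \<le> \<bar>B\<bar> * exp (2 * K - 2 * y)"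
          using f(2)[of y] by (intro mult_mono) auto
        then have "\<bar>f y\<bar> * \<bar>r y\<bar> \<le> \<bar>B\<bar> * exp (2 * K - 2 * y) * \<bar>r y\<bar>"
          by (intro mult_right_mono) auto
        then show ?thesis using True by (simp add: abs_mult exp_diff exp_minus field_simps)
      qed (use f(3)[of y] in \<open>auto simp: indicator_def\<close>)
    qed
  qed
  have r0: "0 \<le> r y" if y: "0 < y" for y
  proof (rule ccontr)
    assume "\<not> 0 \<le> r y"
    then have "\<forall>\<^sub>F z in at y. r z < r y / 2"
      using cont[OF y] by (intro order_tendstoD(2)[of r "r y"]) (auto simp: isCont_def)
    then obtain d where d: "0 < d" "\<And>z. z \<noteq> y \<Longrightarrow> dist z y < d \<Longrightarrow> r z < r y / 2"
      by (auto simp: eventually_at)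
    define e where "e = min d y / 2"
    have e: "0 < e" "e < d" "e < y" using d y by (auto simp: e_def)
    define c where "c = - r y / 2"
    have c: "0 < c" using \<open>\<not> 0 \<le> r y\<close> by (simp add: c_def)
    have rc: "r z \<le> - c" if "\<bar>z - y\<bar> \<le> e" for z
      using d(2)[of z] that e c by (cases "z = y") (auto simp: c_def dist_real_def)
    \<comment> \<open>a tent supported where \<open>r\<close> is at most \<open>- c\<close>\<close>
    define b where "b = (\<lambda>x\<in>{0..}. max 0 (e - \<bar>x - y\<bar>))"
    have b: "b \<in> C0" unfolding b_def
    proof (rule C0_restrictI)
      show "((\<lambda>x. max 0 (e - \<bar>x - y\<bar>)) \<longlongrightarrow> 0) at_top"
        by (rule tendsto_eventually) (auto intro: eventually_mono[OF eventually_ge_at_top[of "y + e"]])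
    qed (intro continuous_intros)
    have bs: "b x = 0" if "y + e \<le> x" for x using that e y by (auto simp: b_def)
    have "0 \<le> \<Lambda> b" by (rule pos[OF b]) (auto simp: b_def)
    also have "\<Lambda> b = (LBINT z:{0..}. b z * r z)" by (rule rep[OF _ b bs]) 
    also have "\<dots> \<le> (LBINT z:{0..}. - (c * e / 2) * indicator {y - e/2..y + e/2} z)"
    proof (rule set_integral_mono)
      show "set_integrable lborel {0..} (\<lambda>z. b z * r z)"
        by (rule intr[of _ e "y+e"]) (use C0_borel_measurable[OF b] bs e in \<open>auto simp: b_def\<close>)
      show "set_integrable lborel {0..} (\<lambda>z. - (c * e / 2) * indicator {y - e/2..y + e/2} z)"
        unfolding set_integrable_def using e
        by (intro integrable_mult_indicator) auto
      fix z :: real assume z: "z \<in> {0..}"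
      show "b z * r z \<le> - (c * e / 2) * indicator {y - e/2..y + e/2} z"
      proof (cases "\<bar>z - y\<bar> \<le> e")
        case True
        have "b z * r z \<le> b z * (- c)" using rc[OF True] z by (intro mult_left_mono) (auto simp: b_def)
        also have "\<dots> \<le> - (c * e / 2) * indicator {y - e/2..y + e/2} z"
        proof (cases "z \<in> {y - e/2..y + e/2}")
          case True
          then have "y - e/2 \<le> z" "z \<le> y + e/2" by simp_all
          then have "\<bar>z - y\<bar> \<le> e / 2" by linarith
          then have "e / 2 \<le> b z" using z e by (auto simp: b_def)
          then have "c * (e/2) \<le> c * b z" using c by (intro mult_left_mono) auto
          then show ?thesis using True by (simp add: mult_ac)
        next
          case False
          have "0 \<le> b z * c" using c z by (auto simp: b_def intro!: mult_nonneg_nonneg)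
          then show ?thesis using False by simp
        qed
        finally show ?thesis .
      next
        case False
        then have "b z = 0" "z \<notin> {y - e/2..y + e/2}" using z e by (auto simp: b_def)
        then show ?thesis by simp
      qed
    qed
    also have "\<dots> = - (c * e / 2) * e"
    proof -
      have "(\<lambda>z. indicator {0..} z *\<^sub>R (- (c * e / 2) * indicator {y - e/2..y + e/2} z)) =
          (\<lambda>z. - (c * e / 2) * indicat_real {y - e/2..y + e/2} z)"
        using e by (auto simp: indicator_def fun_eq_iff)
      then show ?thesis using e by (simp add: set_lebesgue_integral_def)
    qed
    also have "\<dots> < 0" using c e by simp
    finally show False by simp
  qed
  then show "0 < y \<Longrightarrow> 0 \<le> r y" .
  \<comment> \<open>cutoffs increasing to 1\<close>
  define \<phi> where "\<phi> n = (\<lambda>x\<in>{0..}. max 0 (min 1 (real n + 1 - x)))" for n :: nat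
  have \<phi>: "\<phi> n \<in> C0" for n unfolding \<phi>_def
  proof (rule C0_restrictI)
    show "((\<lambda>x. max 0 (min 1 (real n + 1 - x))) \<longlongrightarrow> 0) at_top"
      by (rule tendsto_eventually) (auto intro: eventually_mono[OF eventually_ge_at_top[of "real n + 1"]])
  qed (intro continuous_intros)
  have \<phi>01: "0 \<le> \<phi> n x" "\<phi> n x \<le> 1" if "0 \<le> x" for n x using that by (auto simp: \<phi>_def)
  have \<phi>s: "\<phi> n x = 0" if "real n + 1 \<le> x" for n x using that by (auto simp: \<phi>_def)
  have \<phi>i: "set_integrable lborel {0..} (\<lambda>y. \<phi> n y * r y)" for n
    by (rule intr[of _ 1 "real n + 1"]) (use C0_borel_measurable[OF \<phi>] \<phi>s \<phi>01 in \<open>auto simp: abs_le_iff intro: order_trans[of _ 0]\<close>)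
  have \<phi>lim: "(\<lambda>n. \<phi> n x) \<longlonglongrightarrow> 1" if "0 \<le> x" for x
  proof (rule tendsto_eventually)
    show "\<forall>\<^sub>F n in sequentially. \<phi> n x = 1"
      using eventually_ge_at_top[of "nat \<lceil>x\<rceil>"] by eventually_elim (use that in \<open>auto simp: \<phi>_def\<close>)
  qed
  have bnd: "(LBINT y:{0..}. \<phi> n y * r y) \<le> 1" for n
  proof -
    have "\<bar>\<Lambda> (\<phi> n)\<bar> \<le> 1" by (rule bound[OF \<phi>]) (use \<phi>01 in \<open>auto simp: abs_le_iff intro: order_trans[of _ 0]\<close>)
    then show ?thesis using rep[OF _ \<phi> \<phi>s] by simp
  qed
  have ae0: "AE y in lborel. y \<noteq> (0::real)" by (rule AE_lborel_singleton)
  show ir: "set_integrable lborel {0..} r"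
  proof -
    have mono: "mono (\<lambda>n. \<phi> n y * r y)" if "0 < y" for y
      using that r0[OF that] by (intro monoI mult_right_mono) (auto simp: \<phi>_def)
    have "convergent (\<lambda>n. LBINT y:{0..}. \<phi> n y * r y)"
    proof (rule Bseq_mono_convergent)
      have le: "(LBINT y:{0..}. \<phi> m y * r y) \<le> (LBINT y:{0..}. \<phi> n y * r y)" if "m \<le> n" for m n
        by (rule set_integral_mono_AE[OF \<phi>i \<phi>i], rule AE_mp[OF ae0], rule AE_I2)
          (use mono that in \<open>auto simp: mono_def\<close>)
      show "\<forall>m n. m \<le> n \<longrightarrow> (LBINT y:{0..}. \<phi> m y * r y) \<le> (LBINT y:{0..}. \<phi> n y * r y)" using le by blast
      show "Bseq (\<lambda>n. LBINT y:{0..}. \<phi> n y * r y)"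
        proof (rule BseqI')
        fix n
        show "norm (LBINT y:{0..}. \<phi> n y * r y) \<le> 1 + \<bar>LBINT y:{0..}. \<phi> 0 y * r y\<bar>"
          using bnd[of n] le[of 0 n] unfolding real_norm_def by linarith
      qed
    qed
    then obtain L where L: "(\<lambda>n. LBINT y:{0..}. \<phi> n y * r y) \<longlonglongrightarrow> L" by (auto simp: convergent_def)
    show ?thesis unfolding set_integrable_def
    proof (rule integrable_monotone_convergence[OF _ _ _ L[unfolded set_lebesgue_integral_def]])
      show "integrable lborel (\<lambda>x. indicat_real {0..} x *\<^sub>R (\<phi> n x * r x))" for n
        using \<phi>i unfolding set_integrable_def .
      show "AE x in lborel. mono (\<lambda>n. indicat_real {0..} x *\<^sub>R (\<phi> n x * r x))"
        by (rule AE_mp[OF ae0], rule AE_I2) (use mono in \<open>auto simp: mono_def indicator_def\<close>)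
      show "AE x in lborel. (\<lambda>n. indicat_real {0..} x *\<^sub>R (\<phi> n x * r x)) \<longlonglongrightarrow> indicat_real {0..} x *\<^sub>R r x"
        using tendsto_mult_right[OF \<phi>lim, of _ "r _"] by (intro AE_I2) (auto simp: indicator_def)
      show "(\<lambda>x. indicat_real {0..} x *\<^sub>R r x) \<in> borel_measurable lborel" using r_borel by simp
    qed
  qed
  show "\<Lambda> f = (LBINT y:{0..}. f y * r y)" if f: "f \<in> C0"
  proof -
    obtain B where B: "0 < B" "\<And>x. 0 \<le> x \<Longrightarrow> \<bar>f x\<bar> \<le> B" using C0_bounded[OF f] by auto
    define g where "g n = (\<lambda>x\<in>{0..}. \<phi> n x * f x)" for n
    have g: "g n \<in> C0" for n unfolding g_def
      by (rule C0_mult_bounded[OF f C0_D(1)[OF \<phi>], of _ 1]) (use \<phi>01 in \<open>auto simp: abs_le_iff intro: order_trans[of _ 0]\<close>)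
    have gB: "\<bar>g n x\<bar> \<le> B" if "0 \<le> x" for n x
      using mult_mono[of "\<bar>\<phi> n x\<bar>" 1 "\<bar>f x\<bar>" B] \<phi>01[OF that, of n] B(2)[OF that] that by (auto simp: g_def abs_mult)
    have "(\<lambda>n. \<Lambda> (g n)) \<longlonglongrightarrow> \<Lambda> f"
    proof (rule LIMSEQ_I)
      fix e :: real assume e: "0 < e"
      obtain K where K: "0 \<le> K" "\<And>x. K \<le> x \<Longrightarrow> \<bar>f x\<bar> < e/2" using C0_tail[OF f, of "e/2"] e by auto
      have "norm (\<Lambda> (g n) - \<Lambda> f) < e" if n: "nat \<lceil>K\<rceil> \<le> n" for n
      proof -
        have "\<bar>\<Lambda> (g n) - \<Lambda> f\<bar> \<le> e/2"
        proof (rule diff_bound[OF g f])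
          fix x :: real assume x: "0 \<le> x"
          have eq: "g n x - f x = - ((1 - \<phi> n x) * f x)" using x by (simp add: g_def algebra_simps)
          show "\<bar>g n x - f x\<bar> \<le> e/2"
          proof (cases "x \<le> K")
            case True
            then have "\<phi> n x = 1" using n x by (auto simp: \<phi>_def)
            then show ?thesis using e by (simp add: eq)
          next
            case False
            then have "\<bar>1 - \<phi> n x\<bar> * \<bar>f x\<bar> \<le> 1 * (e/2)"
              using \<phi>01[OF x, of n] K(2)[of x] by (intro mult_mono) auto
            then show ?thesis by (simp add: eq abs_mult)
          qed
        qed
        then show ?thesis using e by simp
      qed
      then show "\<exists>no. \<forall>n\<ge>no. norm (\<Lambda> (g n) - \<Lambda> f) < e" by blast
    qed
    moreover have "(\<lambda>n. \<Lambda> (g n)) \<longlonglongrightarrow> (LBINT y:{0..}. f y * r y)"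
    proof -
      have "(\<lambda>n. LBINT y:{0..}. g n y * r y) \<longlonglongrightarrow> (LBINT y:{0..}. f y * r y)"
        unfolding set_lebesgue_integral_def
      proof (rule integral_dominated_convergence)
        show "integrable lborel (\<lambda>y. B * \<bar>indicator {0..} y *\<^sub>R r y\<bar>)"
          using ir unfolding set_integrable_def by (intro integrable_mult_right integrable_abs) auto
        have m: "(\<lambda>x. h x * (indicator {0..} x * r x)) \<in> borel_measurable borel" if "h \<in> borel_measurable borel" for h
          using that r_borel by measurable
        show "(\<lambda>x. indicat_real {0..} x *\<^sub>R (f x * r x)) \<in> borel_measurable lborel"
          "(\<lambda>x. indicat_real {0..} x *\<^sub>R (g n x * r x)) \<in> borel_measurable lborel" for n
          using m[OF C0_borel_measurable[OF f]] m[OF C0_borel_measurable[OF g]] by (simp_all add: mult_ac)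
        show "AE x in lborel. norm (indicat_real {0..} x *\<^sub>R (g n x * r x)) \<le> B * \<bar>indicat_real {0..} x *\<^sub>R r x\<bar>" for n
          using gB by (intro AE_I2) (auto simp: indicator_def abs_mult intro!: mult_right_mono)
        show "AE x in lborel. (\<lambda>n. indicat_real {0..} x *\<^sub>R (g n x * r x)) \<longlonglongrightarrow> indicat_real {0..} x *\<^sub>R (f x * r x)"
        proof (intro AE_I2)
          fix x
          show "(\<lambda>n. indicat_real {0..} x *\<^sub>R (g n x * r x)) \<longlonglongrightarrow> indicat_real {0..} x *\<^sub>R (f x * r x)"
            using tendsto_mult_right[OF \<phi>lim, of x "f x * r x"] by (auto simp: indicator_def g_def mult_ac)
        qed
      qed
      also have "(\<lambda>n. LBINT y:{0..}. g n y * r y) = (\<lambda>n. \<Lambda> (g n))"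
      proof
        fix n
        show "(LBINT y:{0..}. g n y * r y) = \<Lambda> (g n)"
          by (rule rep[OF _ g, symmetric, of "real n + 1"]) (auto simp: g_def \<phi>s)
      qed
      finally show ?thesis .
    qed
    ultimately show ?thesis by (rule LIMSEQ_unique)
  qed
qed

end

text \<open>Apply the representation of the zero functional to \<open>w\<close> and to \<open>- w\<close>: both are nonnegative.\<close>

lemma laplace_unique:
  fixes w :: "real \<Rightarrow> real"
  assumes cont: "continuous_on {0..} w"
    and int: "set_integrable lborel {0..} (\<lambda>y. exp (- (2 * y)) * w y)"
    and zero: "\<And>n. 3 \<le> n \<Longrightarrow> (LBINT y:{0..}. exp (- (real n * y)) * w y) = 0"
    and x: "0 \<le> x"
  shows "w x = 0"
proof -
  interpret N: C0_functional "\<lambda>_. 0" by unfold_locales (auto intro: order_trans[OF abs_ge_zero])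
  have isC: "isCont w y" if "0 < y" for y
    using continuous_on_interior[OF cont, of y] that by (simp add: interior_real_atLeast)
  have pos: "w y = 0" if y: "0 < y" for y
  proof -
    have "0 \<le> w y"
    proof (rule N.density_representation(3)[OF _ isC int _ y])
      show "0 = (LBINT y:{0..}. exp (- (real n * y)) * w y)" if "3 \<le> n" for n
        using zero[OF that] by simp
    qed auto
    moreover have "0 \<le> - w y"
    proof (rule N.density_representation(3)[OF _ _ _ _ y, of "\<lambda>y. - w y"])
      show "set_integrable lborel {0..} (\<lambda>y. exp (- (2 * y)) * - w y)"
        using int unfolding set_integrable_def by simp
      show "0 = (LBINT y:{0..}. exp (- (real n * y)) * - w y)" if "3 \<le> n" for n
        using zero[OF that] by (simp add: set_lebesgue_integral_def)
    qed (use isC in auto)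
    ultimately show ?thesis by simp
  qed
  have "x \<in> closure {0<..}" using x by simp
  then show ?thesis
    by (rule continuous_constant_on_closure[rotated 2]) (use cont pos in auto)
qed

section \<open>The Mittag-Leffler function\<close>

lemma nn_integral_laplace_powr:
  fixes \<theta> s :: real
  assumes \<theta>: "0 < \<theta>" and s: "0 < s"
  shows "(\<integral>\<^sup>+t. ennreal (indicator {0..} t * (exp (- (\<theta> * t)) * (t powr (s - 1) / Gamma s))) \<partial>lborel) = ennreal (\<theta> powr - s)"
proof -
  let ?K = "\<lambda>t. indicator {0..} t * (exp (- (\<theta> * t)) * (t powr (s - 1) / Gamma s))"
  let ?I = "\<integral>\<^sup>+t. ennreal (?K t) \<partial>lborel"
  have G: "0 < Gamma s" using s by simp
  have "ennreal (Gamma s) = (\<integral>\<^sup>+t. ennreal (indicator {0..} t * t powr (s - 1) / exp t) \<partial>lborel)"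
    by (rule Gamma_conv_nn_integral_real[OF s])
  also have "\<dots> = ennreal \<bar>\<theta>\<bar> * (\<integral>\<^sup>+t. ennreal (indicator {0..} (0 + \<theta> * t) * (0 + \<theta> * t) powr (s - 1) / exp (0 + \<theta> * t)) \<partial>lborel)"
    by (rule nn_integral_real_affine) (use \<theta> in auto)
  also have "(\<integral>\<^sup>+t. ennreal (indicator {0..} (0 + \<theta> * t) * (0 + \<theta> * t) powr (s - 1) / exp (0 + \<theta> * t)) \<partial>lborel)
      = (\<integral>\<^sup>+t. ennreal (\<theta> powr (s - 1) * Gamma s) * ennreal (?K t) \<partial>lborel)"
  proof (rule nn_integral_cong)
    fix t :: real
    have "indicator {0..} (0 + \<theta> * t) * (0 + \<theta> * t) powr (s - 1) / exp (0 + \<theta> * t) = (\<theta> powr (s - 1) * Gamma s) * ?K t"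
    proof (cases "0 \<le> t")
      case True
      then show ?thesis using \<theta> G by (simp add: powr_mult exp_minus divide_inverse)
    next
      case False
      then have "\<theta> * t < 0" using \<theta> by (simp add: mult_pos_neg)
      then show ?thesis using False by simp
    qed
    moreover have "0 \<le> ?K t" using G by simp
    ultimately show "ennreal (indicator {0..} (0 + \<theta> * t) * (0 + \<theta> * t) powr (s - 1) / exp (0 + \<theta> * t))
        = ennreal (\<theta> powr (s - 1) * Gamma s) * ennreal (?K t)"
      using \<theta> G by (simp only: ennreal_mult[symmetric] mult_nonneg_nonneg powr_ge_zero less_imp_le)
  qed
  also have "\<dots> = ennreal (\<theta> powr (s - 1) * Gamma s) * ?I"
    by (rule nn_integral_cmult) measurable
  finally have eq: "ennreal \<bar>\<theta>\<bar> * (ennreal (\<theta> powr (s - 1) * Gamma s) * ?I) = ennreal (Gamma s)" ..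
  have c: "(\<theta> powr - s / Gamma s) * (\<bar>\<theta>\<bar> * (\<theta> powr (s - 1) * Gamma s)) = 1"
  proof -
    have "\<theta> * (\<theta> powr - s * \<theta> powr (s - 1)) = 1"
      using \<theta> by (simp add: powr_minus powr_diff field_simps)
    then show ?thesis using \<theta> G by (simp add: mult_ac)
  qed
  have "?I = ennreal ((\<theta> powr - s / Gamma s) * (\<bar>\<theta>\<bar> * (\<theta> powr (s - 1) * Gamma s))) * ?I"
    unfolding c by simp
  also have "\<dots> = ennreal (\<theta> powr - s / Gamma s) * (ennreal \<bar>\<theta>\<bar> * (ennreal (\<theta> powr (s - 1) * Gamma s) * ?I))"
    using \<theta> G by (simp only: ennreal_mult mult_nonneg_nonneg powr_ge_zero less_imp_le abs_ge_zero divide_nonneg_nonneg mult.assoc)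
  also have "\<dots> = ennreal ((\<theta> powr - s / Gamma s) * Gamma s)"
    unfolding eq using G by (simp only: ennreal_mult powr_ge_zero less_imp_le divide_nonneg_nonneg)
  also have "(\<theta> powr - s / Gamma s) * Gamma s = \<theta> powr - s" using G by simp
  finally show ?thesis .
qed

text \<open>Series with nonnegative terms, so transforming termwise is Tonelli.\<close>

lemma laplace_powr_series:
  fixes \<theta> :: real and \<beta> :: "nat \<Rightarrow> real"
  assumes \<theta>: "0 < \<theta>" and \<beta>: "\<And>n. 0 < \<beta> n"
    and f: "\<And>x. 0 < x \<Longrightarrow> (\<lambda>n. x powr (\<beta> n - 1) / Gamma (\<beta> n)) sums f x"
    and S: "(\<lambda>n. \<theta> powr - \<beta> n) sums S"
  shows "has_bochner_integral lborel (\<lambda>x. indicator {0..} x * (exp (- (\<theta> * x)) * f x)) S"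
proof -
  define h where "h n x = indicator {0..} x * (exp (- (\<theta> * x)) * (x powr (\<beta> n - 1) / Gamma (\<beta> n)))" for n x
  define g where "g x = (if 0 < x then \<Sum>n. h n x else 0)" for x
  have h0: "0 \<le> h n x" for n x using Gamma_real_pos[OF \<beta>[of n]] by (auto simp: h_def indicator_def)
  have hs: "(\<lambda>n. h n x) sums (exp (- (\<theta> * x)) * f x)" if "0 < x" for x
    using sums_mult[OF f[OF that], of "exp (- (\<theta> * x))"] that by (simp add: h_def)
  have S0: "0 \<le> S" using sums_le[OF _ sums_zero S] by simp
  have "(\<integral>\<^sup>+x. ennreal (g x) \<partial>lborel) = (\<integral>\<^sup>+x. (\<Sum>n. ennreal (h n x)) \<partial>lborel)"
  proof (rule nn_integral_cong_AE)
    show "AE x in lborel. ennreal (g x) = (\<Sum>n. ennreal (h n x))"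
      using AE_lborel_singleton[of 0]
    proof eventually_elim
      fix x :: real assume "x \<noteq> 0"
      then consider "0 < x" | "x < 0" by linarith
      then show "ennreal (g x) = (\<Sum>n. ennreal (h n x))"
      proof cases
        case 1 then show ?thesis using h0 hs[OF 1] by (subst suminf_ennreal2) (auto simp: g_def sums_iff)
      next
        case 2 then show ?thesis by (simp add: g_def h_def)
      qed
    qed
  qed
  also have "\<dots> = (\<Sum>n. \<integral>\<^sup>+x. ennreal (h n x) \<partial>lborel)"
    by (rule nn_integral_suminf) (simp add: h_def)
  also have "\<dots> = (\<Sum>n. ennreal (\<theta> powr - \<beta> n))"
    unfolding h_def by (simp only: nn_integral_laplace_powr[OF \<theta> \<beta>])
  also have "\<dots> = ennreal S"
    using S by (subst suminf_ennreal2) (auto simp: sums_iff)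
  finally have nn: "(\<integral>\<^sup>+x. ennreal (g x) \<partial>lborel) = ennreal S" .
  have "0 \<le> g x" for x
  proof (cases "0 < x")
    case True
    then show ?thesis using suminf_nonneg[OF sums_summable[OF hs[OF True]] h0] by (simp add: g_def)
  qed (simp add: g_def)
  moreover have "g \<in> borel_measurable lborel" unfolding g_def h_def by measurable
  ultimately have "has_bochner_integral lborel g S"
    using nn S0 by (intro has_bochner_integral_nn_integral) auto
  then show ?thesis
    by (subst has_bochner_integral_discrete_difference[of "{0}" _ _ g])
       (use hs in \<open>auto simp: g_def indicator_def sums_iff\<close>)
qed

text \<open>\<open>F\<^sub>\<alpha>\<close> is a power series in \<open>x\<^sup>\<alpha>\<close> and is differentiated as such; \<open>ml0\<close>, \<open>ml1\<close> and \<open>ml2\<close> are the power series of \<open>E\<^sub>\<alpha>\<close> and its first two derivatives.\<close>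

definition ml_coeff :: "real \<Rightarrow> nat \<Rightarrow> real" where "ml_coeff \<alpha> n = 1 / Gamma (\<alpha> * real n + 1)"

text \<open>Compare with the exponential series: \<open>\<Gamma>\<close> is increasing on \<open>[3/2, \<infinity>)\<close>, so \<open>\<Gamma>(\<alpha> n + 1) \<ge> n!\<close>.\<close>

lemma summable_ml:
  assumes \<alpha>: "1 < \<alpha>"
  shows "summable (\<lambda>n. ml_coeff \<alpha> n * y ^ n)"
proof (rule summable_comparison_test)
  show "summable (\<lambda>n. inverse (fact n) * \<bar>y\<bar> ^ n)" by (rule summable_exp)
  have "norm (ml_coeff \<alpha> n * y ^ n) \<le> inverse (fact n) * \<bar>y\<bar> ^ n" if n: "1 \<le> n" for n
  proof -
    have 1: "real n + 1 < \<alpha> * real n + 1" using \<alpha> n by simp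
    have "fact n = Gamma (real n + 1)" by (simp add: Gamma_fact add.commute)
    also have "\<dots> < Gamma (\<alpha> * real n + 1)" by (rule Gamma_real_strict_mono[OF _ 1]) (use n in simp)
    finally have "inverse (Gamma (\<alpha> * real n + 1)) \<le> inverse (fact n)" by (intro le_imp_inverse_le) auto
    from mult_right_mono[OF this, of "\<bar>y\<bar> ^ n"] show ?thesis
      using 1 by (simp add: ml_coeff_def abs_mult power_abs inverse_eq_divide)
  qed
  then show "\<exists>N. \<forall>n\<ge>N. norm (ml_coeff \<alpha> n * y ^ n) \<le> inverse (fact n) * \<bar>y\<bar> ^ n" by blast
qed

definition ml0 where "ml0 \<alpha> y = (\<Sum>n. ml_coeff \<alpha> n * y ^ n)"
definition ml1 where "ml1 \<alpha> y = (\<Sum>n. diffs (ml_coeff \<alpha>) n * y ^ n)"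
definition ml2 where "ml2 \<alpha> y = (\<Sum>n. diffs (diffs (ml_coeff \<alpha>)) n * y ^ n)"

context
  fixes \<alpha> :: real
  assumes \<alpha>: "1 < \<alpha>"
begin

lemma summable_ml1: "summable (\<lambda>n. diffs (ml_coeff \<alpha>) n * y ^ n)"
  by (rule termdiff_converges_all) (rule summable_ml[OF \<alpha>])

lemma ml0_deriv: "(ml0 \<alpha> has_field_derivative ml1 \<alpha> y) (at y)"
  unfolding ml0_def[abs_def] ml1_def by (rule termdiffs_strong_converges_everywhere) (rule summable_ml[OF \<alpha>])

lemma ml1_deriv: "(ml1 \<alpha> has_field_derivative ml2 \<alpha> y) (at y)"
  unfolding ml1_def[abs_def] ml2_def by (rule termdiffs_strong_converges_everywhere) (rule summable_ml1)

lemma ml2_isCont: "isCont (ml2 \<alpha>) y"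
  unfolding ml2_def[abs_def]
  by (rule DERIV_isCont, rule termdiffs_strong_converges_everywhere, rule termdiff_converges_all, rule summable_ml1)

lemma FML_eq: "FML \<alpha> x = ml0 \<alpha> (x powr \<alpha>)"
  by (simp add: FML_def mittag_leffler_def ml0_def ml_coeff_def)

lemma FML_deriv: 
  assumes "0 < x"
  shows "(FML \<alpha> has_field_derivative \<alpha> * x powr (\<alpha> - 1) * ml1 \<alpha> (x powr \<alpha>)) (at x)"
  unfolding FML_eq[abs_def]
  by (rule DERIV_cong[OF DERIV_chain2[OF ml0_deriv has_real_derivative_powr]]) (use assms in auto)

lemma deriv_FML: "0 < x \<Longrightarrow> FML' \<alpha> x = \<alpha> * x powr (\<alpha> - 1) * ml1 \<alpha> (x powr \<alpha>)"
  by (rule DERIV_imp_deriv[OF FML_deriv])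

lemma deriv_FML_deriv:
  assumes x: "0 < x"
  shows "(FML' \<alpha> has_field_derivative
    (\<alpha> * (\<alpha> - 1) * x powr (\<alpha> - 2) * ml1 \<alpha> (x powr \<alpha>) + \<alpha>\<^sup>2 * x powr (2 * \<alpha> - 2) * ml2 \<alpha> (x powr \<alpha>))) (at x)"
proof (rule has_field_derivative_transform_within_open[of _ _ _ "{0<..}"])
  have "((\<lambda>x. \<alpha> * x powr (\<alpha> - 1) * ml1 \<alpha> (x powr \<alpha>)) has_field_derivative
      \<alpha> * x powr (\<alpha> - 1) * (ml2 \<alpha> (x powr \<alpha>) * (\<alpha> * x powr (\<alpha> - 1)))
      + \<alpha> * ((\<alpha> - 1) * x powr (\<alpha> - 1 - 1)) * ml1 \<alpha> (x powr \<alpha>)) (at x)"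
    by (rule DERIV_mult'[OF DERIV_cmult[OF has_real_derivative_powr] DERIV_chain2[OF ml1_deriv has_real_derivative_powr]])
       (use x in auto)
  moreover have "x powr (\<alpha> - 1) * x powr (\<alpha> - 1) = x powr (2 * \<alpha> - 2)"
    using x by (simp flip: powr_add)
  then have "\<alpha> * x powr (\<alpha> - 1) * (ml2 \<alpha> (x powr \<alpha>) * (\<alpha> * x powr (\<alpha> - 1))) = \<alpha>\<^sup>2 * x powr (2 * \<alpha> - 2) * ml2 \<alpha> (x powr \<alpha>)"
    by (simp add: power2_eq_square mult_ac)
  moreover have "\<alpha> * ((\<alpha> - 1) * x powr (\<alpha> - 1 - 1)) * ml1 \<alpha> (x powr \<alpha>) = \<alpha> * (\<alpha> - 1) * x powr (\<alpha> - 2) * ml1 \<alpha> (x powr \<alpha>)"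
    by simp
  ultimately show "((\<lambda>x. \<alpha> * x powr (\<alpha> - 1) * ml1 \<alpha> (x powr \<alpha>)) has_field_derivative
    (\<alpha> * (\<alpha> - 1) * x powr (\<alpha> - 2) * ml1 \<alpha> (x powr \<alpha>) + \<alpha>\<^sup>2 * x powr (2 * \<alpha> - 2) * ml2 \<alpha> (x powr \<alpha>))) (at x)"
    by (simp only: add.commute)
qed (use x in \<open>auto simp: deriv_FML\<close>)

lemma deriv2_FML:
  "0 < x \<Longrightarrow> FML'' \<alpha> x =
    \<alpha> * (\<alpha> - 1) * x powr (\<alpha> - 2) * ml1 \<alpha> (x powr \<alpha>) + \<alpha>\<^sup>2 * x powr (2 * \<alpha> - 2) * ml2 \<alpha> (x powr \<alpha>)"
  by (rule DERIV_imp_deriv[OF deriv_FML_deriv])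

lemma isCont_deriv2_FML:
  assumes x: "0 < x"
  shows "isCont (FML'' \<alpha>) x"
proof -
  have "isCont (\<lambda>x. \<alpha> * (\<alpha> - 1) * x powr (\<alpha> - 2) * ml1 \<alpha> (x powr \<alpha>) + \<alpha>\<^sup>2 * x powr (2 * \<alpha> - 2) * ml2 \<alpha> (x powr \<alpha>)) x"
    using x by (intro continuous_intros isCont_o2[of x "\<lambda>x. x powr \<alpha>" "ml1 \<alpha>"] isCont_o2[of x "\<lambda>x. x powr \<alpha>" "ml2 \<alpha>"]
      DERIV_isCont[OF ml1_deriv] ml2_isCont) auto
  moreover have "\<forall>\<^sub>F y in nhds x. FML'' \<alpha> y =
     \<alpha> * (\<alpha> - 1) * y powr (\<alpha> - 2) * ml1 \<alpha> (y powr \<alpha>) + \<alpha>\<^sup>2 * y powr (2 * \<alpha> - 2) * ml2 \<alpha> (y powr \<alpha>)"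
    using eventually_nhds_in_open[of "{0<..}" x] x by (auto elim!: eventually_mono simp: deriv2_FML)
  ultimately show ?thesis by (simp add: isCont_cong)
qed

lemma continuous_on_FML: "continuous_on {0..} (FML \<alpha>)"
proof -
  have "continuous_on UNIV (ml0 \<alpha>)"
    by (auto intro!: continuous_at_imp_continuous_on DERIV_isCont[OF ml0_deriv])
  then show ?thesis
    unfolding FML_eq[abs_def]
    by (rule continuous_on_compose2) (use \<alpha> in \<open>auto intro!: continuous_on_powr' continuous_on_const continuous_on_id\<close>)
qed

text \<open>The derivative has the continuous extension \<open>0\<close> at the origin.\<close>

lemma continuous_on_deriv_FML: "continuous_on {0..} (\<lambda>x. \<alpha> * x powr (\<alpha> - 1) * ml1 \<alpha> (x powr \<alpha>))"
proof -
  have c: "continuous_on UNIV (ml1 \<alpha>)"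
    by (auto intro!: continuous_at_imp_continuous_on DERIV_isCont[OF ml1_deriv])
  show ?thesis
  proof -
    have p: "continuous_on {0..} (\<lambda>x::real. x powr a)" if "0 < a" for a
      using that by (intro continuous_on_powr' continuous_on_const continuous_on_id) auto
    have q: "continuous_on {0..} (\<lambda>x. ml1 \<alpha> (x powr \<alpha>))"
      by (rule continuous_on_compose2[OF c p]) (use \<alpha> in auto)
    then show ?thesis
      using \<alpha> by (intro continuous_on_mult p q continuous_on_const) auto
  qed
qed

lemma powr_nat: "0 < x \<Longrightarrow> (x powr \<alpha>) ^ n = x powr (\<alpha> * real n)"
  by (simp add: powr_powr flip: powr_realpow)

lemma FML_sums:
  assumes "0 < x"
  shows "(\<lambda>n. x powr (\<alpha> * real n + 1 - 1) / Gamma (\<alpha> * real n + 1)) sums FML \<alpha> x"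
  using summable_sums[OF summable_ml[OF \<alpha>, of "x powr \<alpha>"]] assms
  by (simp add: FML_eq ml0_def ml_coeff_def powr_nat)

lemma diffs_ml_coeff: "\<alpha> * diffs (ml_coeff \<alpha>) n = 1 / Gamma (\<alpha> * real (n + 1))"
proof -
  have "Gamma (\<alpha> * real (n + 1) + 1) = \<alpha> * real (n + 1) * Gamma (\<alpha> * real (n + 1))"
  proof (rule Gamma_plus1)
    have "0 < \<alpha> * real (n + 1)" using \<alpha> by simp
    then show "\<alpha> * real (n + 1) \<notin> \<int>\<^sub>\<le>\<^sub>0" by (auto elim!: nonpos_Ints_cases simp del: of_nat_add)
  qed
  then show ?thesis using \<alpha> by (simp add: diffs_def ml_coeff_def)
qed

lemma deriv_FML_sums:
  assumes x: "0 < x"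
  shows "(\<lambda>n. x powr (\<alpha> * real (n + 1) - 1) / Gamma (\<alpha> * real (n + 1))) sums FML' \<alpha> x"
proof -
  have "(\<lambda>n. (\<alpha> * x powr (\<alpha> - 1)) * (diffs (ml_coeff \<alpha>) n * (x powr \<alpha>) ^ n)) sums FML' \<alpha> x"
    unfolding deriv_FML[OF x] ml1_def by (rule sums_mult[OF summable_sums[OF summable_ml1]])
  also have "(\<lambda>n. (\<alpha> * x powr (\<alpha> - 1)) * (diffs (ml_coeff \<alpha>) n * (x powr \<alpha>) ^ n)) =
      (\<lambda>n. x powr (\<alpha> * real (n + 1) - 1) / Gamma (\<alpha> * real (n + 1)))"
  proof
    fix n
    have "x powr (\<alpha> - 1) * x powr (\<alpha> * real n) = x powr (\<alpha> * real (n + 1) - 1)"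
      using x by (simp add: algebra_simps flip: powr_add)
    moreover have "(\<alpha> * x powr (\<alpha> - 1)) * (diffs (ml_coeff \<alpha>) n * (x powr \<alpha>) ^ n) =
      (\<alpha> * diffs (ml_coeff \<alpha>) n) * (x powr (\<alpha> - 1) * x powr (\<alpha> * real n))"
      using x by (simp add: powr_nat)
    ultimately show "(\<alpha> * x powr (\<alpha> - 1)) * (diffs (ml_coeff \<alpha>) n * (x powr \<alpha>) ^ n) =
      x powr (\<alpha> * real (n + 1) - 1) / Gamma (\<alpha> * real (n + 1))"
      by (simp only: diffs_ml_coeff) simp
  qed
  finally show ?thesis .
qed

text \<open>Multiplying \<open>ml2\<close> by its argument aligns its powers with those of \<open>ml1\<close>; the two series then combine and \<open>(\<alpha> (n+1) - 1) / \<Gamma>(\<alpha> (n+1))\<close> becomes \<open>1 / \<Gamma>(\<alpha> (n+1) - 1)\<close>.\<close>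

lemma deriv2_FML_sums:
  assumes x: "0 < x"
  shows "(\<lambda>n. x powr (\<alpha> * real (n + 1) - 1 - 1) / Gamma (\<alpha> * real (n + 1) - 1)) sums FML'' \<alpha> x"
proof -
  define y where "y = x powr \<alpha>"
  define d where "d = diffs (ml_coeff \<alpha>)"
  have y: "0 < y" using x by (simp add: y_def)
  have "(\<lambda>n. real n * d n * y ^ (n - Suc 0)) sums ml2 \<alpha> y"
    unfolding ml2_def d_def by (rule diffs_equiv) (rule termdiff_converges_all, rule summable_ml1)
  from sums_mult[OF this, of y] have 2: "(\<lambda>n. real n * (d n * y ^ n)) sums (y * ml2 \<alpha> y)"
    by (rule sums_cong[THEN iffD1, rotated]) (auto simp: power_eq_if mult_ac)
  have 1: "(\<lambda>n. d n * y ^ n) sums ml1 \<alpha> y"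
    unfolding ml1_def d_def by (rule summable_sums[OF summable_ml1])
  have "x powr (2 * \<alpha> - 2) = x powr (\<alpha> - 2) * y" using x by (simp add: y_def flip: powr_add)
  then have eq: "FML'' \<alpha> x = \<alpha> * x powr (\<alpha> - 2) * ((\<alpha> - 1) * ml1 \<alpha> y + \<alpha> * (y * ml2 \<alpha> y))"
    by (simp add: deriv2_FML[OF x] y_def algebra_simps power2_eq_square)
  have "(\<lambda>n. \<alpha> * x powr (\<alpha> - 2) * ((\<alpha> - 1) * (d n * y ^ n) + \<alpha> * (real n * (d n * y ^ n)))) sums FML'' \<alpha> x"
    unfolding eq by (intro sums_mult sums_add 1 2)
  also have "(\<lambda>n. \<alpha> * x powr (\<alpha> - 2) * ((\<alpha> - 1) * (d n * y ^ n) + \<alpha> * (real n * (d n * y ^ n)))) =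
    (\<lambda>n. x powr (\<alpha> * real (n + 1) - 1 - 1) / Gamma (\<alpha> * real (n + 1) - 1))"
  proof
    fix n
    have p: "x powr (\<alpha> - 2) * y ^ n = x powr (\<alpha> * real (n + 1) - 1 - 1)"
      using x by (simp add: y_def powr_nat algebra_simps flip: powr_add)
    have "\<alpha> * real (n + 1) \<ge> \<alpha> * 1" using \<alpha> by (intro mult_left_mono) auto
    then have gt: "\<alpha> * real (n + 1) - 1 > 0" using \<alpha> by linarith
    have "Gamma (\<alpha> * real (n + 1) - 1 + 1) = (\<alpha> * real (n + 1) - 1) * Gamma (\<alpha> * real (n + 1) - 1)"
      using gt by (intro Gamma_plus1) (auto elim!: nonpos_Ints_cases)
    then have G: "(\<alpha> * real (n + 1) - 1) * (1 / Gamma (\<alpha> * real (n + 1))) = 1 / Gamma (\<alpha> * real (n + 1) - 1)"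
      using gt by simp
    have "\<alpha> * x powr (\<alpha> - 2) * ((\<alpha> - 1) * (d n * y ^ n) + \<alpha> * (real n * (d n * y ^ n))) =
      (\<alpha> * real (n + 1) - 1) * (\<alpha> * d n) * (x powr (\<alpha> - 2) * y ^ n)"
      by (simp add: algebra_simps)
    also have "\<dots> = (\<alpha> * real (n + 1) - 1) * (1 / Gamma (\<alpha> * real (n + 1))) * x powr (\<alpha> * real (n + 1) - 1 - 1)"
      by (simp only: d_def diffs_ml_coeff p)
    finally show "\<alpha> * x powr (\<alpha> - 2) * ((\<alpha> - 1) * (d n * y ^ n) + \<alpha> * (real n * (d n * y ^ n))) =
      x powr (\<alpha> * real (n + 1) - 1 - 1) / Gamma (\<alpha> * real (n + 1) - 1)"
      unfolding G by simp
  qed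
  finally show ?thesis .
qed

lemma geometric_powr_sums:
  fixes \<theta> :: real
  assumes \<theta>: "1 < \<theta>"
  shows "(\<lambda>n. \<theta> powr - (\<alpha> * real n + c)) sums (\<theta> powr (\<alpha> - c) / (\<theta> powr \<alpha> - 1))"
proof -
  have 1: "1 < \<theta> powr \<alpha>" using \<theta> \<alpha> by simp
  then have "(\<lambda>n. \<theta> powr - c * (\<theta> powr - \<alpha>) ^ n) sums (\<theta> powr - c * (1 / (1 - \<theta> powr - \<alpha>)))"
    by (intro sums_mult geometric_sums) (auto simp: powr_minus inverse_less_1_iff)
  moreover have "\<theta> powr - c * (\<theta> powr - \<alpha>) ^ n = \<theta> powr - (\<alpha> * real n + c)" for n
    using \<theta> by (simp add: powr_powr algebra_simps flip: powr_realpow powr_add)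
  moreover have "\<theta> powr - c * (1 / (1 - \<theta> powr - \<alpha>)) = \<theta> powr (\<alpha> - c) / (\<theta> powr \<alpha> - 1)"
    using 1 \<theta> by (simp add: powr_minus powr_diff field_simps)
  ultimately show ?thesis by simp
qed

lemma laplace_FML:
  assumes \<theta>: "1 < \<theta>"
  shows "has_bochner_integral lborel (\<lambda>x. indicator {0..} x * (exp (- (\<theta> * x)) * FML \<alpha> x)) (\<theta> powr (\<alpha> - 1) / (\<theta> powr \<alpha> - 1))"
proof (rule laplace_powr_series[OF _ _ FML_sums])
  show "0 < \<alpha> * real n + 1" for n using \<alpha> by (simp add: add_nonneg_pos)
  show "(\<lambda>n. \<theta> powr - (\<alpha> * real n + 1)) sums (\<theta> powr (\<alpha> - 1) / (\<theta> powr \<alpha> - 1))"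
    by (rule geometric_powr_sums[OF \<theta>])
qed (use \<theta> in auto)

lemma laplace_FML':
  assumes \<theta>: "1 < \<theta>"
  shows "has_bochner_integral lborel (\<lambda>x. indicator {0..} x * (exp (- (\<theta> * x)) * FML' \<alpha> x)) (1 / (\<theta> powr \<alpha> - 1))"
proof (rule laplace_powr_series[OF _ _ deriv_FML_sums])
  show "0 < \<alpha> * real (n + 1)" for n using \<alpha> by simp
  show "(\<lambda>n. \<theta> powr - (\<alpha> * real (n + 1))) sums (1 / (\<theta> powr \<alpha> - 1))"
    using geometric_powr_sums[OF \<theta>, of \<alpha>] \<theta> by (simp add: distrib_left add.commute)
qed (use \<theta> in auto)

lemma laplace_FML'':
  assumes \<theta>: "1 < \<theta>"
  shows "has_bochner_integral lborel (\<lambda>x. indicator {0..} x * (exp (- (\<theta> * x)) * FML'' \<alpha> x)) (\<theta> / (\<theta> powr \<alpha> - 1))"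
proof (rule laplace_powr_series[OF _ _ deriv2_FML_sums])
  show "0 < \<alpha> * real (n + 1) - 1" for n
    using \<alpha> mult_left_mono[of 1 "real (n+1)" \<alpha>] by linarith
  show "(\<lambda>n. \<theta> powr - (\<alpha> * real (n + 1) - 1)) sums (\<theta> / (\<theta> powr \<alpha> - 1))"
    using geometric_powr_sums[OF \<theta>, of "\<alpha> - 1"] \<theta> by (simp add: distrib_left algebra_simps)
qed (use \<theta> in auto)

end

section \<open>Contraction semigroups and their resolvents\<close>

lemma has_bochner_integral_exp:
  fixes c :: real assumes c: "0 < c"
  shows "has_bochner_integral lborel (\<lambda>x. indicator {0..} x * exp (- (c * x))) (1 / c)"
proof (rule has_bochner_integral_nn_integral)
  have "((\<lambda>x. exp (- c * x)) has_integral exp (- c * 0) / c) {0..}"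
    by (rule has_integral_exp_minus_to_infinity[OF c])
  from nn_integral_has_integral_lebesgue[OF _ this]
  show "(\<integral>\<^sup>+x. ennreal (indicator {0..} x * exp (- (c * x))) \<partial>lborel) = ennreal (1 / c)" by simp
qed (use c in auto)

lemma
  fixes c :: real
  assumes "0 < c"
  shows set_integrable_exp: "set_integrable lborel {0..} (\<lambda>x. exp (- (c * x)))"
    and set_integral_exp: "(LBINT x:{0..}. exp (- (c * x))) = 1 / c"
  using has_bochner_integral_exp[OF assms] by (auto simp: set_integrable_def set_lebesgue_integral_def has_bochner_integral_iff)

lemma set_integrable_exp_bounded:
  fixes g :: "real \<Rightarrow> real"
  assumes c: "0 < c" and g: "(\<lambda>t. indicator {0..} t * g t) \<in> borel_measurable borel"
    and B: "\<And>t. 0 \<le> t \<Longrightarrow> \<bar>g t\<bar> \<le> B"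
  shows "set_integrable lborel {0..} (\<lambda>t. exp (- (c * t)) * g t)"
  unfolding set_integrable_def
proof (rule Bochner_Integration.integrable_bound)
  show "integrable lborel (\<lambda>t. B * (indicator {0..} t *\<^sub>R exp (- (c * t))))"
    using set_integrable_exp[OF c] unfolding set_integrable_def by (rule integrable_mult_right)
  have "(\<lambda>t. exp (- (c * t)) * (indicator {0..} t * g t)) \<in> borel_measurable borel"
    using g by measurable
  then show "(\<lambda>x. indicat_real {0..} x *\<^sub>R (exp (- (c * x)) * g x)) \<in> borel_measurable lborel"
    by (simp add: mult_ac)
  show "AE x in lborel. norm (indicat_real {0..} x *\<^sub>R (exp (- (c * x)) * g x)) \<le> norm (B * (indicator {0..} x *\<^sub>R exp (- (c * x))))"
    using order_trans[OF B abs_ge_self] by (auto simp: indicator_def abs_mult mult.commute[of B] intro!: mult_left_mono)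
qed

lemma set_integral_exp_bounded_le:
  fixes g :: "real \<Rightarrow> real"
  assumes c: "0 < c" and g: "(\<lambda>t. indicator {0..} t * g t) \<in> borel_measurable borel"
    and B: "\<And>t. 0 \<le> t \<Longrightarrow> \<bar>g t\<bar> \<le> B"
  shows "\<bar>LBINT t:{0..}. exp (- (c * t)) * g t\<bar> \<le> B / c"
proof -
  note i = set_integrable_exp_bounded[OF c g B]
  have "\<bar>LBINT t:{0..}. exp (- (c * t)) * g t\<bar> \<le> (LBINT t:{0..}. \<bar>exp (- (c * t)) * g t\<bar>)"
    by (rule set_integral_abs_le)
  also have "\<dots> \<le> (LBINT t:{0..}. B * exp (- (c * t)))"
    using B by (intro set_integral_mono set_integrable_abs[OF i] set_integrable_mult_right set_integrable_exp[OF c])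
      (auto simp: abs_mult mult.commute[of B] intro!: mult_left_mono)
  also have "\<dots> = B / c" using c by (simp add: set_integral_exp)
  finally show ?thesis .
qed

lemma (in prob_space) expectation_exp_integral_swap:
  fixes H :: "'a \<Rightarrow> real \<Rightarrow> real"
  assumes c: "0 < c" and Hm: "(\<lambda>(\<omega>, t). H \<omega> t) \<in> borel_measurable (M \<Otimes>\<^sub>M lborel)" and B: "\<And>\<omega> t. \<bar>H \<omega> t\<bar> \<le> B"
  shows "integrable M (\<lambda>\<omega>. LBINT t:{0..}. exp (- (c * t)) * H \<omega> t)"
    and "(LBINT t:{0..}. exp (- (c * t)) * (\<integral>\<omega>. H \<omega> t \<partial>M)) = (\<integral>\<omega>. (LBINT t:{0..}. exp (- (c * t)) * H \<omega> t) \<partial>M)"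
proof -
  interpret P: pair_sigma_finite M lborel ..
  define G where "G \<omega> t = indicat_real {0..} t *\<^sub>R (exp (- (c * t)) * H \<omega> t)" for \<omega> t
  have Gm: "case_prod G \<in> borel_measurable (M \<Otimes>\<^sub>M lborel)"
  proof -
    have "(\<lambda>p. indicat_real {0..} (snd p) *\<^sub>R (exp (- (c * snd p)) * (case p of (\<omega>, t) \<Rightarrow> H \<omega> t))) \<in> borel_measurable (M \<Otimes>\<^sub>M lborel)"
      using Hm by measurable
    then show ?thesis by (simp add: G_def split_beta')
  qed
  have Hs: "H \<omega> \<in> borel_measurable borel" if "\<omega> \<in> space M" for \<omega>
    using measurable_compose[OF measurable_Pair1'[OF that] Hm] by simp
  have in1: "integrable lborel (G \<omega>)" if "\<omega> \<in> space M" for \<omega>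
    using set_integrable_exp_bounded[OF c, of "H \<omega>" B] Hs[OF that] B by (simp add: set_integrable_def G_def[abs_def])
  have le: "(\<integral>t. norm (G \<omega> t) \<partial>lborel) \<le> B * (1 / c)" if "\<omega> \<in> space M" for \<omega>
  proof -
    have "(\<integral>t. norm (G \<omega> t) \<partial>lborel) \<le> (\<integral>t. B * (indicator {0..} t * exp (- (c * t))) \<partial>lborel)"
    proof (rule integral_mono)
      show "integrable lborel (\<lambda>t. norm (G \<omega> t))" by (intro integrable_norm in1 that)
      show "integrable lborel (\<lambda>t. B * (indicat_real {0..} t * exp (- (c * t))))"
        using has_bochner_integral_exp[OF c] by (intro integrable_mult_right) (simp add: has_bochner_integral_iff)
      show "norm (G \<omega> t) \<le> B * (indicat_real {0..} t * exp (- (c * t)))" for t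
        using B[of \<omega> t] by (auto simp: G_def indicator_def abs_mult mult.commute[of B])
    qed
    also have "\<dots> = B * (1 / c)" using has_bochner_integral_exp[OF c] by (simp add: has_bochner_integral_iff)
    finally show ?thesis .
  qed
  have int: "integrable (M \<Otimes>\<^sub>M lborel) (case_prod G)"
  proof (rule P.Fubini_integrable[OF Gm])
    show "AE \<omega> in M. integrable lborel (\<lambda>t. case_prod G (\<omega>, t))" using in1 by (intro AE_I2) simp
    show "integrable M (\<lambda>\<omega>. \<integral>t. norm (case_prod G (\<omega>, t)) \<partial>lborel)"
    proof (rule integrable_const_bound[of _ "B * (1 / c)"])
      show "(\<lambda>\<omega>. \<integral>t. norm (case_prod G (\<omega>, t)) \<partial>lborel) \<in> borel_measurable M"
        using Gm by (intro lborel.borel_measurable_lebesgue_integral) (simp add: split_beta')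
      show "AE \<omega> in M. norm (\<integral>t. norm (case_prod G (\<omega>, t)) \<partial>lborel) \<le> B * (1 / c)"
        using le by (intro AE_I2) simp
    qed
  qed
  show "integrable M (\<lambda>\<omega>. LBINT t:{0..}. exp (- (c * t)) * H \<omega> t)"
    using P.integrable_fst[OF int] by (simp add: G_def set_lebesgue_integral_def)
  have "(LBINT t:{0..}. exp (- (c * t)) * (\<integral>\<omega>. H \<omega> t \<partial>M)) = (\<integral>t. \<integral>\<omega>. G \<omega> t \<partial>M \<partial>lborel)"
    by (simp add: G_def set_lebesgue_integral_def)
  also have "\<dots> = (\<integral>\<omega>. \<integral>t. G \<omega> t \<partial>lborel \<partial>M)" by (rule P.Fubini_integral[OF int])
  finally show "(LBINT t:{0..}. exp (- (c * t)) * (\<integral>\<omega>. H \<omega> t \<partial>M)) = (\<integral>\<omega>. (LBINT t:{0..}. exp (- (c * t)) * H \<omega> t) \<partial>M)"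
    by (simp add: G_def set_lebesgue_integral_def)
qed

locale C0_semigroup =
  fixes T :: "real \<Rightarrow> (real \<Rightarrow> real) \<Rightarrow> real \<Rightarrow> real"
  assumes T_C0: "0 \<le> t \<Longrightarrow> f \<in> C0 \<Longrightarrow> T t f \<in> C0"
    and T_lincomb: "0 \<le> t \<Longrightarrow> f \<in> C0 \<Longrightarrow> g \<in> C0 \<Longrightarrow>
      T t (\<lambda>x\<in>{0..}. a * f x + b * g x) = (\<lambda>x\<in>{0..}. a * T t f x + b * T t g x)"
    and T_bound: "0 \<le> t \<Longrightarrow> f \<in> C0 \<Longrightarrow> (\<And>x. 0 \<le> x \<Longrightarrow> \<bar>f x\<bar> \<le> B) \<Longrightarrow> 0 \<le> x \<Longrightarrow> \<bar>T t f x\<bar> \<le> B"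
    and T_nonneg: "0 \<le> t \<Longrightarrow> f \<in> C0 \<Longrightarrow> (\<And>x. 0 \<le> x \<Longrightarrow> 0 \<le> f x) \<Longrightarrow> 0 \<le> x \<Longrightarrow> 0 \<le> T t f x"
    and T_add: "0 \<le> s \<Longrightarrow> 0 \<le> t \<Longrightarrow> f \<in> C0 \<Longrightarrow> T (s + t) f = T s (T t f)"
    and T_small: "f \<in> C0 \<Longrightarrow> 0 < e \<Longrightarrow> \<exists>h>0. \<forall>t\<in>{0..h}. \<forall>x\<ge>0. \<bar>T t f x - f x\<bar> \<le> e"
begin

lemma T_diff_bound:
  assumes "0 \<le> t" "f \<in> C0" "g \<in> C0" "\<And>x. 0 \<le> x \<Longrightarrow> \<bar>f x - g x\<bar> \<le> B" "0 \<le> x"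
  shows "\<bar>T t f x - T t g x\<bar> \<le> B"
  using T_bound[OF assms(1) C0_lincomb[OF assms(2,3), of 1 "-1"], of B x]
    T_lincomb[OF assms(1-3), of 1 "-1"] assms(4,5) by simp

text \<open>Strong continuity at \<open>0\<close> becomes uniform in time, since \<open>T (s + r) f - T s f = T s (T r f - f)\<close> and \<open>T s\<close> is a contraction.\<close>

lemma T_time_uniform:
  assumes f: "f \<in> C0" and e: "0 < e"
  obtains h where "0 < h" "\<And>s t x. 0 \<le> s \<Longrightarrow> 0 \<le> t \<Longrightarrow> \<bar>s - t\<bar> \<le> h \<Longrightarrow> 0 \<le> x \<Longrightarrow> \<bar>T s f x - T t f x\<bar> \<le> e"
proof -
  obtain h where h: "0 < h" "\<And>t x. t \<in> {0..h} \<Longrightarrow> 0 \<le> x \<Longrightarrow> \<bar>T t f x - f x\<bar> \<le> e"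
    using T_small[OF f e] by blast
  have *: "\<bar>T (s + r) f x - T s f x\<bar> \<le> e" if "0 \<le> s" "0 \<le> r" "r \<le> h" "0 \<le> x" for s r x
    unfolding T_add[OF that(1,2) f]
    by (rule T_diff_bound) (use that h f T_C0 in auto)
  have "\<bar>T s f x - T t f x\<bar> \<le> e" if "0 \<le> s" "0 \<le> t" "\<bar>s - t\<bar> \<le> h" "0 \<le> x" for s t x
    using *[of s "t - s" x] *[of t "s - t" x] that by (cases "s \<le> t") (auto simp: abs_minus_commute)
  then show ?thesis using that h(1) by blast
qed

lemma T_joint_continuous:
  assumes f: "f \<in> C0"
  shows "continuous_on ({0..} \<times> {0..}) (\<lambda>(t, x). T t f x)"
  unfolding continuous_on_iff
proof (intro ballI allI impI)
  fix p and e :: real assume p: "p \<in> {0::real..} \<times> {0::real..}" and e: "0 < e"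
  obtain t x where ptx: "p = (t, x)" by (cases p)
  then have tx: "t \<in> {0..}" "x \<in> {0..}" using p by auto
  obtain h where h: "0 < h" "\<And>s t x. 0 \<le> s \<Longrightarrow> 0 \<le> t \<Longrightarrow> \<bar>s - t\<bar> \<le> h \<Longrightarrow> 0 \<le> x \<Longrightarrow> \<bar>T s f x - T t f x\<bar> \<le> e/3"
    using T_time_uniform[OF f, of "e/3"] e by auto
  obtain d where d: "0 < d" "\<And>y. 0 \<le> y \<Longrightarrow> dist y x < d \<Longrightarrow> dist (T t f y) (T t f x) < e/3"
    using C0_D(1)[OF T_C0[OF _ f, of t]] tx e unfolding continuous_on_iff
    by (metis atLeast_iff divide_pos_pos zero_less_numeral)
  have "dist (T s f y) (T t f x) < e" if "s \<in> {0..}" "y \<in> {0..}" "dist (s, y) (t, x) < min d h" for s y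
  proof -
    have "dist s t < h" "dist y x < d"
      using that(3) dist_fst_le[of "(s,y)" "(t,x)"] dist_snd_le[of "(s,y)" "(t,x)"] by auto
    then have "\<bar>T s f y - T t f y\<bar> \<le> e/3" "dist (T t f y) (T t f x) < e/3"
      using that tx h(2)[of s t y] d(2)[of y] by (auto simp: dist_real_def)
    then show ?thesis using e unfolding dist_real_def by linarith
  qed
  then show "\<exists>d>0. \<forall>x'\<in>{0..} \<times> {0..}. dist x' p < d \<longrightarrow>
      dist (case x' of (t, x) \<Rightarrow> T t f x) (case p of (t, x) \<Rightarrow> T t f x) < e"
    unfolding ptx using d(1) h(1) by (intro exI[of _ "min d h"]) auto
qed

lemma T_time_continuous:
  assumes "f \<in> C0" "0 \<le> x" shows "continuous_on {0..} (\<lambda>t. T t f x)"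
proof -
  have "continuous_on {0..} (\<lambda>t. (\<lambda>(t, x). T t f x) (t, x))"
    by (rule continuous_on_compose2[OF T_joint_continuous[OF assms(1)]])
       (use assms(2) in \<open>auto intro!: continuous_intros\<close>)
  then show ?thesis by simp
qed

lemma T_time_measurable:
  assumes "f \<in> C0" "0 \<le> x" shows "(\<lambda>t. indicator {0..} t * T t f x) \<in> borel_measurable borel"
  using borel_measurable_continuous_on_indicator[OF _ T_time_continuous[OF assms]] by simp

definition U :: "(real \<Rightarrow> real) \<Rightarrow> real \<Rightarrow> real" where
  "U f = (\<lambda>x\<in>{0..}. LBINT t:{0..}. exp (- t) * T t f x)"

lemma U_integrable:
  assumes f: "f \<in> C0" and x: "0 \<le> x"
  shows "set_integrable lborel {0..} (\<lambda>t. exp (- t) * T t f x)"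
proof -
  obtain B where B: "\<And>x. 0 \<le> x \<Longrightarrow> \<bar>f x\<bar> \<le> B" using C0_bounded[OF f] by auto
  show ?thesis
    using set_integrable_exp_bounded[of 1, OF _ T_time_measurable[OF f x] T_bound[OF _ f B x]] by simp
qed

lemma U_bound:
  assumes f: "f \<in> C0" and B: "\<And>x. 0 \<le> x \<Longrightarrow> \<bar>f x\<bar> \<le> B" and x: "0 \<le> x"
  shows "\<bar>U f x\<bar> \<le> B"
  using set_integral_exp_bounded_le[of 1, OF _ T_time_measurable[OF f x] T_bound[OF _ f B x]] x
  by (simp add: U_def)

lemma U_lincomb:
  assumes f: "f \<in> C0" and g: "g \<in> C0"
  shows "U (\<lambda>x\<in>{0..}. a * f x + b * g x) = (\<lambda>x\<in>{0..}. a * U f x + b * U g x)"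
proof
  fix x
  show "U (\<lambda>x\<in>{0..}. a * f x + b * g x) x = (\<lambda>x\<in>{0..}. a * U f x + b * U g x) x"
  proof (cases "0 \<le> x")
    case True
    have "(LBINT t:{0..}. exp (- t) * T t (\<lambda>x\<in>{0..}. a * f x + b * g x) x) =
        (LBINT t:{0..}. a * (exp (- t) * T t f x) + b * (exp (- t) * T t g x))"
      using True by (intro set_lebesgue_integral_cong) (auto simp: T_lincomb[OF _ f g] algebra_simps)
    also have "\<dots> = a * (LBINT t:{0..}. exp (- t) * T t f x) + b * (LBINT t:{0..}. exp (- t) * T t g x)"
      using U_integrable[OF f True] U_integrable[OF g True] by simp
    finally show ?thesis using True by (simp add: U_def)
  qed (simp add: U_def)
qed

lemma U_nonneg:
  assumes f: "f \<in> C0" and pos: "\<And>x. 0 \<le> x \<Longrightarrow> 0 \<le> f x" and x: "0 \<le> x"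
  shows "0 \<le> U f x"
  using x T_nonneg[OF _ f pos x]
  by (auto simp: U_def set_lebesgue_integral_def indicator_def intro!: Bochner_Integration.integral_nonneg)

lemma U_C0:
  assumes f: "f \<in> C0" shows "U f \<in> C0"
proof -
  obtain B where B: "0 < B" "\<And>x. 0 \<le> x \<Longrightarrow> \<bar>f x\<bar> \<le> B" using C0_bounded[OF f] by auto
  have meas: "(\<lambda>t. indicat_real {0..} t *\<^sub>R (exp (- t) * T t f x)) \<in> borel_measurable lborel" if "0 \<le> x" for x
    using borel_measurable_integrable[OF U_integrable[OF f that, unfolded set_integrable_def]] .
  have dom: "integrable lborel (\<lambda>t. B * (indicator {0..} t * exp (- t)))"
    using has_bochner_integral_exp[of 1] by (intro integrable_mult_right) (simp add: has_bochner_integral_iff)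
  have bnd: "norm (indicat_real {0..} t *\<^sub>R (exp (- t) * T t f x)) \<le> B * (indicator {0..} t * exp (- t))" if "0 \<le> x" for x t
    using T_bound[OF _ f B(2) that, of t] by (auto simp: indicator_def abs_mult mult.commute[of B])
  show ?thesis unfolding U_def
  proof (rule C0_restrictI)
    show "continuous_on {0..} (\<lambda>x. LBINT t:{0..}. exp (- t) * T t f x)"
      unfolding continuous_on_sequentially comp_def set_lebesgue_integral_def
    proof (intro allI ballI impI, elim conjE)
      fix xs :: "nat \<Rightarrow> real" and x :: real assume xs: "x \<in> {0..}" "\<forall>n. xs n \<in> {0..}" "xs \<longlonglongrightarrow> x"
      show "(\<lambda>n. LBINT t. indicat_real {0..} t *\<^sub>R (exp (- t) * T t f (xs n)))
          \<longlonglongrightarrow> (LBINT t. indicat_real {0..} t *\<^sub>R (exp (- t) * T t f x))"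
      proof (rule integral_dominated_convergence[OF meas meas dom])
        show "AE t in lborel. (\<lambda>n. indicat_real {0..} t *\<^sub>R (exp (- t) * T t f (xs n)))
            \<longlonglongrightarrow> indicat_real {0..} t *\<^sub>R (exp (- t) * T t f x)"
        proof (intro AE_I2)
          fix t :: real
          have "(\<lambda>n. T t f (xs n)) \<longlonglongrightarrow> T t f x" if "0 \<le> t"
            by (rule continuous_on_tendsto_compose[OF C0_D(1)[OF T_C0[OF that f]] xs(3)]) (use xs in auto)
          then show "(\<lambda>n. indicat_real {0..} t *\<^sub>R (exp (- t) * T t f (xs n)))
              \<longlonglongrightarrow> indicat_real {0..} t *\<^sub>R (exp (- t) * T t f x)"
            by (cases "0 \<le> t") (auto intro!: tendsto_intros)
        qed
      qed (use xs bnd in auto)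
    qed
    have "((\<lambda>x. LBINT t. indicat_real {0..} t *\<^sub>R (exp (- t) * T t f (max 0 x))) \<longlongrightarrow> (\<integral>t. 0 \<partial>(lborel :: real measure))) at_top"
    proof (rule integral_dominated_convergence_at_top[where M = lborel and f = "\<lambda>_. 0" and w = "\<lambda>t. B * (indicator {0..} t * exp (- t))"
          and s = "\<lambda>x t. indicat_real {0..} t *\<^sub>R (exp (- t) * T t f (max 0 x))"])
      show "integrable lborel (\<lambda>t. B * (indicator {0..} t * exp (- t)))" by (rule dom)
      show "(\<lambda>t. indicat_real {0..} t *\<^sub>R (exp (- t) * T t f (max 0 x))) \<in> borel_measurable lborel" for x
        by (rule meas) simp
      show "\<forall>\<^sub>F x in at_top. AE t in lborel. norm (indicat_real {0..} t *\<^sub>R (exp (- t) * T t f (max 0 x))) \<le> B * (indicator {0..} t * exp (- t))"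
        using bnd by (intro always_eventually allI AE_I2) auto
      show "AE t in lborel. ((\<lambda>x. indicat_real {0..} t *\<^sub>R (exp (- t) * T t f (max 0 x))) \<longlongrightarrow> 0) at_top"
      proof (intro AE_I2)
        fix t :: real
        show "((\<lambda>x. indicat_real {0..} t *\<^sub>R (exp (- t) * T t f (max 0 x))) \<longlongrightarrow> 0) at_top"
        proof (cases "0 \<le> t")
          case True
          have "((\<lambda>x. exp (- t) * T t f x) \<longlongrightarrow> exp (- t) * 0) at_top"
            by (intro tendsto_intros C0_D(2)[OF T_C0[OF True f]])
          then have "((\<lambda>x. exp (- t) * T t f x) \<longlongrightarrow> 0) at_top" by simp
          then have "((\<lambda>x. exp (- t) * T t f (max 0 x)) \<longlongrightarrow> 0) at_top"
            by (rule Lim_transform_eventually) (auto intro: eventually_mono[OF eventually_ge_at_top[of 0]])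
          then show ?thesis using True by simp
        qed simp
      qed
    qed auto
    then have "((\<lambda>x. LBINT t. indicat_real {0..} t *\<^sub>R (exp (- t) * T t f (max 0 x))) \<longlongrightarrow> 0) at_top" by simp
    then show "((\<lambda>x. LBINT t:{0..}. exp (- t) * T t f x) \<longlongrightarrow> 0) at_top"
      unfolding set_lebesgue_integral_def
      by (rule Lim_transform_eventually) (auto intro: eventually_mono[OF eventually_ge_at_top[of 0]])
  qed
qed

lemma C0_functional_U: "0 \<le> x \<Longrightarrow> C0_functional (\<lambda>f. U f x)"
  by unfold_locales (auto simp: U_lincomb intro: U_bound)

text \<open>\<open>g\<close> is the value at \<open>u\<close> of the generator of the semigroup.\<close>

definition generator_limit :: "(real \<Rightarrow> real) \<Rightarrow> (real \<Rightarrow> real) \<Rightarrow> bool" where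
  "generator_limit u g \<longleftrightarrow> uniform_limit {0..} (\<lambda>t x. (T t u x - u x) / t) g (at_right 0)"

lemma generator_limit_iff:
  "generator_limit u g \<longleftrightarrow> (\<forall>e>0. \<exists>h>0. \<forall>t x. 0 < t \<longrightarrow> t < h \<longrightarrow> 0 \<le> x \<longrightarrow> \<bar>T t u x - u x - t * g x\<bar> \<le> e * t)"
proof
  assume g: "generator_limit u g"
  show "\<forall>e>0. \<exists>h>0. \<forall>t x. 0 < t \<longrightarrow> t < h \<longrightarrow> 0 \<le> x \<longrightarrow> \<bar>T t u x - u x - t * g x\<bar> \<le> e * t"
  proof (intro allI impI)
    fix e :: real assume "0 < e"
    with g have "\<forall>\<^sub>F t in at_right 0. \<forall>x\<in>{0..}. dist ((T t u x - u x) / t) (g x) < e"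
      unfolding generator_limit_def by (rule uniform_limitD)
    then obtain h where h: "0 < h" "\<And>t x. 0 < t \<Longrightarrow> t < h \<Longrightarrow> 0 \<le> x \<Longrightarrow> dist ((T t u x - u x) / t) (g x) < e"
      unfolding eventually_at_right_field by auto
    have "\<bar>T t u x - u x - t * g x\<bar> \<le> e * t" if t: "0 < t" "t < h" "0 \<le> x" for t x
    proof -
      have "T t u x - u x - t * g x = ((T t u x - u x) / t - g x) * t" using t by (simp add: field_simps)
      then have "\<bar>T t u x - u x - t * g x\<bar> = \<bar>(T t u x - u x) / t - g x\<bar> * t" using t by (simp add: abs_mult)
      also have "\<dots> \<le> e * t" using h(2)[OF t] t by (intro mult_right_mono) (auto simp: dist_real_def)
      finally show ?thesis .
    qed
    then show "\<exists>h>0. \<forall>t x. 0 < t \<longrightarrow> t < h \<longrightarrow> 0 \<le> x \<longrightarrow> \<bar>T t u x - u x - t * g x\<bar> \<le> e * t" using h(1) by blast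
  qed
next
  assume *: "\<forall>e>0. \<exists>h>0. \<forall>t x. 0 < t \<longrightarrow> t < h \<longrightarrow> 0 \<le> x \<longrightarrow> \<bar>T t u x - u x - t * g x\<bar> \<le> e * t"
  show "generator_limit u g" unfolding generator_limit_def
  proof (rule uniform_limitI)
    fix e :: real assume e: "0 < e"
    obtain h where h: "0 < h" "\<And>t x. 0 < t \<Longrightarrow> t < h \<Longrightarrow> 0 \<le> x \<Longrightarrow> \<bar>T t u x - u x - t * g x\<bar> \<le> e/2 * t"
      using *[rule_format, of "e/2"] e by auto
    have "dist ((T t u x - u x) / t) (g x) < e" if t: "0 < t" "t < h" "0 \<le> x" for t x
    proof -
      have "(T t u x - u x) / t - g x = (T t u x - u x - t * g x) / t" using t by (simp add: field_simps)
      then have "dist ((T t u x - u x) / t) (g x) \<le> e / 2" using h(2)[OF t] t by (simp add: dist_real_def field_simps)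
      then show ?thesis using e by simp
    qed
    then show "\<forall>\<^sub>F t in at_right 0. \<forall>x\<in>{0..}. dist ((T t u x - u x) / t) (g x) < e"
      unfolding eventually_at_right_field using h(1) by auto
  qed
qed

text \<open>The generator is dissipative: a solution of \<open>L w = w\<close> satisfies \<open>\<parallel>w\<parallel> \<ge> \<parallel>T t w\<parallel> \<ge> (1 + t) \<parallel>w\<parallel> - o(t)\<close>.\<close>

lemma generator_fixpoint_zero:
  assumes w: "w \<in> C0" and g: "generator_limit w w" and x: "0 \<le> x"
  shows "w x = 0"
proof -
  obtain B0 where B0: "\<And>x. 0 \<le> x \<Longrightarrow> \<bar>w x\<bar> \<le> B0" using C0_bounded[OF w] by auto
  define B where "B = (SUP x\<in>{0..}. \<bar>w x\<bar>)"
  have bdd: "bdd_above ((\<lambda>x. \<bar>w x\<bar>) ` {0..})" using B0 by (auto intro!: bdd_aboveI2[of _ _ B0])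
  have le: "\<bar>w y\<bar> \<le> B" if "0 \<le> y" for y
    unfolding B_def by (rule cSUP_upper[OF _ bdd]) (use that in auto)
  have "B \<le> 0 + e" if e: "0 < e" for e
  proof -
    obtain h where h: "0 < h" "\<And>t x. 0 < t \<Longrightarrow> t < h \<Longrightarrow> 0 \<le> x \<Longrightarrow> \<bar>T t w x - w x - t * w x\<bar> \<le> e * t"
      using g e unfolding generator_limit_iff by blast
    define t where "t = h / 2"
    have t: "0 < t" "t < h" using h(1) by (auto simp: t_def)
    have "\<bar>w y\<bar> \<le> (B + e * t) / (1 + t)" if y: "0 \<le> y" for y
    proof -
      have "(1 + t) * \<bar>w y\<bar> = \<bar>(1 + t) * w y\<bar>" using t by (simp add: abs_mult)
      also have "\<dots> = \<bar>w y + t * w y\<bar>" by (simp add: algebra_simps)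
      also have "\<dots> \<le> B + e * t"
        using h(2)[OF t y] T_bound[OF _ w le y, of t] t by linarith
      finally show ?thesis using t by (simp add: field_simps)
    qed
    then have "B \<le> (B + e * t) / (1 + t)" unfolding B_def by (intro cSUP_least) auto
    then have "B * t \<le> e * t" using t by (simp add: field_simps)
    then show ?thesis using t by simp
  qed
  then have "B \<le> 0" by (rule field_le_epsilon)
  then show ?thesis using le[OF x] by simp
qed

lemma generator_limit_diff:
  assumes u: "u \<in> C0" "generator_limit u g" and v: "v \<in> C0" "generator_limit v k"
  shows "generator_limit (\<lambda>x\<in>{0..}. 1 * u x + -1 * v x) (\<lambda>x. g x - k x)"
  unfolding generator_limit_iff
proof (intro allI impI)
  fix e :: real assume e: "0 < e"
  obtain h where h: "0 < h" "\<And>t x. 0 < t \<Longrightarrow> t < h \<Longrightarrow> 0 \<le> x \<Longrightarrow> \<bar>T t u x - u x - t * g x\<bar> \<le> e/2 * t"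
    using u(2) e unfolding generator_limit_iff by (meson half_gt_zero)
  obtain h' where h': "0 < h'" "\<And>t x. 0 < t \<Longrightarrow> t < h' \<Longrightarrow> 0 \<le> x \<Longrightarrow> \<bar>T t v x - v x - t * k x\<bar> \<le> e/2 * t"
    using v(2) e unfolding generator_limit_iff by (meson half_gt_zero)
  let ?w = "\<lambda>x\<in>{0..}. 1 * u x + -1 * v x"
  have "\<bar>T t ?w x - ?w x - t * (g x - k x)\<bar> \<le> e * t" if t: "0 < t" "t < min h h'" "0 \<le> x" for t x
  proof -
    have "T t ?w x - ?w x - t * (g x - k x) = (T t u x - u x - t * g x) - (T t v x - v x - t * k x)"
      using t T_lincomb[OF _ u(1) v(1), of t 1 "-1"] by (simp add: algebra_simps)
    then show ?thesis using h(2)[of t x] h'(2)[of t x] t by linarith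
  qed
  then show "\<exists>h>0. \<forall>t x. 0 < t \<longrightarrow> t < h \<longrightarrow> 0 \<le> x \<longrightarrow> \<bar>T t ?w x - ?w x - t * (g x - k x)\<bar> \<le> e * t"
    using h(1) h'(1) by (intro exI[of _ "min h h'"]) auto
qed

lemma generator_limit_C0:
  assumes u: "u \<in> C0" "generator_limit u g"
  shows "(\<lambda>x\<in>{0..}. g x) \<in> C0"
proof (rule C0_restrictI)
  define q where "q n x = (T (1 / Suc n) u x - u x) * Suc n" for n :: nat and x
  have lim: "uniform_limit {0..} q g sequentially"
  proof (rule uniform_limitI)
    fix e :: real assume "0 < e"
    with u(2) have "\<forall>\<^sub>F t in at_right 0. \<forall>x\<in>{0..}. dist ((T t u x - u x) / t) (g x) < e"
      unfolding generator_limit_def by (rule uniform_limitD)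
    moreover have "filterlim (\<lambda>n. 1 / real (Suc n)) (at_right 0) sequentially"
      using LIMSEQ_inverse_real_of_nat by (intro tendsto_imp_filterlim_at_right) (auto simp: inverse_eq_divide)
    ultimately have "\<forall>\<^sub>F n in sequentially. \<forall>x\<in>{0..}. dist ((T (1 / real (Suc n)) u x - u x) / (1 / real (Suc n))) (g x) < e"
      by (rule eventually_compose_filterlim)
    then show "\<forall>\<^sub>F n in sequentially. \<forall>x\<in>{0..}. dist (q n x) (g x) < e"
      by (simp add: q_def)
  qed
  have qC: "continuous_on {0..} (q n)" "(q n \<longlongrightarrow> 0) at_top" for n
  proof -
    note C = T_C0[OF _ u(1), of "1 / Suc n"]
    show "continuous_on {0..} (q n)" unfolding q_def
      by (intro continuous_intros C0_D(1)[OF C] C0_D(1)[OF u(1)]) auto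
    have "((\<lambda>x. (T (1 / Suc n) u x - u x) * Suc n) \<longlongrightarrow> (0 - 0) * real (Suc n)) at_top"
      by (intro tendsto_intros C0_D(2)[OF C] C0_D(2)[OF u(1)]) auto
    then show "(q n \<longlongrightarrow> 0) at_top" by (simp add: q_def[abs_def])
  qed
  show "continuous_on {0..} g"
    by (rule uniform_limit_theorem[OF _ lim]) (use qC in auto)
  show "(g \<longlongrightarrow> 0) at_top"
  proof (rule tendstoI)
    fix e :: real assume e: "0 < e"
    obtain n where n: "\<forall>x\<in>{0..}. dist (q n x) (g x) < e/2"
      using uniform_limitD[OF lim, of "e/2"] e by (auto simp: eventually_sequentially)
    have "\<forall>\<^sub>F x in at_top. dist (q n x) 0 < e/2" using tendstoD[OF qC(2), of "e/2"] e by auto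
    then show "\<forall>\<^sub>F x in at_top. dist (g x) 0 < e"
      using eventually_ge_at_top[of 0]
    proof eventually_elim
      case (elim x)
      then have "dist (q n x) (g x) < e/2" using n by auto
      with elim(1) show ?case using dist_triangle_half_r[of "q n x" "g x" e 0] by (simp add: dist_commute)
    qed
  qed
qed

end

text \<open>For operators given by an expectation the exchange is Fubini's theorem.\<close>

locale C0_semigroup_fubini = C0_semigroup +
  assumes T_U: "0 \<le> s \<Longrightarrow> f \<in> C0 \<Longrightarrow> 0 \<le> x \<Longrightarrow>
    T s (\<lambda>x\<in>{0..}. LBINT t:{0..}. exp (- t) * T t f x) x = (LBINT t:{0..}. exp (- t) * T s (T t f) x)"
begin

lemma T_U_shift:
  assumes f: "f \<in> C0" and s: "0 \<le> s" and x: "0 \<le> x"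
  shows "T s (U f) x = exp s * (U f x - (LBINT t:{0..s}. exp (- t) * T t f x))"
proof -
  let ?G = "\<lambda>t. exp (- t) * T t f x"
  have int: "set_integrable lborel {0..} ?G" by (rule U_integrable[OF f x])
  have "T s (U f) x = (LBINT t:{0..}. exp (- t) * T s (T t f) x)"
    unfolding U_def by (rule T_U[OF s f x])
  also have "\<dots> = (LBINT t:{0..}. exp s * ?G (s + t))"
    by (intro set_lebesgue_integral_cong) (auto simp: T_add[OF s _ f] exp_add[symmetric] simp flip: mult.assoc)
  also have "\<dots> = exp s * (LBINT t:{0..}. ?G (s + t))" by simp
  also have "(LBINT t:{0..}. ?G (s + t)) = (LBINT t:{s..}. ?G t)"
    unfolding set_lebesgue_integral_def
    by (subst lborel_integral_real_affine[of 1 "\<lambda>t. indicator {s..} t *\<^sub>R ?G t" s]) (auto simp: indicator_def intro!: Bochner_Integration.integral_cong)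
  also have "(LBINT t:{s..}. ?G t) = (LBINT t:{0..}. ?G t) - (LBINT t:{0..s}. ?G t)"
  proof -
    have "(LBINT t:{0..s} \<union> {s<..}. ?G t) = (LBINT t:{0..s}. ?G t) + (LBINT t:{s<..}. ?G t)"
      by (intro set_integral_Un) (use s in \<open>auto intro: set_integrable_subset[OF int]\<close>)
    moreover have "{0..s} \<union> {s<..} = {0..}" using s by auto
    moreover have "(LBINT t:{s<..}. ?G t) = (LBINT t:{s..}. ?G t)"
      unfolding set_lebesgue_integral_def
      by (rule integral_discrete_difference[of "{s}"]) (auto simp: indicator_def)
    ultimately show ?thesis by simp
  qed
  finally have "T s (U f) x = exp s * ((LBINT t:{0..}. ?G t) - (LBINT t:{0..s}. ?G t))" .
  moreover have "(LBINT t:{0..}. ?G t) = U f x" using x by (simp add: U_def)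
  ultimately show ?thesis by simp
qed

text \<open>By the shift formula \<open>T s (U f) - U f = (exp s - 1) U f - exp s \<integral>\<^sub>0\<^sup>s exp (- t) T t f dt\<close>, and the last integral is \<open>s f + o(s)\<close>, uniformly.\<close>

lemma generator_limit_U:
  assumes f: "f \<in> C0"
  shows "generator_limit (U f) (\<lambda>x. U f x - f x)"
  unfolding generator_limit_iff
proof (intro allI impI)
  fix e :: real assume e: "0 < e"
  obtain B where B: "0 < B" "\<And>x. 0 \<le> x \<Longrightarrow> \<bar>f x\<bar> \<le> B" using C0_bounded[OF f] by auto
  define \<eta> where "\<eta> = e / 4"
  have \<eta>: "0 < \<eta>" using e by (simp add: \<eta>_def)
  obtain h where h: "0 < h" "\<And>t x. t \<in> {0..h} \<Longrightarrow> 0 \<le> x \<Longrightarrow> \<bar>T t f x - f x\<bar> \<le> \<eta>"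
    using T_small[OF f \<eta>] by blast
  \<comment> \<open>chosen so that \<open>4 s B \<le> \<eta>\<close> for \<open>s < h0\<close>, which absorbs every second-order term\<close>
  define h0 where "h0 = min (min h 1) (\<eta> / (4 * B))"
  have h0: "0 < h0" "h0 \<le> h" "h0 \<le> 1" "4 * B * h0 \<le> \<eta>"
  proof -
    have "4 * B * h0 \<le> 4 * B * (\<eta> / (4 * B))" using B(1) by (intro mult_left_mono) (auto simp: h0_def)
    then show "4 * B * h0 \<le> \<eta>" using B(1) by simp
  qed (use h(1) \<eta> B(1) in \<open>auto simp: h0_def\<close>)
  have "\<bar>T s (U f) x - U f x - s * (U f x - f x)\<bar> \<le> e * s" if s: "0 < s" "s < h0" and x: "0 \<le> x" for s x
  proof -
    have sB: "4 * (s * B) \<le> \<eta>"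
    proof -
      have "s * B \<le> h0 * B" using s B(1) by (intro mult_right_mono) auto
      moreover have "4 * (h0 * B) \<le> \<eta>" using h0(4) by (simp only: mult_ac)
      ultimately show ?thesis by linarith
    qed
    have s2: "s\<^sup>2 \<le> s" using s h0 by (simp add: power2_eq_square)
    have "exp s \<le> 1 + s + s\<^sup>2" "1 + s \<le> exp s" using exp_bound[of s] s h0 exp_ge_add_one_self[of s] by auto
    then have es: "\<bar>exp s - 1\<bar> \<le> 2 * s" "\<bar>exp s - 1 - s\<bar> \<le> s\<^sup>2"
      using s s2 by linarith+
    have f1: "exp s * exp (- t) - 1 \<ge> 0" "exp s * exp (- t) - 1 \<le> 2 * s" if t: "t \<in> {0..s}" for t
    proof -
      have "exp s * exp (- t) = exp (s - t)" by (simp flip: exp_add)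
      moreover have "1 \<le> exp (s - t)" "exp (s - t) \<le> exp s" using t by auto
      ultimately show "exp s * exp (- t) - 1 \<ge> 0" "exp s * exp (- t) - 1 \<le> 2 * s" using es by linarith+
    qed
    let ?J = "LBINT t:{0..s}. exp s * (exp (- t) * T t f x) - f x"
    have int: "set_integrable lborel {0..s} (\<lambda>t. exp (- t) * T t f x)"
      by (rule set_integrable_subset[OF U_integrable[OF f x]]) auto
    have intc: "set_integrable lborel {0..s} (\<lambda>t. c)" for c :: real
      by (rule borel_integrable_atLeastAtMost') auto
    have "?J = exp s * (LBINT t:{0..s}. exp (- t) * T t f x) - s * f x"
      using set_integral_diff(2)[OF set_integrable_mult_right[OF int, of "exp s"] intc[of "f x"]] s
      by (simp add: set_integral_const)
    then have main: "T s (U f) x - U f x - s * (U f x - f x) = (exp s - 1 - s) * U f x - ?J"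
      using T_U_shift[OF f _ x, of s] s by (simp add: algebra_simps)
    have "\<bar>?J\<bar> \<le> (LBINT t:{0..s}. \<bar>exp s * (exp (- t) * T t f x) - f x\<bar>)"
      by (rule set_integral_abs_le)
    also have "\<dots> \<le> (LBINT t:{0..s}. 2 * s * B + \<eta>)"
    proof (rule set_integral_mono)
      show "set_integrable lborel {0..s} (\<lambda>t. \<bar>exp s * (exp (- t) * T t f x) - f x\<bar>)"
        by (intro set_integrable_abs set_integral_diff(1) set_integrable_mult_right int intc)
      fix t assume t: "t \<in> {0..s}"
      have "exp s * (exp (- t) * T t f x) - f x = (exp s * exp (- t) - 1) * T t f x + (T t f x - f x)"
        by (simp add: algebra_simps)
      moreover have "\<bar>(exp s * exp (- t) - 1) * T t f x\<bar> \<le> (2 * s) * B"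
        unfolding abs_mult using f1[OF t] T_bound[OF _ f B(2) x, of t] t s by (intro mult_mono) auto
      moreover have "\<bar>T t f x - f x\<bar> \<le> \<eta>" using t s h0 x by (intro h(2)) auto
      ultimately show "\<bar>exp s * (exp (- t) * T t f x) - f x\<bar> \<le> 2 * s * B + \<eta>" by linarith
    qed (rule intc)
    also have "\<dots> = s * (2 * s * B + \<eta>)" using s by (simp add: set_integral_const)
    also have "\<dots> \<le> s * (\<eta> + \<eta>)"
      using s sB mult_pos_pos[OF s(1) B(1)] by (intro mult_left_mono) (auto simp: mult.assoc)
    finally have J: "\<bar>?J\<bar> \<le> s * (2 * \<eta>)" by simp
    have "\<bar>(exp s - 1 - s) * U f x\<bar> \<le> s\<^sup>2 * B"
      unfolding abs_mult using es U_bound[OF f B(2) x] by (intro mult_mono) auto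
    also have "\<dots> = s * (s * B)" by (simp add: power2_eq_square)
    also have "\<dots> \<le> s * \<eta>" using s sB mult_pos_pos[OF s(1) B(1)] by (intro mult_left_mono) auto
    finally have "\<bar>T s (U f) x - U f x - s * (U f x - f x)\<bar> \<le> s * \<eta> + s * (2 * \<eta>)"
      unfolding main using J by linarith
    also have "\<dots> \<le> e * s" using s e by (simp add: \<eta>_def field_simps)
    finally show ?thesis .
  qed
  then show "\<exists>h>0. \<forall>t x. 0 < t \<longrightarrow> t < h \<longrightarrow> 0 \<le> x \<longrightarrow> \<bar>T t (U f) x - U f x - t * (U f x - f x)\<bar> \<le> e * t"
    using h0(1) by blast
qed

text \<open>With \<open>f = u - g\<close>, the difference \<open>w = u - U f\<close> satisfies \<open>L w = w\<close>, hence vanishes.\<close>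

lemma generator_limit_imp_U:
  assumes u: "u \<in> C0" "generator_limit u g"
  shows "u = U (\<lambda>x\<in>{0..}. u x - g x)"
proof -
  define f where "f = (\<lambda>x\<in>{0..}. u x - g x)"
  have f: "f \<in> C0" unfolding f_def by (rule C0_diff_restrict[OF u(1) generator_limit_C0[OF u]])
  let ?w = "\<lambda>x\<in>{0..}. 1 * u x + -1 * U f x"
  have "generator_limit ?w (\<lambda>x. g x - (U f x - f x))"
    by (rule generator_limit_diff[OF u U_C0[OF f] generator_limit_U[OF f]])
  then have "generator_limit ?w ?w"
    unfolding generator_limit_iff by (auto simp: f_def algebra_simps)
  from generator_fixpoint_zero[OF C0_lincomb[OF u(1) U_C0[OF f]] this]
  have "u x = U f x" if "0 \<le> x" for x using that by simp
  moreover have "u x = U f x" if "\<not> 0 \<le> x" for x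
    using that u(1) by (auto simp: U_def C0_def extensional_def)
  ultimately show ?thesis unfolding f_def by (intro ext) metis
qed

theorem domain_eq_range_U: "{u \<in> C0. \<exists>g. generator_limit u g} = {U f | f. f \<in> C0}"
proof safe
  fix u g assume u: "u \<in> C0" "generator_limit u g"
  have "(\<lambda>x\<in>{0..}. u x - g x) \<in> C0" by (rule C0_diff_restrict[OF u(1) generator_limit_C0[OF u]])
  then show "\<exists>f. u = U f \<and> f \<in> C0" using generator_limit_imp_U[OF u] by blast
qed (auto intro: U_C0 generator_limit_U)

end

section \<open>Random contractions of the half-line\<close>

text \<open>The operator of a random self-map of the half-line; the reflected process at a fixed time and one step of its discretisation are both of this form.\<close>

definition rand_op :: "'a measure \<Rightarrow> (real \<Rightarrow> 'a \<Rightarrow> real) \<Rightarrow> (real \<Rightarrow> real) \<Rightarrow> real \<Rightarrow> real" where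
  "rand_op M \<phi> f = (\<lambda>x\<in>{0..}. \<integral>\<omega>. f (\<phi> x \<omega>) \<partial>M)"

text \<open>Pathwise contraction makes the operator preserve moduli of continuity, in particular Lipschitz constants; the last condition makes it preserve decay at infinity.\<close>

locale random_contraction = prob_space M
  for M :: "'a measure" and \<phi> :: "real \<Rightarrow> 'a \<Rightarrow> real" +
  assumes measurable_map: "0 \<le> x \<Longrightarrow> \<phi> x \<in> borel_measurable M"
    and map_nonneg: "\<omega> \<in> space M \<Longrightarrow> 0 \<le> x \<Longrightarrow> 0 \<le> \<phi> x \<omega>"
    and map_contraction: "\<omega> \<in> space M \<Longrightarrow> 0 \<le> x \<Longrightarrow> 0 \<le> y \<Longrightarrow> \<bar>\<phi> x \<omega> - \<phi> y \<omega>\<bar> \<le> \<bar>x - y\<bar>"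
    and map_escape: "\<omega> \<in> space M \<Longrightarrow> \<exists>c. \<forall>x\<ge>0. x + c \<le> \<phi> x \<omega>"
begin

lemma integrable_map:
  assumes f: "f \<in> C0" and x: "0 \<le> x"
  shows "integrable M (\<lambda>\<omega>. f (\<phi> x \<omega>))"
proof -
  obtain B where B: "\<And>x. 0 \<le> x \<Longrightarrow> \<bar>f x\<bar> \<le> B" using C0_bounded[OF f] by auto
  show ?thesis
    by (rule integrable_const_bound[of _ B])
       (use B map_nonneg x measurable_compose[OF measurable_map[OF x] C0_borel_measurable[OF f]] in auto)
qed

lemma rand_op_lincomb:
  assumes "f \<in> C0" "g \<in> C0"
  shows "rand_op M \<phi> (\<lambda>x\<in>{0..}. a * f x + b * g x) = (\<lambda>x\<in>{0..}. a * rand_op M \<phi> f x + b * rand_op M \<phi> g x)"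
proof
  fix x
  show "rand_op M \<phi> (\<lambda>x\<in>{0..}. a * f x + b * g x) x = (\<lambda>x\<in>{0..}. a * rand_op M \<phi> f x + b * rand_op M \<phi> g x) x"
  proof (cases "0 \<le> x")
    case True
    have "(\<integral>\<omega>. (\<lambda>x\<in>{0..}. a * f x + b * g x) (\<phi> x \<omega>) \<partial>M) = (\<integral>\<omega>. a * f (\<phi> x \<omega>) + b * g (\<phi> x \<omega>) \<partial>M)"
      by (rule Bochner_Integration.integral_cong) (use map_nonneg True in auto)
    then show ?thesis using True integrable_map assms by (simp add: rand_op_def)
  qed (simp add: rand_op_def)
qed

lemma rand_op_bound:
  assumes f: "f \<in> C0" and B: "\<And>x. 0 \<le> x \<Longrightarrow> \<bar>f x\<bar> \<le> B" and x: "0 \<le> x"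
  shows "\<bar>rand_op M \<phi> f x\<bar> \<le> B"
proof -
  have "\<bar>\<integral>\<omega>. f (\<phi> x \<omega>) \<partial>M\<bar> \<le> (\<integral>\<omega>. \<bar>f (\<phi> x \<omega>)\<bar> \<partial>M)" using integral_norm_bound[of M "\<lambda>\<omega>. f (\<phi> x \<omega>)"] by simp
  also have "\<dots> \<le> (\<integral>\<omega>. B \<partial>M)" using integrable_map[OF f x] B map_nonneg x by (intro integral_mono) auto
  finally show ?thesis using x by (simp add: rand_op_def prob_space)
qed

lemma rand_op_nonneg:
  assumes "\<And>x. 0 \<le> x \<Longrightarrow> 0 \<le> f x" "0 \<le> x"
  shows "0 \<le> rand_op M \<phi> f x"
  using assms map_nonneg by (auto simp: rand_op_def intro!: Bochner_Integration.integral_nonneg)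

lemma rand_op_modulus:
  assumes f: "f \<in> C0" and m: "\<And>x y. 0 \<le> x \<Longrightarrow> 0 \<le> y \<Longrightarrow> \<bar>x - y\<bar> \<le> d \<Longrightarrow> \<bar>f x - f y\<bar> \<le> e"
    and xy: "0 \<le> x" "0 \<le> y" "\<bar>x - y\<bar> \<le> d"
  shows "\<bar>rand_op M \<phi> f x - rand_op M \<phi> f y\<bar> \<le> e"
proof -
  have "\<bar>rand_op M \<phi> f x - rand_op M \<phi> f y\<bar> = \<bar>\<integral>\<omega>. f (\<phi> x \<omega>) - f (\<phi> y \<omega>) \<partial>M\<bar>"
    using xy integrable_map[OF f] by (simp add: rand_op_def)
  also have "\<dots> \<le> (\<integral>\<omega>. \<bar>f (\<phi> x \<omega>) - f (\<phi> y \<omega>)\<bar> \<partial>M)"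
    using integral_norm_bound[of M "\<lambda>\<omega>. f (\<phi> x \<omega>) - f (\<phi> y \<omega>)"] by simp
  also have "\<dots> \<le> (\<integral>\<omega>. e \<partial>M)"
    using xy integrable_map[OF f] order_trans[OF map_contraction xy(3)]
    by (intro integral_mono integrable_abs Bochner_Integration.integrable_diff m map_nonneg) auto
  finally show ?thesis by (simp add: prob_space)
qed

lemma rand_op_C0:
  assumes f: "f \<in> C0" shows "rand_op M \<phi> f \<in> C0"
proof -
  obtain B where B: "\<And>x. 0 \<le> x \<Longrightarrow> \<bar>f x\<bar> \<le> B" using C0_bounded[OF f] by auto
  have "continuous_on {0..} (\<lambda>x. \<integral>\<omega>. f (\<phi> x \<omega>) \<partial>M)"
    unfolding continuous_on_iff
  proof (intro ballI allI impI)
    fix x e :: real assume x: "x \<in> {0..}" and e: "0 < e"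
    obtain d where d: "0 < d" "\<And>x y. 0 \<le> x \<Longrightarrow> 0 \<le> y \<Longrightarrow> \<bar>x - y\<bar> < d \<Longrightarrow> \<bar>f x - f y\<bar> < e/2"
      using C0_uniformly_continuous[OF f, of "e/2"] e by auto
    have "dist (\<integral>\<omega>. f (\<phi> y \<omega>) \<partial>M) (\<integral>\<omega>. f (\<phi> x \<omega>) \<partial>M) < e" if "y \<in> {0..}" "dist y x < d/2" for y
      using rand_op_modulus[OF f, of "d/2" "e/2" y x] d that x e
      by (auto simp: rand_op_def dist_real_def less_imp_le)
    then show "\<exists>d>0. \<forall>y\<in>{0..}. dist y x < d \<longrightarrow> dist (\<integral>\<omega>. f (\<phi> y \<omega>) \<partial>M) (\<integral>\<omega>. f (\<phi> x \<omega>) \<partial>M) < e"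
      using d(1) by (intro exI[of _ "d/2"]) auto
  qed
  moreover have "((\<lambda>x. \<integral>\<omega>. f (\<phi> x \<omega>) \<partial>M) \<longlongrightarrow> 0) at_top"
  proof -
    have "((\<lambda>x. \<integral>\<omega>. f (\<phi> (max 0 x) \<omega>) \<partial>M) \<longlongrightarrow> (\<integral>\<omega>. 0 \<partial>M)) at_top"
    proof (rule integral_dominated_convergence_at_top[where w = "\<lambda>_. B"])
      show "(\<lambda>\<omega>. f (\<phi> (max 0 x) \<omega>)) \<in> borel_measurable M" for x
        using borel_measurable_integrable[OF integrable_map[OF f, of "max 0 x"]] by simp
      show "\<forall>\<^sub>F x in at_top. AE \<omega> in M. norm (f (\<phi> (max 0 x) \<omega>)) \<le> B"
        using B map_nonneg by (intro always_eventually allI AE_I2) auto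
      show "AE \<omega> in M. ((\<lambda>x. f (\<phi> (max 0 x) \<omega>)) \<longlongrightarrow> 0) at_top"
      proof (intro AE_I2)
        fix \<omega> assume \<omega>: "\<omega> \<in> space M"
        obtain c where c: "\<And>x. 0 \<le> x \<Longrightarrow> x + c \<le> \<phi> x \<omega>" using map_escape[OF \<omega>] by blast
        have "filterlim (\<lambda>x. \<phi> (max 0 x) \<omega>) at_top at_top"
          unfolding filterlim_at_top
        proof
          fix K
          show "\<forall>\<^sub>F x in at_top. K \<le> \<phi> (max 0 x) \<omega>"
            using eventually_ge_at_top[of "max 0 (K - c)"]
          proof eventually_elim
            case (elim x)
            then show ?case using c[of x] by (auto simp: max_def split: if_splits)
          qed
        qed
        then show "((\<lambda>x. f (\<phi> (max 0 x) \<omega>)) \<longlongrightarrow> 0) at_top"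
          by (rule filterlim_compose[OF C0_D(2)[OF f]])
      qed
    qed auto
    then have "((\<lambda>x. \<integral>\<omega>. f (\<phi> (max 0 x) \<omega>) \<partial>M) \<longlongrightarrow> 0) at_top" by simp
    then show ?thesis
      by (rule Lim_transform_eventually) (auto intro: eventually_mono[OF eventually_ge_at_top[of 0]])
  qed
  ultimately show ?thesis unfolding rand_op_def by (rule C0_restrictI)
qed

end

text \<open>Use uniform continuity of \<open>f\<close> where \<open>\<Delta> < d\<close>, and boundedness elsewhere. The constants depend on \<open>f\<close>
  and \<open>e\<close> alone, which makes later estimates uniform in the starting point.\<close>

lemma (in prob_space) expectation_close:
  assumes f: "f \<in> C0" and e: "0 < e"
  shows "\<exists>d>0. \<exists>B>0. \<forall>X Y \<Delta>. X \<in> borel_measurable M \<longrightarrow> Y \<in> borel_measurable M \<longrightarrow> \<Delta> \<in> borel_measurable M \<longrightarrow>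
      (AE \<omega> in M. 0 \<le> X \<omega> \<and> 0 \<le> Y \<omega> \<and> \<bar>X \<omega> - Y \<omega>\<bar> \<le> \<Delta> \<omega>) \<longrightarrow>
      \<bar>(\<integral>\<omega>. f (X \<omega>) \<partial>M) - (\<integral>\<omega>. f (Y \<omega>) \<partial>M)\<bar> \<le> e + B * prob {\<omega> \<in> space M. d \<le> \<Delta> \<omega>}"
proof -
  obtain B where B: "0 < B" "\<And>x. 0 \<le> x \<Longrightarrow> \<bar>f x\<bar> \<le> B" using C0_bounded[OF f] by auto
  obtain d where d: "0 < d" "\<And>x y. 0 \<le> x \<Longrightarrow> 0 \<le> y \<Longrightarrow> \<bar>x - y\<bar> < d \<Longrightarrow> \<bar>f x - f y\<bar> < e"
    using C0_uniformly_continuous[OF f e] by auto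
  show ?thesis
  proof (rule exI[of _ d], intro conjI, rule d(1), rule exI[of _ "2 * B"], intro conjI allI impI)
    fix X Y \<Delta> :: "'a \<Rightarrow> real"
    assume [measurable]: "X \<in> borel_measurable M" "Y \<in> borel_measurable M" "\<Delta> \<in> borel_measurable M"
      and ae: "AE \<omega> in M. 0 \<le> X \<omega> \<and> 0 \<le> Y \<omega> \<and> \<bar>X \<omega> - Y \<omega>\<bar> \<le> \<Delta> \<omega>"
    have fm[measurable]: "f \<in> borel_measurable borel" by (rule C0_borel_measurable[OF f])
    have i: "integrable M (\<lambda>\<omega>. f (X \<omega>))" "integrable M (\<lambda>\<omega>. f (Y \<omega>))"
      using ae B by (auto intro!: integrable_const_bound[of _ B])
    let ?A = "{\<omega> \<in> space M. d \<le> \<Delta> \<omega>}"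
    have A: "?A \<in> sets M" by measurable
    have "\<bar>(\<integral>\<omega>. f (X \<omega>) \<partial>M) - (\<integral>\<omega>. f (Y \<omega>) \<partial>M)\<bar> = \<bar>\<integral>\<omega>. f (X \<omega>) - f (Y \<omega>) \<partial>M\<bar>" using i by simp
    also have "\<dots> \<le> (\<integral>\<omega>. \<bar>f (X \<omega>) - f (Y \<omega>)\<bar> \<partial>M)"
      using integral_norm_bound[of M "\<lambda>\<omega>. f (X \<omega>) - f (Y \<omega>)"] by simp
    also have "\<dots> \<le> (\<integral>\<omega>. e + 2 * B * indicator ?A \<omega> \<partial>M)"
    proof (rule integral_mono_AE)
      show "AE \<omega> in M. \<bar>f (X \<omega>) - f (Y \<omega>)\<bar> \<le> e + 2 * B * indicator ?A \<omega>"
        using ae AE_space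
      proof eventually_elim
        case (elim \<omega>)
        show ?case
        proof (cases "d \<le> \<Delta> \<omega>")
          case True
          then show ?thesis using elim B(2)[of "X \<omega>"] B(2)[of "Y \<omega>"] e by (simp add: abs_le_iff)
        next
          case False
          then have "\<bar>f (X \<omega>) - f (Y \<omega>)\<bar> < e" using elim by (intro d(2)) auto
          then show ?thesis using False by simp
        qed
      qed
    qed (use i A in \<open>auto intro!: integrable_real_indicator simp: emeasure_eq_measure\<close>)
    also have "\<dots> = (\<integral>\<omega>. e \<partial>M) + (\<integral>\<omega>. 2 * B * indicator ?A \<omega> \<partial>M)"
      using A by (intro Bochner_Integration.integral_add integrable_mult_right integrable_real_indicator)
        (auto simp: emeasure_eq_measure)
    also have "\<dots> = e + 2 * B * prob ?A" using A by (simp add: prob_space)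
    finally show "\<bar>(\<integral>\<omega>. f (X \<omega>) \<partial>M) - (\<integral>\<omega>. f (Y \<omega>) \<partial>M)\<bar> \<le> e + 2 * B * prob ?A" .
  qed (use B d in auto)
qed

lemma (in prob_space) prob_tendsto_zero:
  fixes \<Delta> :: "nat \<Rightarrow> 'a \<Rightarrow> real"
  assumes [measurable]: "\<And>n. \<Delta> n \<in> borel_measurable M" and lim: "AE \<omega> in M. (\<lambda>n. \<Delta> n \<omega>) \<longlonglongrightarrow> 0" and d: "0 < d"
  shows "(\<lambda>n. prob {\<omega> \<in> space M. d \<le> \<Delta> n \<omega>}) \<longlonglongrightarrow> 0"
proof -
  let ?A = "\<lambda>n. {\<omega> \<in> space M. d \<le> \<Delta> n \<omega>}"
  have "(\<lambda>n. \<integral>\<omega>. indicator (?A n) \<omega> \<partial>M) \<longlonglongrightarrow> (\<integral>\<omega>. (0::real) \<partial>M)"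
  proof (rule integral_dominated_convergence[where w = "\<lambda>_. 1"])
    show "AE \<omega> in M. (\<lambda>n. indicat_real (?A n) \<omega>) \<longlonglongrightarrow> 0"
      using lim
    proof eventually_elim
      case (elim \<omega>)
      have "\<forall>\<^sub>F n in sequentially. \<Delta> n \<omega> < d" using order_tendstoD(2)[OF elim d] .
      then have "\<forall>\<^sub>F n in sequentially. indicat_real (?A n) \<omega> = 0" by eventually_elim auto
      then show ?case by (rule tendsto_eventually)
    qed
  qed (auto simp: indicator_def)
  then show ?thesis by simp
qed

section \<open>Cadlag paths and the Lindley recursion\<close>

text \<open>By bisection: the one-sided limits at a point bound the path near that point.\<close>

lemma cadlag_bounded:
  fixes z :: "real \<Rightarrow> real"
  assumes rc: "\<And>t. 0 \<le> t \<Longrightarrow> (z \<longlongrightarrow> z t) (at_right t)"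
    and ll: "\<And>t. 0 < t \<Longrightarrow> \<exists>l. (z \<longlongrightarrow> l) (at_left t)"
    and T: "0 \<le> T"
  obtains B where "\<And>s. 0 \<le> s \<Longrightarrow> s \<le> T \<Longrightarrow> \<bar>z s\<bar> \<le> B"
proof -
  define P where "P a b \<longleftrightarrow> (\<exists>B. \<forall>s. 0 \<le> s \<and> s \<in> {a..b} \<longrightarrow> \<bar>z s\<bar> \<le> B)" for a b
  have "P 0 T"
    using T
  proof (induction rule: Bolzano)
    case (trans a b c)
    then obtain B B' where B: "\<And>s. 0 \<le> s \<and> s \<in> {a..b} \<Longrightarrow> \<bar>z s\<bar> \<le> B" "\<And>s. 0 \<le> s \<and> s \<in> {b..c} \<Longrightarrow> \<bar>z s\<bar> \<le> B'"
      unfolding P_def by blast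
    have "\<bar>z s\<bar> \<le> max B B'" if "0 \<le> s \<and> s \<in> {a..c}" for s
      using that B(1)[of s] B(2)[of s] by (cases "s \<le> b") auto
    then show ?case unfolding P_def by blast
  next
    case (local x)
    obtain d1 where d1: "x < d1" "\<And>s. x < s \<Longrightarrow> s < d1 \<Longrightarrow> dist (z s) (z x) < 1"
      using tendstoD[OF rc[OF local(1)], of 1] unfolding eventually_at_right_field by auto
    obtain d2 l where d2: "d2 < x" "\<And>s. 0 \<le> s \<Longrightarrow> d2 < s \<Longrightarrow> s < x \<Longrightarrow> dist (z s) l < 1"
    proof (cases "0 < x")
      case True
      obtain l where "(z \<longlongrightarrow> l) (at_left x)" using ll[OF True] by blast
      from tendstoD[OF this, of 1] obtain b where "b < x" "\<And>s. b < s \<Longrightarrow> s < x \<Longrightarrow> dist (z s) l < 1"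
        unfolding eventually_at_left_field by auto
      then show ?thesis using that by blast
    next
      case False
      then show ?thesis using that[of "x - 1" 0] local by auto
    qed
    define B where "B = max (\<bar>l\<bar> + 1) (\<bar>z x\<bar> + 1)"
    have near: "\<bar>z s\<bar> \<le> B" if "0 \<le> s" "d2 < s" "s < d1" for s
    proof -
      consider "s < x" | "s = x" | "x < s" by linarith
      then show ?thesis
        by cases (use d1(2)[of s] d2(2)[of s] that in \<open>auto simp: B_def dist_real_def\<close>)
    qed
    show ?case
    proof (intro exI[of _ "min (d1 - x) (x - d2)"] conjI allI impI)
      show "0 < min (d1 - x) (x - d2)" using d1(1) d2(1) by auto
      fix a b assume ab: "a \<le> x \<and> x \<le> b \<and> b - a < min (d1 - x) (x - d2)"
      show "P a b" unfolding P_def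
        by (intro exI[of _ B] allI impI near) (use ab in auto)
    qed
  qed
  then show ?thesis using that unfolding P_def by auto
qed

text \<open>Right continuity suffices if every \<open>u\<close> is approximated by grid points from the right, including the end point \<open>T\<close> itself.\<close>

lemma partition_inf_tendsto:
  fixes z :: "real \<Rightarrow> real" and \<tau> :: "nat \<Rightarrow> nat \<Rightarrow> real"
  assumes rc: "\<And>t. 0 \<le> t \<Longrightarrow> (z \<longlongrightarrow> z t) (at_right t)"
    and bdd: "bdd_below (z ` {0..T})" and T: "0 \<le> T"
    and \<tau>: "\<And>n k. k \<le> N n \<Longrightarrow> \<tau> n k \<in> {0..T}"
    and mesh: "\<And>n u. 0 \<le> u \<Longrightarrow> u \<le> T \<Longrightarrow> \<exists>k\<le>N n. u \<le> \<tau> n k \<and> \<tau> n k \<le> u + T / Suc n"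
  shows "(\<lambda>n. Min ((\<lambda>k. z (\<tau> n k)) ` {..N n})) \<longlonglongrightarrow> (INF s\<in>{0..T}. z s)"
proof (rule LIMSEQ_I)
  fix e :: real assume e: "0 < e"
  let ?I = "INF s\<in>{0..T}. z s"
  have ge: "?I \<le> Min ((\<lambda>k. z (\<tau> n k)) ` {..N n})" for n
    by (intro Min.boundedI) (auto intro!: cINF_lower[OF bdd] \<tau>)
  have "\<exists>x\<in>z ` {0..T}. x < ?I + e/2"
    by (rule cInf_lessD) (use e T in auto)
  then obtain u where u: "u \<in> {0..T}" "z u < ?I + e/2" by auto
  obtain b where b: "u < b" "\<And>s. u < s \<Longrightarrow> s < b \<Longrightarrow> z s < ?I + e/2"
    using order_tendstoD(2)[OF rc u(2)] u(1) unfolding eventually_at_right_field by auto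
  have "(\<lambda>n. T / Suc n) \<longlonglongrightarrow> 0"
    using tendsto_mult_left[OF LIMSEQ_inverse_real_of_nat, of T] by (simp add: field_simps)
  then have "\<forall>\<^sub>F n in sequentially. T / Suc n < b - u"
    by (rule order_tendstoD) (use b in auto)
  then have "\<forall>\<^sub>F n in sequentially. norm (Min ((\<lambda>k. z (\<tau> n k)) ` {..N n}) - ?I) < e"
  proof eventually_elim
    case (elim n)
    obtain k where k: "k \<le> N n" "u \<le> \<tau> n k" "\<tau> n k \<le> u + T / Suc n" using mesh[of u n] u by auto
    have "Min ((\<lambda>k. z (\<tau> n k)) ` {..N n}) \<le> z (\<tau> n k)" using k by (intro Min.coboundedI) auto
    also have "\<dots> < ?I + e/2" using k elim b(2)[of "\<tau> n k"] u(2) by (cases "\<tau> n k = u") auto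
    finally show ?case using ge[of n] e by simp
  qed
  then show "\<exists>no. \<forall>n\<ge>no. norm (Min ((\<lambda>k. z (\<tau> n k)) ` {..N n}) - ?I) < e"
    by (simp add: eventually_sequentially)
qed

text \<open>The random walk with increments \<open>\<xi>\<close>, reflected at \<open>0\<close>.\<close>

primrec lindley :: "real \<Rightarrow> (nat \<Rightarrow> real) \<Rightarrow> nat \<Rightarrow> real" where
  "lindley x \<xi> 0 = x"
| "lindley x \<xi> (Suc n) = max 0 (lindley x \<xi> n + \<xi> n)"

lemma lindley_nonneg: "0 \<le> x \<Longrightarrow> 0 \<le> lindley x \<xi> n"
  by (induction n) auto

lemma lindley_cong: "(\<And>i. i < n \<Longrightarrow> \<xi> i = \<xi>' i) \<Longrightarrow> lindley x \<xi> n = lindley x \<xi>' n"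
  by (induction n) auto

text \<open>The reflected walk is the free walk \<open>x + z n\<close>, pushed up by the amount by which its minimum falls below \<open>0\<close>.\<close>

lemma lindley_eq:
  assumes z: "z 0 = 0" and x: "0 \<le> x"
  shows "lindley x (\<lambda>k. z (Suc k) - z k) n = z n + max x (- Min (z ` {..n}))"
proof (induction n)
  case 0 then show ?case using z x by simp
next
  case (Suc n)
  have "Min (z ` {..Suc n}) = min (z (Suc n)) (Min (z ` {..n}))"
    by (simp add: atMost_Suc)
  moreover have "max 0 (a + max x (- m) + (b - a)) = b + max x (- min b m)" for a b m :: real
    by (auto simp: max_def min_def)
  ultimately show ?case by (simp only: lindley.simps Suc)
qed

lemma lindley_measurable:
  "(\<lambda>\<xi>. lindley x \<xi> n) \<in> borel_measurable (PiM {..<n} (\<lambda>_. borel))"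
proof -
  have "(\<lambda>\<xi>. lindley x \<xi> k) \<in> borel_measurable (PiM {..<n} (\<lambda>_. borel))" if "k \<le> n" for k
    using that
  proof (induction k)
    case (Suc k)
    then have [measurable]: "(\<lambda>\<xi>. lindley x \<xi> k) \<in> borel_measurable (PiM {..<n} (\<lambda>_. borel))"
      "(\<lambda>\<xi>. \<xi> k) \<in> borel_measurable (PiM {..<n} (\<lambda>_. borel))"
      by (auto intro!: measurable_component_singleton)
    show ?case unfolding lindley.simps by measurable
  qed simp
  then show ?thesis by simp
qed

lemma telescope_bound:
  fixes a :: "nat \<Rightarrow> real"
  assumes "\<And>k. k < n \<Longrightarrow> \<bar>a (Suc k) - a k - c\<bar> \<le> e"
  shows "\<bar>a n - a 0 - real n * c\<bar> \<le> real n * e"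
  using assms
proof (induction n)
  case (Suc n)
  have "\<bar>a n - a 0 - real n * c\<bar> \<le> real n * e" by (rule Suc.IH) (use Suc.prems in auto)
  moreover have "\<bar>a (Suc n) - a n - c\<bar> \<le> e" by (rule Suc.prems) simp
  moreover have "real (Suc n) * c = real n * c + c" "real (Suc n) * e = real n * e + e" by (simp_all add: distrib_right)
  ultimately show ?case by linarith
qed simp

lemma grid_point:
  fixes s u :: real
  assumes u: "0 \<le> u" "u \<le> s"
  shows "\<exists>k\<le>Suc n. u \<le> s * real k / Suc n \<and> s * real k / Suc n \<le> u + s / Suc n"
proof (cases "s = 0")
  case True
  then show ?thesis using u by (intro exI[of _ 0]) simp
next
  case False
  obtain N where N: "N = real (Suc n)" "0 < N" by simp
  have s: "0 < s" using False u by simp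
  obtain v where v: "v = u * N / s" by blast
  have v0: "0 \<le> v" unfolding v using s N(2) u(1) by simp
  have sv: "s * v / N = u" unfolding v using s N(2) by simp
  have "u * N \<le> s * N" using u(2) N(2) by (intro mult_right_mono) simp_all
  then have vN: "v \<le> N" unfolding v pos_divide_le_eq[OF s] mult.commute[of N] .
  obtain k where kd: "k = nat \<lceil>v\<rceil>" by blast
  have k: "v \<le> real k" "real k \<le> v + 1" unfolding kd using v0 by linarith+
  have kn: "k \<le> Suc n" unfolding kd using vN N(1) by linarith
  have "s * v / N \<le> s * real k / N" using k(1) s N(2) by (intro divide_right_mono mult_left_mono) simp_all
  moreover have "s * real k / N \<le> s * (v + 1) / N" using k(2) s N(2) by (intro divide_right_mono mult_left_mono) simp_all
  moreover have "s * (v + 1) / N = s * v / N + s / N" by (simp only: distrib_left add_divide_distrib mult_1_right)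
  ultimately have "u \<le> s * real k / N \<and> s * real k / N \<le> u + s / N" using sv by linarith
  then show ?thesis using kn unfolding N(1) by blast
qed

section \<open>The semigroup of the reflected process\<close>

context levy_process
begin

definition step :: "real \<Rightarrow> (real \<Rightarrow> real) \<Rightarrow> real \<Rightarrow> real" where
  "step h = rand_op M (\<lambda>x \<omega>. max 0 (x + Z h \<omega>))"

lemma step_contraction: "0 \<le> h \<Longrightarrow> random_contraction M (\<lambda>x \<omega>. max 0 (x + Z h \<omega>))"
proof
  assume h: "0 \<le> h"
  note [measurable] = measurable_Z[OF h]
  show "(\<lambda>\<omega>. max 0 (x + Z h \<omega>)) \<in> borel_measurable M" for x by measurable
  show "\<exists>c. \<forall>x\<ge>0. x + c \<le> max 0 (x + Z h \<omega>)" for \<omega> by (intro exI[of _ "Z h \<omega>"]) auto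
qed (auto simp: max_def)

lemma step_C0: "0 \<le> h \<Longrightarrow> f \<in> C0 \<Longrightarrow> step h f \<in> C0"
  unfolding step_def by (rule random_contraction.rand_op_C0[OF step_contraction])

lemma step_lincomb:
  "0 \<le> h \<Longrightarrow> f \<in> C0 \<Longrightarrow> g \<in> C0 \<Longrightarrow> step h (\<lambda>x\<in>{0..}. a * f x + b * g x) = (\<lambda>x\<in>{0..}. a * step h f x + b * step h g x)"
  unfolding step_def by (rule random_contraction.rand_op_lincomb[OF step_contraction])

lemma step_bound:
  "0 \<le> h \<Longrightarrow> f \<in> C0 \<Longrightarrow> (\<And>x. 0 \<le> x \<Longrightarrow> \<bar>f x\<bar> \<le> B) \<Longrightarrow> 0 \<le> x \<Longrightarrow> \<bar>step h f x\<bar> \<le> B"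
  unfolding step_def by (rule random_contraction.rand_op_bound[OF step_contraction])

lemma step_pow_C0: "0 \<le> h \<Longrightarrow> f \<in> C0 \<Longrightarrow> (step h ^^ n) f \<in> C0"
  by (induction n) (auto intro: step_C0)

lemma step_pow_diff_bound:
  assumes h: "0 \<le> h" and f: "f \<in> C0" and g: "g \<in> C0" and B: "\<And>x. 0 \<le> x \<Longrightarrow> \<bar>f x - g x\<bar> \<le> B"
  shows "0 \<le> x \<Longrightarrow> \<bar>(step h ^^ n) f x - (step h ^^ n) g x\<bar> \<le> B"
proof (induction n arbitrary: x)
  case (Suc n)
  let ?f = "(step h ^^ n) f" and ?g = "(step h ^^ n) g"
  have C: "?f \<in> C0" "?g \<in> C0" using h f g by (auto intro: step_pow_C0)
  have "\<bar>step h (\<lambda>x\<in>{0..}. 1 * ?f x + -1 * ?g x) x\<bar> \<le> B"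
    by (rule step_bound[OF h C0_lincomb[OF C]]) (use Suc in auto)
  then show ?case using Suc.prems step_lincomb[OF h C, of 1 "-1"] by simp
qed (use B in auto)

text \<open>The product of the one-step operators over the first \<open>n\<close> cells of a partition, the first cell being applied last.\<close>

primrec steps :: "(nat \<Rightarrow> real) \<Rightarrow> nat \<Rightarrow> (real \<Rightarrow> real) \<Rightarrow> real \<Rightarrow> real" where
  "steps \<tau> 0 f = f"
| "steps \<tau> (Suc n) f = steps \<tau> n (step (\<tau> (Suc n) - \<tau> n) f)"

lemma steps_const:
  assumes "\<And>k. k < n \<Longrightarrow> \<tau> (Suc k) - \<tau> k = h"
  shows "steps \<tau> n f = (step h ^^ n) f"
  using assms by (induction n arbitrary: f) (simp_all add: funpow_swap1)

lemma steps_append: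
  assumes "\<And>k. k < m \<Longrightarrow> \<tau> (Suc (n + k)) - \<tau> (n + k) = h"
  shows "steps \<tau> (n + m) f = steps \<tau> n ((step h ^^ m) f)"
  using assms by (induction m arbitrary: f) (simp_all add: funpow_swap1)

text \<open>Condition on all increments but the last: the last one is independent of the walk so far and distributed as \<open>Z\<close> at the length of its cell.\<close>

lemma expectation_lindley_eq_steps:
  assumes \<tau>: "mono \<tau>" "0 \<le> \<tau> 0" and f: "f \<in> C0" and x: "0 \<le> x"
  shows "(\<integral>\<omega>. f (lindley x (\<lambda>k. Z (\<tau> (Suc k)) \<omega> - Z (\<tau> k) \<omega>) n) \<partial>M) = steps \<tau> n f x"
  using f
proof (induction n arbitrary: f)
  case 0 then show ?case by (simp add: prob_space)
next
  case (Suc n)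
  define X where "X = (\<lambda>k \<omega>. Z (\<tau> (Suc k)) \<omega> - Z (\<tau> k) \<omega>)"
  define W where "W = (\<lambda>\<omega>. lindley x (\<lambda>k. X k \<omega>) n)"
  define d where "d = \<tau> (Suc n) - \<tau> n"
  have pos: "0 \<le> \<tau> k" for k using \<tau> by (auto simp: mono_def intro: order_trans[of 0 "\<tau> 0"])
  have d: "0 \<le> d" using \<tau> by (simp add: d_def mono_def)
  have fm[measurable]: "f \<in> borel_measurable borel" by (rule C0_borel_measurable[OF Suc.prems])
  obtain B where B: "\<And>x. 0 \<le> x \<Longrightarrow> \<bar>f x\<bar> \<le> B" using C0_bounded[OF Suc.prems] by auto
  have ind: "indep_vars (\<lambda>_. borel) X {..<Suc n}"
    unfolding X_def by (rule indep_increments[OF \<tau>(2,1)])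
  have "indep_var borel ((\<lambda>\<xi>. lindley x \<xi> n) \<circ> (\<lambda>\<omega>. restrict (\<lambda>i. X i \<omega>) {..<n}))
      borel ((\<lambda>\<xi>. \<xi> n) \<circ> (\<lambda>\<omega>. restrict (\<lambda>i. X i \<omega>) {n}))"
    by (rule indep_var_compose[OF indep_var_restrict[OF ind] lindley_measurable measurable_component_singleton]) auto
  moreover have "(\<lambda>\<xi>. lindley x \<xi> n) \<circ> (\<lambda>\<omega>. restrict (\<lambda>i. X i \<omega>) {..<n}) = W"
    by (auto simp: W_def fun_eq_iff intro!: lindley_cong)
  moreover have "(\<lambda>\<xi>. \<xi> n) \<circ> (\<lambda>\<omega>. restrict (\<lambda>i. X i \<omega>) {n}) = X n" by auto
  ultimately have WX: "indep_var borel W borel (X n)" by simp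
  then have [measurable]: "W \<in> borel_measurable M" "X n \<in> borel_measurable M"
    and pair: "distr M borel W \<Otimes>\<^sub>M distr M borel (X n) = distr M (borel \<Otimes>\<^sub>M borel) (\<lambda>\<omega>. (W \<omega>, X n \<omega>))"
    unfolding indep_var_distribution_eq by auto
  have law: "distr M borel (X n) = distr M borel (Z d)"
    using stationary_increments[OF pos[of n] d] by (simp add: X_def d_def)
  have [measurable]: "Z d \<in> borel_measurable M" by (rule measurable_Z[OF d])
  interpret DW: prob_space "distr M borel W" by (rule prob_space_distr) measurable
  interpret DZ: prob_space "distr M borel (Z d)" by (rule prob_space_distr) measurable
  interpret P: pair_prob_space "distr M borel W" "distr M borel (Z d)" ..
  let ?g = "\<lambda>(w, s). f (max 0 (w + s))"
  have gm: "?g \<in> borel_measurable (borel \<Otimes>\<^sub>M borel)"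
    using measurable_compose[OF _ fm, of "\<lambda>p. max 0 (fst p + snd p)" "borel \<Otimes>\<^sub>M borel"]
    by (simp add: split_beta')
  have "(\<integral>\<omega>. f (lindley x (\<lambda>k. Z (\<tau> (Suc k)) \<omega> - Z (\<tau> k) \<omega>) (Suc n)) \<partial>M) = (\<integral>\<omega>. ?g (W \<omega>, X n \<omega>) \<partial>M)"
    by (simp add: W_def X_def)
  also have "\<dots> = (\<integral>p. ?g p \<partial>(distr M (borel \<Otimes>\<^sub>M borel) (\<lambda>\<omega>. (W \<omega>, X n \<omega>))))"
    by (rule integral_distr[symmetric]) (use gm in measurable)
  also have "\<dots> = (\<integral>p. ?g p \<partial>(distr M borel W \<Otimes>\<^sub>M distr M borel (Z d)))"
    unfolding pair[symmetric] law ..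
  also have "\<dots> = (\<integral>w. \<integral>s. f (max 0 (w + s)) \<partial>distr M borel (Z d) \<partial>distr M borel W)"
  proof (rule P.integral_fst[symmetric, where f = "\<lambda>w s. f (max 0 (w + s))"])
    show "integrable (distr M borel W \<Otimes>\<^sub>M distr M borel (Z d)) (\<lambda>(w, s). f (max 0 (w + s)))"
    proof (rule P.P.integrable_const_bound[of _ B])
      show "?g \<in> borel_measurable (distr M borel W \<Otimes>\<^sub>M distr M borel (Z d))"
        using gm by (simp cong: measurable_cong_sets)
    qed (auto intro!: AE_I2 B)
  qed
  also have "\<dots> = (\<integral>w. \<integral>\<omega>. f (max 0 (w + Z d \<omega>)) \<partial>M \<partial>distr M borel W)"
    by (rule Bochner_Integration.integral_cong[OF refl], rule integral_distr) measurable
  also have "\<dots> = (\<integral>w. step d f w \<partial>distr M borel W)"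
  proof (rule integral_cong_AE)
    have sm: "step d f \<in> borel_measurable borel" by (rule C0_borel_measurable[OF step_C0[OF d Suc.prems]])
    then show "step d f \<in> borel_measurable (distr M borel W)" by simp
    have "(\<lambda>w. \<integral>s. f (max 0 (w + s)) \<partial>distr M borel (Z d)) \<in> borel_measurable (distr M borel W)"
      using gm by (intro DZ.borel_measurable_lebesgue_integral) (simp cong: measurable_cong_sets)
    then show "(\<lambda>w. \<integral>\<omega>. f (max 0 (w + Z d \<omega>)) \<partial>M) \<in> borel_measurable (distr M borel W)"
      by (subst (asm) integral_distr; measurable)
    have "AE w in distr M borel W. 0 \<le> w"
    proof (subst AE_distr_iff)
      show "AE \<omega> in M. 0 \<le> W \<omega>" by (intro AE_I2) (simp add: W_def lindley_nonneg[OF x])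
    qed measurable
    then show "AE w in distr M borel W. (\<integral>\<omega>. f (max 0 (w + Z d \<omega>)) \<partial>M) = step d f w"
      by eventually_elim (simp add: step_def rand_op_def)
  qed
  also have "\<dots> = (\<integral>\<omega>. step d f (W \<omega>) \<partial>M)"
    by (rule integral_distr) (use C0_borel_measurable[OF step_C0[OF d Suc.prems]] in measurable)
  also have "\<dots> = steps \<tau> n (step d f) x"
    unfolding W_def X_def by (rule Suc.IH[OF step_C0[OF d Suc.prems]])
  finally show ?case by (simp add: d_def)
qed

lemma path_bounded:
  assumes \<omega>: "\<omega> \<in> space M" and T: "0 \<le> T"
  obtains B where "\<And>s. 0 \<le> s \<Longrightarrow> s \<le> T \<Longrightarrow> \<bar>Z s \<omega>\<bar> \<le> B"
  using cadlag_bounded[OF right_continuous[OF \<omega>] left_limits[OF \<omega>] T] by blast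

lemma path_bdd_below:
  assumes "\<omega> \<in> space M" "0 \<le> T"
  shows "bdd_below ((\<lambda>s. Z s \<omega>) ` {0..T})"
proof -
  obtain B where "\<And>s. 0 \<le> s \<Longrightarrow> s \<le> T \<Longrightarrow> \<bar>Z s \<omega>\<bar> \<le> B" using path_bounded[OF assms] by blast
  then show ?thesis by (intro bdd_belowI2[of _ "- B"]) (auto simp: abs_le_iff minus_le_iff)
qed

lemma running_inf_le: "\<omega> \<in> space M \<Longrightarrow> 0 \<le> s \<Longrightarrow> s \<le> t \<Longrightarrow> running_inf Z t \<omega> \<le> Z s \<omega>"
  unfolding running_inf_def by (intro cINF_lower path_bdd_below) auto

text \<open>Partition of \<open>[0, s + t]\<close> into \<open>Suc n\<close> equal parts of \<open>[0, s]\<close> and as many of \<open>[s, s + t]\<close>;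
  the break at \<open>s\<close> is what yields the semigroup property in the limit. The minimum and the truncated
  subtraction freeze each summand while \<open>k\<close> runs through the other half.\<close>

definition two_part :: "real \<Rightarrow> real \<Rightarrow> nat \<Rightarrow> nat \<Rightarrow> real" where
  "two_part s t n k = s * real (min k (Suc n)) / Suc n + t * real (k - Suc n) / Suc n"

lemma two_part_0: "two_part s t n 0 = 0"
  by (simp add: two_part_def)

lemma two_part_mono: "0 \<le> s \<Longrightarrow> 0 \<le> t \<Longrightarrow> mono (two_part s t n)"
  unfolding two_part_def by (intro monoI add_mono divide_right_mono mult_left_mono) auto

lemma two_part_last: "two_part s t n (Suc n + Suc n) = s + t"
  by (simp add: two_part_def del: of_nat_Suc)

lemma two_part_first: "k \<le> Suc n \<Longrightarrow> two_part s t n k = s * real k / Suc n"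
  by (simp add: two_part_def)

lemma two_part_second: "two_part s t n (Suc n + k) = s + t * real k / Suc n"
  by (simp add: two_part_def del: of_nat_Suc)

lemma two_part_mesh:
  assumes st: "0 \<le> s" "0 \<le> t" and u: "0 \<le> u" "u \<le> s + t"
  shows "\<exists>k\<le>Suc n + Suc n. u \<le> two_part s t n k \<and> two_part s t n k \<le> u + (s + t) / Suc n"
proof -
  have div: "s / Suc n \<le> (s + t) / Suc n" "t / Suc n \<le> (s + t) / Suc n" by (rule divide_right_mono; use st in simp)+
  show ?thesis
  proof (cases "u \<le> s")
    case True
    obtain k where k: "k \<le> Suc n" "u \<le> s * real k / Suc n" "s * real k / Suc n \<le> u + s / Suc n"
      using grid_point[OF u(1) True] by blast
    have "two_part s t n k = s * real k / Suc n" by (rule two_part_first[OF k(1)])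
    then have "u \<le> two_part s t n k \<and> two_part s t n k \<le> u + (s + t) / Suc n" using div k by linarith
    moreover have "k \<le> Suc n + Suc n" using k(1) by linarith
    ultimately show ?thesis by blast
  next
    case False
    obtain k where k: "k \<le> Suc n" "u - s \<le> t * real k / Suc n" "t * real k / Suc n \<le> (u - s) + t / Suc n"
      using grid_point[of "u - s" t n] False u by auto
    have "two_part s t n (Suc n + k) = s + t * real k / Suc n" by (rule two_part_second)
    then have "u \<le> two_part s t n (Suc n + k) \<and> two_part s t n (Suc n + k) \<le> u + (s + t) / Suc n" using div k by linarith
    moreover have "Suc n + k \<le> Suc n + Suc n" using k(1) by linarith
    ultimately show ?thesis by blast
  qed
qed

lemma steps_two_part:
  "steps (two_part s t n) (Suc n + Suc n) f = (step (s / Suc n) ^^ Suc n) ((step (t / Suc n) ^^ Suc n) f)"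
proof -
  have "steps (two_part s t n) (Suc n + Suc n) f = steps (two_part s t n) (Suc n) ((step (t / Suc n) ^^ Suc n) f)"
  proof (rule steps_append)
    fix k
    have "two_part s t n (Suc (Suc n + k)) = s + t * real (Suc k) / Suc n"
      using two_part_second[of s t n "Suc k"] by (simp only: add_Suc_right)
    moreover have "t * real (Suc k) / Suc n = t * real k / Suc n + t / Suc n"
      by (simp add: of_nat_Suc[of k] distrib_left add_divide_distrib del: of_nat_Suc)
    ultimately show "two_part s t n (Suc (Suc n + k)) - two_part s t n (Suc n + k) = t / Suc n"
      unfolding two_part_second by linarith
  qed
  also have "\<dots> = (step (s / Suc n) ^^ Suc n) ((step (t / Suc n) ^^ Suc n) f)"
  proof (rule steps_const)
    fix k assume "k < Suc n"
    then have "two_part s t n (Suc k) = s * real (Suc k) / Suc n" "two_part s t n k = s * real k / Suc n"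
      by (auto intro!: two_part_first simp del: of_nat_Suc)
    moreover have "s * real (Suc k) / Suc n = s * real k / Suc n + s / Suc n"
      by (simp add: of_nat_Suc[of k] distrib_left add_divide_distrib del: of_nat_Suc)
    ultimately show "two_part s t n (Suc k) - two_part s t n k = s / Suc n" by linarith
  qed
  finally show ?thesis .
qed

definition disc_inf :: "real \<Rightarrow> real \<Rightarrow> nat \<Rightarrow> 'a \<Rightarrow> real" where
  "disc_inf s t n \<omega> = Min ((\<lambda>k. Z (two_part s t n k) \<omega>) ` {..Suc n + Suc n})"

lemma two_part_range:
  assumes "0 \<le> s" "0 \<le> t" "k \<le> Suc n + Suc n"
  shows "two_part s t n k \<in> {0..s + t}"
  using monoD[OF two_part_mono[OF assms(1,2), of n] assms(3)] monoD[OF two_part_mono[OF assms(1,2), of n], of 0 k]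
  by (simp add: two_part_0 two_part_last del: add_Suc add_Suc_right)

lemma disc_inf_tendsto:
  assumes "\<omega> \<in> space M" "0 \<le> s" "0 \<le> t"
  shows "(\<lambda>n. disc_inf s t n \<omega>) \<longlonglongrightarrow> running_inf Z (s + t) \<omega>"
  unfolding disc_inf_def running_inf_def
  by (rule partition_inf_tendsto[OF right_continuous[OF assms(1)] path_bdd_below[OF assms(1)]])
     (use assms two_part_range two_part_mesh in auto)

lemma disc_inf_measurable: "0 \<le> s \<Longrightarrow> 0 \<le> t \<Longrightarrow> disc_inf s t n \<in> borel_measurable M"
  unfolding disc_inf_def
  by (intro borel_measurable_Min measurable_Z) (use two_part_range in auto)

lemma running_inf_measurable: "0 \<le> t \<Longrightarrow> running_inf Z t \<in> borel_measurable M"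
  using borel_measurable_LIMSEQ_real[of M "\<lambda>n. disc_inf t 0 n" "running_inf Z t"] disc_inf_tendsto[of _ t 0] disc_inf_measurable[of t 0]
  by simp

definition refl_op :: "real \<Rightarrow> (real \<Rightarrow> real) \<Rightarrow> real \<Rightarrow> real" where
  "refl_op t = rand_op M (\<lambda>x. refl_inf Z x t)"

lemma refl_inf_measurable:
  assumes t: "0 \<le> t" shows "refl_inf Z x t \<in> borel_measurable M"
proof -
  note [measurable] = running_inf_measurable[OF t] measurable_Z[OF t]
  show ?thesis unfolding refl_inf_def[abs_def] by measurable
qed

lemma refl_contraction:
  assumes t: "0 \<le> t" shows "random_contraction M (\<lambda>x. refl_inf Z x t)"
proof
  show "refl_inf Z x t \<in> borel_measurable M" for x by (rule refl_inf_measurable[OF t])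
  show "0 \<le> refl_inf Z x t \<omega>" if "\<omega> \<in> space M" for x \<omega>
    using running_inf_le[OF that t order_refl] by (simp add: refl_inf_def)
  show "\<exists>c. \<forall>x\<ge>0. x + c \<le> refl_inf Z x t \<omega>" for \<omega>
    by (intro exI[of _ "Z t \<omega>"]) (auto simp: refl_inf_def)
qed (auto simp: refl_inf_def max_def)

lemma expectation_lindley_two_part:
  assumes st: "0 \<le> s" "0 \<le> t" and f: "f \<in> C0" and x: "0 \<le> x"
  shows "(step (s / Suc n) ^^ Suc n) ((step (t / Suc n) ^^ Suc n) f) x =
    (\<integral>\<omega>. f (max 0 (Z (s + t) \<omega> + max x (- disc_inf s t n \<omega>))) \<partial>M)"
proof -
  let ?\<tau> = "two_part s t n" and ?N = "Suc n + Suc n"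
  have pos: "0 \<le> ?\<tau> k" for k
    using monoD[OF two_part_mono[OF st, of n], of 0 k] by (simp add: two_part_0)
  have "(step (s / Suc n) ^^ Suc n) ((step (t / Suc n) ^^ Suc n) f) x =
      (\<integral>\<omega>. f (lindley x (\<lambda>k. Z (?\<tau> (Suc k)) \<omega> - Z (?\<tau> k) \<omega>) ?N) \<partial>M)"
    unfolding steps_two_part[symmetric]
    by (rule expectation_lindley_eq_steps[symmetric]) (use two_part_mono[OF st] f x in \<open>auto simp: two_part_0\<close>)
  also have "\<dots> = (\<integral>\<omega>. f (max 0 (Z (s + t) \<omega> + max x (- disc_inf s t n \<omega>))) \<partial>M)"
  proof (rule integral_cong_AE)
    note fm[measurable] = C0_borel_measurable[OF f]
    have "(\<lambda>\<omega>. lindley x (\<lambda>k. Z (?\<tau> (Suc k)) \<omega> - Z (?\<tau> k) \<omega>) N) \<in> borel_measurable M" for N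
    proof (induction N)
      case (Suc N)
      note [measurable] = this measurable_Z[OF pos]
      show ?case unfolding lindley.simps by measurable
    qed simp
    then show "(\<lambda>\<omega>. f (lindley x (\<lambda>k. Z (?\<tau> (Suc k)) \<omega> - Z (?\<tau> k) \<omega>) ?N)) \<in> borel_measurable M" by measurable
    have [measurable]: "Z (s + t) \<in> borel_measurable M" "disc_inf s t n \<in> borel_measurable M"
      using st by (auto intro: measurable_Z disc_inf_measurable)
    show "(\<lambda>\<omega>. f (max 0 (Z (s + t) \<omega> + max x (- disc_inf s t n \<omega>)))) \<in> borel_measurable M" by measurable
    show "AE \<omega> in M. f (lindley x (\<lambda>k. Z (?\<tau> (Suc k)) \<omega> - Z (?\<tau> k) \<omega>) ?N) = f (max 0 (Z (s + t) \<omega> + max x (- disc_inf s t n \<omega>)))"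
      using start
    proof eventually_elim
      case (elim \<omega>)
      have eq: "lindley x (\<lambda>k. Z (?\<tau> (Suc k)) \<omega> - Z (?\<tau> k) \<omega>) ?N = Z (s + t) \<omega> + max x (- disc_inf s t n \<omega>)"
        using lindley_eq[of "\<lambda>k. Z (?\<tau> k) \<omega>" x ?N] elim x
        by (simp only: two_part_0 two_part_last disc_inf_def)
      then show ?case using lindley_nonneg[OF x, of "\<lambda>k. Z (?\<tau> (Suc k)) \<omega> - Z (?\<tau> k) \<omega>" ?N] by simp
    qed
  qed
  finally show ?thesis .
qed

text \<open>The walk and the process differ by at most the difference between the minimum over the partition and the infimum of the path, whatever the starting point.\<close>

lemma refl_op_limit:
  assumes st: "0 \<le> s" "0 \<le> t" and f: "f \<in> C0"
  shows "uniform_limit {0..} (\<lambda>n. (step (s / Suc n) ^^ Suc n) ((step (t / Suc n) ^^ Suc n) f)) (refl_op (s + t) f) sequentially"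
proof (rule uniform_limitI)
  fix e :: real assume e: "0 < e"
  have e2: "0 < e/2" using e by simp
  define \<Delta> where "\<Delta> n \<omega> = \<bar>disc_inf s t n \<omega> - running_inf Z (s + t) \<omega>\<bar>" for n \<omega>
  have st': "0 \<le> s + t" using st by simp
  note [measurable] = measurable_Z[OF st'] disc_inf_measurable[OF st] running_inf_measurable[OF st']
  have \<Delta>m[measurable]: "\<Delta> n \<in> borel_measurable M" for n unfolding \<Delta>_def by measurable
  obtain d B where dB: "0 < d" "0 < B"
    and close: "\<forall>X Y \<Delta>. X \<in> borel_measurable M \<longrightarrow> Y \<in> borel_measurable M \<longrightarrow> \<Delta> \<in> borel_measurable M \<longrightarrow>
      (AE \<omega> in M. 0 \<le> X \<omega> \<and> 0 \<le> Y \<omega> \<and> \<bar>X \<omega> - Y \<omega>\<bar> \<le> \<Delta> \<omega>) \<longrightarrow>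
      \<bar>(\<integral>\<omega>. f (X \<omega>) \<partial>M) - (\<integral>\<omega>. f (Y \<omega>) \<partial>M)\<bar> \<le> e/2 + B * prob {\<omega> \<in> space M. d \<le> \<Delta> \<omega>}"
    using expectation_close[OF f e2] by (elim exE conjE) blast
  have "(\<lambda>n. prob {\<omega> \<in> space M. d \<le> \<Delta> n \<omega>}) \<longlonglongrightarrow> 0"
  proof (rule prob_tendsto_zero[OF \<Delta>m _ dB(1)], intro AE_I2)
    fix \<omega> assume "\<omega> \<in> space M"
    from disc_inf_tendsto[OF this st] show "(\<lambda>n. \<Delta> n \<omega>) \<longlonglongrightarrow> 0"
      unfolding \<Delta>_def by (intro tendsto_rabs_zero) (simp add: LIM_zero_iff)
  qed
  then have "\<forall>\<^sub>F n in sequentially. prob {\<omega> \<in> space M. d \<le> \<Delta> n \<omega>} < e / (2 * B)"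
    by (rule order_tendstoD) (use e dB in auto)
  then show "\<forall>\<^sub>F n in sequentially. \<forall>x\<in>{0..}. dist ((step (s / Suc n) ^^ Suc n) ((step (t / Suc n) ^^ Suc n) f) x) (refl_op (s + t) f x) < e"
  proof eventually_elim
    case (elim n)
    show ?case
    proof
      fix x :: real assume x: "x \<in> {0..}"
      have "\<bar>(\<integral>\<omega>. f (max 0 (Z (s + t) \<omega> + max x (- disc_inf s t n \<omega>))) \<partial>M) - (\<integral>\<omega>. f (refl_inf Z x (s + t) \<omega>) \<partial>M)\<bar>
          \<le> e/2 + B * prob {\<omega> \<in> space M. d \<le> \<Delta> n \<omega>}"
      proof (rule close[rule_format, OF _ refl_inf_measurable \<Delta>m])
        show "(\<lambda>\<omega>. max 0 (Z (s + t) \<omega> + max x (- disc_inf s t n \<omega>))) \<in> borel_measurable M"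
          by measurable
        show "AE \<omega> in M. 0 \<le> max 0 (Z (s + t) \<omega> + max x (- disc_inf s t n \<omega>)) \<and> 0 \<le> refl_inf Z x (s + t) \<omega> \<and>
            \<bar>max 0 (Z (s + t) \<omega> + max x (- disc_inf s t n \<omega>)) - refl_inf Z x (s + t) \<omega>\<bar> \<le> \<Delta> n \<omega>"
        proof (intro AE_I2 conjI)
          fix \<omega> assume \<omega>: "\<omega> \<in> space M"
          show n: "0 \<le> refl_inf Z x (s + t) \<omega>"
            using random_contraction.map_nonneg[OF refl_contraction \<omega>] st x by simp
          have "\<bar>max 0 (z + max x (- a)) - (z + max x (- b))\<bar> \<le> \<bar>a - b\<bar>" if "0 \<le> z + max x (- b)" for z a b
            using that by (auto simp: max_def)
          from this[OF n[unfolded refl_inf_def]]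
          show "\<bar>max 0 (Z (s + t) \<omega> + max x (- disc_inf s t n \<omega>)) - refl_inf Z x (s + t) \<omega>\<bar> \<le> \<Delta> n \<omega>"
            unfolding refl_inf_def \<Delta>_def .
        qed simp
      qed (rule st')
      also have "\<dots> < e" using elim dB(2) by (simp add: field_simps)
      finally show "dist ((step (s / Suc n) ^^ Suc n) ((step (t / Suc n) ^^ Suc n) f) x) (refl_op (s + t) f x) < e"
        using expectation_lindley_two_part[OF st f, of x n] x by (simp only: dist_real_def refl_op_def rand_op_def restrict_apply' atLeast_iff)
    qed
  qed
qed

lemma step_zero:
  assumes f: "f \<in> C0" shows "step 0 f = f"
proof
  fix x
  show "step 0 f x = f x"
  proof (cases "0 \<le> x")
    case True
    have "(\<integral>\<omega>. f (max 0 (x + Z 0 \<omega>)) \<partial>M) = (\<integral>\<omega>. f x \<partial>M)"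
    proof (rule integral_cong_AE)
      have "random_contraction M (\<lambda>x \<omega>. max 0 (x + Z 0 \<omega>))" by (rule step_contraction) simp
      from random_contraction.integrable_map[OF this f True]
      show "(\<lambda>\<omega>. f (max 0 (x + Z 0 \<omega>))) \<in> borel_measurable M" by (rule borel_measurable_integrable)
      show "AE \<omega> in M. f (max 0 (x + Z 0 \<omega>)) = f x"
        using start by eventually_elim (use True in \<open>simp add: max_def\<close>)
    qed simp
    then show ?thesis using True by (simp add: step_def rand_op_def prob_space)
  next
    case False
    then show ?thesis using f by (auto simp: step_def rand_op_def C0_def extensional_def)
  qed
qed

lemma step_zero_pow: "f \<in> C0 \<Longrightarrow> (step 0 ^^ n) f = f"
  by (induction n) (simp_all add: step_zero)

lemma refl_op_limit_single:
  assumes t: "0 \<le> t" and f: "f \<in> C0"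
  shows "uniform_limit {0..} (\<lambda>n. (step (t / Suc n) ^^ Suc n) f) (refl_op t f) sequentially"
proof -
  have "(step (0 / real (Suc n)) ^^ Suc n) f = f" for n
    using step_zero_pow[OF f, of "Suc n"] by (simp only: div_0)
  then show ?thesis using refl_op_limit[OF t order_refl f] by (simp only: add_0_right)
qed

lemma refl_op_C0: "0 \<le> t \<Longrightarrow> f \<in> C0 \<Longrightarrow> refl_op t f \<in> C0"
  unfolding refl_op_def by (rule random_contraction.rand_op_C0[OF refl_contraction])

text \<open>Both sides are limits of \<open>P\<^sub>s\<^sub>/\<^sub>n\<^sup>n P\<^sub>t\<^sub>/\<^sub>n\<^sup>n f\<close>: the right-hand side because \<open>P\<^sub>t\<^sub>/\<^sub>n\<^sup>n f\<close> converges uniformly and the outer operators are contractions.\<close>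

lemma refl_op_add:
  assumes st: "0 \<le> s" "0 \<le> t" and f: "f \<in> C0"
  shows "refl_op (s + t) f = refl_op s (refl_op t f)"
proof
  fix x
  show "refl_op (s + t) f x = refl_op s (refl_op t f) x"
  proof (cases "0 \<le> x")
    case True
    define A where "A n = (step (s / Suc n) ^^ Suc n) ((step (t / Suc n) ^^ Suc n) f) x" for n
    define B where "B n = (step (s / Suc n) ^^ Suc n) (refl_op t f) x" for n
    have A: "A \<longlonglongrightarrow> refl_op (s + t) f x"
      unfolding A_def by (rule tendsto_uniform_limitI[OF refl_op_limit[OF st f]]) (use True in simp)
    have B: "B \<longlonglongrightarrow> refl_op s (refl_op t f) x"
      unfolding B_def by (rule tendsto_uniform_limitI[OF refl_op_limit_single[OF st(1) refl_op_C0[OF st(2) f]]]) (use True in simp)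
    have "(\<lambda>n. A n - B n) \<longlonglongrightarrow> 0"
    proof (rule tendstoI)
      fix e :: real assume e: "0 < e"
      have "\<forall>\<^sub>F n in sequentially. \<forall>y\<in>{0..}. dist ((step (t / Suc n) ^^ Suc n) f y) (refl_op t f y) < e/2"
        by (rule uniform_limitD[OF refl_op_limit_single[OF st(2) f]]) (use e in simp)
      then show "\<forall>\<^sub>F n in sequentially. dist (A n - B n) 0 < e"
      proof eventually_elim
        case (elim n)
        have "\<bar>A n - B n\<bar> \<le> e/2" unfolding A_def B_def
        proof (rule step_pow_diff_bound)
          show "(step (t / Suc n) ^^ Suc n) f \<in> C0" using st f by (intro step_pow_C0) simp_all
          show "\<bar>(step (t / Suc n) ^^ Suc n) f y - refl_op t f y\<bar> \<le> e/2" if "0 \<le> y" for y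
            using elim that by (auto simp: dist_real_def intro: less_imp_le simp del: funpow.simps)
        qed (use st f True refl_op_C0 in simp_all)
        then show ?case using e by simp
      qed
    qed
    from tendsto_diff[OF A B] this have "refl_op (s + t) f x - refl_op s (refl_op t f) x = 0"
      by (rule LIMSEQ_unique)
    then show ?thesis by simp
  qed (simp add: refl_op_def rand_op_def)
qed

text \<open>The displacement of the reflected process, and of every walk that approximates it, is at most
  \<open>\<bar>Z\<^sub>h\<bar>\<close> plus the depth of the infimum, from any starting point.\<close>

lemma small_displacement_prob:
  assumes d: "0 < d"
  shows "((\<lambda>h. prob {\<omega> \<in> space M. d \<le> \<bar>Z h \<omega>\<bar> + max 0 (- running_inf Z h \<omega>)}) \<longlongrightarrow> 0) (at_right 0)"
  unfolding tendsto_at_iff_sequentially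
proof (intro allI impI)
  fix X :: "nat \<Rightarrow> real" assume X: "\<forall>i. X i \<in> {0<..} - {0}" "X \<longlonglongrightarrow> 0"
  have X0: "0 < X i" for i using X(1) by auto
  have flt: "filterlim X (at_right 0) sequentially"
    using X0 X(2) by (intro tendsto_imp_filterlim_at_right) auto
  have "(\<lambda>n. prob {\<omega> \<in> space M. d \<le> \<bar>Z (X n) \<omega>\<bar> + max 0 (- running_inf Z (X n) \<omega>)}) \<longlonglongrightarrow> 0"
  proof (rule prob_tendsto_zero[OF _ _ d])
    fix n
    have "0 \<le> X n" using X0[of n] by simp
    note [measurable] = measurable_Z[OF this] running_inf_measurable[OF this]
    show "(\<lambda>\<omega>. \<bar>Z (X n) \<omega>\<bar> + max 0 (- running_inf Z (X n) \<omega>)) \<in> borel_measurable M" by measurable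
  next
    show "AE \<omega> in M. (\<lambda>n. \<bar>Z (X n) \<omega>\<bar> + max 0 (- running_inf Z (X n) \<omega>)) \<longlonglongrightarrow> 0"
      using start AE_space
    proof eventually_elim
      case (elim \<omega>)
      have rc: "((\<lambda>s. Z s \<omega>) \<longlongrightarrow> 0) (at_right 0)" using right_continuous[OF elim(2), of 0] elim(1) by simp
      have 1: "(\<lambda>n. \<bar>Z (X n) \<omega>\<bar>) \<longlonglongrightarrow> 0"
        by (rule tendsto_rabs_zero[OF filterlim_compose[OF rc flt]])
      have 2: "(\<lambda>n. max 0 (- running_inf Z (X n) \<omega>)) \<longlonglongrightarrow> 0"
      proof (rule tendstoI)
        fix e :: real assume e: "0 < e"
        obtain b where b: "0 < b" "\<And>s. 0 < s \<Longrightarrow> s < b \<Longrightarrow> \<bar>Z s \<omega>\<bar> < e/2"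
          using tendstoD[OF rc, of "e/2"] e unfolding eventually_at_right_field by (auto simp: dist_real_def)
        have "\<forall>\<^sub>F n in sequentially. X n < b" by (rule order_tendstoD(2)[OF X(2) b(1)])
        then show "\<forall>\<^sub>F n in sequentially. dist (max 0 (- running_inf Z (X n) \<omega>)) 0 < e"
        proof eventually_elim
          case (elim n)
          have "- (e/2) \<le> running_inf Z (X n) \<omega>"
            unfolding running_inf_def
          proof (rule cINF_greatest)
            fix s assume s: "s \<in> {0..X n}"
            show "- (e/2) \<le> Z s \<omega>"
            proof (cases "s = 0")
              case True then show ?thesis using \<open>Z 0 \<omega> = 0\<close> e by simp
            next
              case False then show ?thesis using b(2)[of s] s elim by (auto simp: abs_less_iff)
            qed
          qed (use X0[of n] in auto)
          then show ?case using e by (simp add: dist_real_def)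
        qed
      qed
      show ?case using tendsto_add[OF 1 2] by simp
    qed
  qed
  then show "((\<lambda>h. prob {\<omega> \<in> space M. d \<le> \<bar>Z h \<omega>\<bar> + max 0 (- running_inf Z h \<omega>)}) \<circ> X) \<longlonglongrightarrow> 0"
    by (simp add: comp_def)
qed

text \<open>One time \<open>h0\<close> serves all step sizes at once; this uniformity is what the passage from steps to the semigroup uses.\<close>

lemma step_pow_small:
  assumes f: "f \<in> C0" and e: "0 < e"
  shows "\<exists>h0>0. \<forall>d\<ge>0. \<forall>k. real k * d \<le> h0 \<longrightarrow> (\<forall>x\<ge>0. \<bar>(step d ^^ k) f x - f x\<bar> \<le> e)"
proof -
  have e2: "0 < e/2" using e by simp
  obtain d0 B where dB: "0 < d0" "0 < B"
    and close: "\<forall>X Y \<Delta>. X \<in> borel_measurable M \<longrightarrow> Y \<in> borel_measurable M \<longrightarrow> \<Delta> \<in> borel_measurable M \<longrightarrow>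
      (AE \<omega> in M. 0 \<le> X \<omega> \<and> 0 \<le> Y \<omega> \<and> \<bar>X \<omega> - Y \<omega>\<bar> \<le> \<Delta> \<omega>) \<longrightarrow>
      \<bar>(\<integral>\<omega>. f (X \<omega>) \<partial>M) - (\<integral>\<omega>. f (Y \<omega>) \<partial>M)\<bar> \<le> e/2 + B * prob {\<omega> \<in> space M. d0 \<le> \<Delta> \<omega>}"
    using expectation_close[OF f e2] by (elim exE conjE) blast
  define \<Delta> where "\<Delta> h \<omega> = \<bar>Z h \<omega>\<bar> + max 0 (- running_inf Z h \<omega>)" for h \<omega>
  have "\<forall>\<^sub>F h in at_right 0. prob {\<omega> \<in> space M. d0 \<le> \<Delta> h \<omega>} < e / (2 * B)"
    unfolding \<Delta>_def by (rule order_tendstoD(2)[OF small_displacement_prob[OF dB(1)]]) (use e dB in simp)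
  then obtain b where b: "0 < b" "\<And>h. 0 < h \<Longrightarrow> h < b \<Longrightarrow> prob {\<omega> \<in> space M. d0 \<le> \<Delta> h \<omega>} < e / (2 * B)"
    unfolding eventually_at_right_field by auto
  have main: "\<bar>(step d ^^ k) f x - f x\<bar> \<le> e" if d: "0 \<le> d" and k: "real k * d \<le> b/2" and x: "0 \<le> x" for d k x
  proof (cases "k = 0 \<or> d = 0")
    case True
    then show ?thesis using step_zero_pow[OF f] e by auto
  next
    case False
    then obtain n where n: "k = Suc n" by (cases k) auto
    define h where "h = real k * d"
    have h: "0 < h" "h < b" "h \<le> h + 0" "0 \<le> h" using False d k b(1) by (auto simp: h_def)
    have dh: "h / Suc n = d" by (simp add: h_def n del: of_nat_Suc)
    have z: "(step (0 / real (Suc n)) ^^ Suc n) f = f" using step_zero_pow[OF f, of "Suc n"] by (simp only: div_0)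
    have eq: "(step d ^^ k) f x = (\<integral>\<omega>. f (max 0 (Z (h + 0) \<omega> + max x (- disc_inf h 0 n \<omega>))) \<partial>M)"
      using expectation_lindley_two_part[OF h(4) order_refl f x, of n] unfolding dh z n .
    note m[measurable] = measurable_Z[OF h(4)] running_inf_measurable[OF h(4)] disc_inf_measurable[OF h(4) order_refl, of n]
    have "\<bar>(\<integral>\<omega>. f (max 0 (Z (h + 0) \<omega> + max x (- disc_inf h 0 n \<omega>))) \<partial>M) - (\<integral>\<omega>. f x \<partial>M)\<bar>
        \<le> e/2 + B * prob {\<omega> \<in> space M. d0 \<le> \<Delta> h \<omega>}"
    proof (rule close[rule_format, where Y = "\<lambda>_. x"])
      show "(\<lambda>\<omega>. max 0 (Z (h + 0) \<omega> + max x (- disc_inf h 0 n \<omega>))) \<in> borel_measurable M" unfolding add_0_right by measurable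
      show "\<Delta> h \<in> borel_measurable M" unfolding \<Delta>_def by measurable
      show "AE \<omega> in M. 0 \<le> max 0 (Z (h + 0) \<omega> + max x (- disc_inf h 0 n \<omega>)) \<and> 0 \<le> x \<and>
          \<bar>max 0 (Z (h + 0) \<omega> + max x (- disc_inf h 0 n \<omega>)) - x\<bar> \<le> \<Delta> h \<omega>"
      proof (intro AE_I2 conjI)
        fix \<omega> assume \<omega>: "\<omega> \<in> space M"
        have "running_inf Z h \<omega> \<le> disc_inf h 0 n \<omega>" unfolding disc_inf_def
        proof (rule Min.boundedI)
          fix a assume "a \<in> (\<lambda>k. Z (two_part h 0 n k) \<omega>) ` {..Suc n + Suc n}"
          then obtain j where j: "j \<le> Suc n + Suc n" "a = Z (two_part h 0 n j) \<omega>" by auto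
          show "running_inf Z h \<omega> \<le> a"
            unfolding j(2) using two_part_range[OF h(4) order_refl j(1)] by (intro running_inf_le[OF \<omega>]) auto
        qed auto
        moreover have "\<bar>max 0 (z + max x (- a)) - x\<bar> \<le> \<bar>z\<bar> + max 0 (- i)" if "i \<le> a" for z a i :: real
          using that x by (auto simp: max_def)
        ultimately show "\<bar>max 0 (Z (h + 0) \<omega> + max x (- disc_inf h 0 n \<omega>)) - x\<bar> \<le> \<Delta> h \<omega>"
          unfolding \<Delta>_def by simp
      qed (use x in auto)
    qed simp
    also have "\<dots> \<le> e" using b(2)[OF h(1,2)] dB(2) by (simp add: field_simps)
    finally show ?thesis unfolding eq by (simp add: prob_space)
  qed
  show ?thesis by (rule exI[of _ "b/2"]) (use main b(1) in auto)
qed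

lemma refl_op_small:
  assumes f: "f \<in> C0" and e: "0 < e"
  shows "\<exists>h>0. \<forall>t\<in>{0..h}. \<forall>x\<ge>0. \<bar>refl_op t f x - f x\<bar> \<le> e"
proof -
  obtain h0 where h0: "0 < h0" "\<And>d k x. 0 \<le> d \<Longrightarrow> real k * d \<le> h0 \<Longrightarrow> 0 \<le> x \<Longrightarrow> \<bar>(step d ^^ k) f x - f x\<bar> \<le> e"
    using step_pow_small[OF f e] by blast
  have "\<bar>refl_op t f x - f x\<bar> \<le> e" if t: "t \<in> {0..h0}" and x: "0 \<le> x" for t x
  proof (rule LIMSEQ_le_const2)
    have "(\<lambda>n. (step (t / Suc n) ^^ Suc n) f x) \<longlonglongrightarrow> refl_op t f x"
      by (rule tendsto_uniform_limitI[OF refl_op_limit_single[OF _ f]]) (use t x in auto)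
    then show "(\<lambda>n. \<bar>(step (t / Suc n) ^^ Suc n) f x - f x\<bar>) \<longlonglongrightarrow> \<bar>refl_op t f x - f x\<bar>"
      by (intro tendsto_intros)
    have "\<bar>(step (t / Suc n) ^^ Suc n) f x - f x\<bar> \<le> e" for n
      by (rule h0(2)) (use t x in \<open>auto simp del: of_nat_Suc\<close>)
    then show "\<exists>N. \<forall>n\<ge>N. \<bar>(step (t / Suc n) ^^ Suc n) f x - f x\<bar> \<le> e" by blast
  qed
  then show ?thesis using h0(1) by blast
qed

lemma C0_semigroup_refl_op: "C0_semigroup refl_op"
proof
  fix t :: real and f g :: "real \<Rightarrow> real" assume t: "0 \<le> t" and f: "f \<in> C0"
  interpret R: random_contraction M "\<lambda>x. refl_inf Z x t" by (rule refl_contraction[OF t])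
  show "refl_op t f \<in> C0" by (rule refl_op_C0[OF t f])
  show "\<bar>refl_op t f x\<bar> \<le> B" if "\<And>x. 0 \<le> x \<Longrightarrow> \<bar>f x\<bar> \<le> B" "0 \<le> x" for B x
    unfolding refl_op_def by (rule R.rand_op_bound[OF f that])
  show "0 \<le> refl_op t f x" if "\<And>x. 0 \<le> x \<Longrightarrow> 0 \<le> f x" "0 \<le> x" for x
    unfolding refl_op_def by (rule R.rand_op_nonneg[OF that])
  show "refl_op t (\<lambda>x\<in>{0..}. a * f x + b * g x) = (\<lambda>x\<in>{0..}. a * refl_op t f x + b * refl_op t g x)"
    if "g \<in> C0" for a b unfolding refl_op_def by (rule R.rand_op_lincomb[OF f that])
qed (use refl_op_add refl_op_small in auto)

lemma C0_semigroup_fubini_refl_op: "C0_semigroup_fubini refl_op"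
proof -
  interpret S: C0_semigroup refl_op by (rule C0_semigroup_refl_op)
  show ?thesis
  proof unfold_locales
    fix s x :: real and f assume s: "0 \<le> s" and f: "f \<in> C0" and x: "0 \<le> x"
    obtain B where B: "0 < B" "\<And>x. 0 \<le> x \<Longrightarrow> \<bar>f x\<bar> \<le> B" using C0_bounded[OF f] by auto
    define Y where "Y = refl_inf Z x s"
    have Ym[measurable]: "Y \<in> borel_measurable M" unfolding Y_def by (rule refl_inf_measurable[OF s])
    have Y0: "0 \<le> Y \<omega>" if "\<omega> \<in> space M" for \<omega>
      unfolding Y_def using random_contraction.map_nonneg[OF refl_contraction[OF s] that x] .
    \<comment> \<open>the cut-off makes the integrand bounded and measurable on the whole plane\<close>
    define Q where "Q p = indicator ({0..} \<times> {0..}) p *\<^sub>R (case p of (t, x) \<Rightarrow> refl_op t f x)" for p :: "real \<times> real"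
    have Q: "Q (t, y) = refl_op t f y" if "0 \<le> t" "0 \<le> y" for t y using that by (simp add: Q_def)
    have QB: "\<bar>Q p\<bar> \<le> B" for p
      using S.T_bound[OF _ f B(2)] B(1) by (cases p) (auto simp: Q_def indicator_def)
    have "Q \<in> borel_measurable borel" unfolding Q_def[abs_def]
      by (rule borel_measurable_continuous_on_indicator[OF _ S.T_joint_continuous[OF f]])
         (intro borel_closed closed_Times, auto)
    then have "Q \<in> borel_measurable (borel \<Otimes>\<^sub>M borel)" by (simp add: borel_prod)
    from measurable_compose[OF _ this, of "\<lambda>p. (snd p, Y (fst p))" "M \<Otimes>\<^sub>M lborel"]
    have Qm: "(\<lambda>(\<omega>, t). Q (t, Y \<omega>)) \<in> borel_measurable (M \<Otimes>\<^sub>M lborel)" by (simp add: split_beta')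
    have "refl_op s (\<lambda>x\<in>{0..}. LBINT t:{0..}. exp (- t) * refl_op t f x) x
        = (\<integral>\<omega>. (LBINT t:{0..}. exp (- (1 * t)) * Q (t, Y \<omega>)) \<partial>M)"
      using x unfolding refl_op_def[of s] rand_op_def
      by (simp, intro Bochner_Integration.integral_cong refl)
         (auto simp: Y0[unfolded Y_def] Y_def Q intro!: set_lebesgue_integral_cong)
    also have "\<dots> = (LBINT t:{0..}. exp (- (1 * t)) * (\<integral>\<omega>. Q (t, Y \<omega>) \<partial>M))"
      by (rule expectation_exp_integral_swap(2)[OF _ Qm QB, symmetric]) simp
    also have "\<dots> = (LBINT t:{0..}. exp (- t) * refl_op s (refl_op t f) x)"
    proof (intro set_lebesgue_integral_cong allI impI)
      fix t :: real assume "t \<in> {0..}"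
      then have "(\<integral>\<omega>. Q (t, Y \<omega>) \<partial>M) = (\<integral>\<omega>. refl_op t f (Y \<omega>) \<partial>M)"
        by (intro Bochner_Integration.integral_cong refl) (simp add: Q Y0)
      then show "exp (- (1 * t)) * (\<integral>\<omega>. Q (t, Y \<omega>) \<partial>M) = exp (- t) * refl_op s (refl_op t f) x"
        using x by (simp add: Y_def refl_op_def[of s] rand_op_def)
    qed simp
    finally show "refl_op s (\<lambda>x\<in>{0..}. LBINT t:{0..}. exp (- t) * refl_op t f x) x = (LBINT t:{0..}. exp (- t) * refl_op s (refl_op t f) x)" .
  qed
qed

end

sublocale levy_process \<subseteq> refl: C0_semigroup_fubini refl_op
  by (rule C0_semigroup_fubini_refl_op)

context levy_process
begin

theorem feller_domain_eq_range_U: "feller_domain M (refl_inf Z) = {refl.U f | f. f \<in> C0}"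
proof -
  have "uniform_limit {0..} (\<lambda>t x. ((\<integral>\<omega>. f (refl_inf Z x t \<omega>) \<partial>M) - f x) / t) g (at_right 0) \<longleftrightarrow> refl.generator_limit f g" for f g
    unfolding refl.generator_limit_def
    by (rule uniform_limit_cong) (auto simp: refl_op_def rand_op_def)
  then show ?thesis unfolding feller_domain_def refl.domain_eq_range_U[symmetric] by simp
qed

section \<open>From one-step operators to the generator\<close>

lemma step_pow_lincomb:
  assumes h: "0 \<le> h" and f: "f \<in> C0" and g: "g \<in> C0"
  shows "(step h ^^ n) (\<lambda>x\<in>{0..}. a * f x + b * g x) = (\<lambda>x\<in>{0..}. a * (step h ^^ n) f x + b * (step h ^^ n) g x)"
proof (induction n)
  case (Suc n)
  show ?case unfolding funpow.simps comp_apply Suc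
    by (rule step_lincomb[OF h step_pow_C0[OF h f] step_pow_C0[OF h g]])
qed simp

text \<open>In the telescoping sum
  \<open>P\<^sup>n u - u = \<Sum> P\<^sup>k (P u - u)\<close> the powers \<open>P\<^sup>k\<close> are uniformly close to the identity on \<open>g\<close>.\<close>

lemma generator_limit_of_step:
  assumes u: "u \<in> C0" and g: "g \<in> C0"
    and cons: "\<And>e. 0 < e \<Longrightarrow> \<exists>h0>0. \<forall>h x. 0 < h \<longrightarrow> h < h0 \<longrightarrow> 0 \<le> x \<longrightarrow> \<bar>step h u x - u x - h * g x\<bar> \<le> e * h"
  shows "refl.generator_limit u g"
  unfolding refl.generator_limit_iff
proof (intro allI impI)
  fix e :: real assume e: "0 < e"
  then have e2: "0 < e / 2" by simp
  obtain h1 where h1: "0 < h1" "\<And>d k x. 0 \<le> d \<Longrightarrow> real k * d \<le> h1 \<Longrightarrow> 0 \<le> x \<Longrightarrow> \<bar>(step d ^^ k) g x - g x\<bar> \<le> e/2"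
    using step_pow_small[OF g e2] by blast
  obtain h0 where h0: "0 < h0" "\<And>h x. 0 < h \<Longrightarrow> h < h0 \<Longrightarrow> 0 \<le> x \<Longrightarrow> \<bar>step h u x - u x - h * g x\<bar> \<le> e/2 * h"
    using cons[OF e2] by blast
  have "\<bar>refl_op h u x - u x - h * g x\<bar> \<le> e * h" if h: "0 < h" "h < h1" and x: "0 \<le> x" for h x
  proof (rule LIMSEQ_le_const2)
    have "(\<lambda>n. (step (h / Suc n) ^^ Suc n) u x) \<longlonglongrightarrow> refl_op h u x"
      by (rule tendsto_uniform_limitI[OF refl_op_limit_single[OF _ u]]) (use h x in auto)
    then show "(\<lambda>n. \<bar>(step (h / Suc n) ^^ Suc n) u x - u x - h * g x\<bar>) \<longlonglongrightarrow> \<bar>refl_op h u x - u x - h * g x\<bar>"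
      by (intro tendsto_intros)
    have "(\<lambda>n. h / real (Suc n)) \<longlonglongrightarrow> 0"
      using tendsto_mult_left[OF LIMSEQ_inverse_real_of_nat, of h] by (simp add: field_simps)
    then have "\<forall>\<^sub>F n in sequentially. h / real (Suc n) < h0"
      by (rule order_tendstoD) (rule h0(1))
    then have "\<forall>\<^sub>F n in sequentially. \<bar>(step (h / Suc n) ^^ Suc n) u x - u x - h * g x\<bar> \<le> e * h"
    proof eventually_elim
      case (elim n)
      define d where "d = h / Suc n"
      have d: "0 < d" "d < h0" "0 \<le> d" using h elim by (auto simp: d_def)
      have nd: "real (Suc n) * d = h" by (simp add: d_def del: of_nat_Suc)
      have "\<bar>(step d ^^ Suc n) u x - (step d ^^ 0) u x - real (Suc n) * (d * g x)\<bar> \<le> real (Suc n) * (e * d)"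
      proof (rule telescope_bound)
        fix k assume k: "k < Suc n"
        have "real k * d \<le> real (Suc n) * d" using k d by (intro mult_right_mono) auto
        then have kd: "real k * d \<le> h1" using nd h by linarith
        have 1: "\<bar>(step d ^^ k) (step d u) x - (step d ^^ k) (\<lambda>x\<in>{0..}. 1 * u x + d * g x) x\<bar> \<le> e/2 * d"
        proof (rule step_pow_diff_bound[OF d(3) step_C0[OF d(3) u] C0_lincomb[OF u g] _ x])
          fix y :: real assume y: "0 \<le> y"
          show "\<bar>step d u y - (\<lambda>x\<in>{0..}. 1 * u x + d * g x) y\<bar> \<le> e/2 * d"
            using h0(2)[OF d(1,2) y] y by (simp add: diff_diff_eq)
        qed
        have 2: "(step d ^^ k) (\<lambda>x\<in>{0..}. 1 * u x + d * g x) x = (step d ^^ k) u x + d * (step d ^^ k) g x"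
          unfolding step_pow_lincomb[OF d(3) u g] using x by simp
        have 3: "\<bar>d * (step d ^^ k) g x - d * g x\<bar> \<le> d * (e/2)"
          unfolding right_diff_distrib[symmetric] abs_mult using h1(2)[OF d(3) kd x] d by (intro mult_mono) auto
        have "e/2 * d + d * (e/2) = e * d" by simp
        moreover have "(step d ^^ Suc k) u x = (step d ^^ k) (step d u) x" by (simp add: funpow_swap1)
        ultimately show "\<bar>(step d ^^ Suc k) u x - (step d ^^ k) u x - d * g x\<bar> \<le> e * d"
          using 1 2 3 by linarith
      qed
      moreover have "real (Suc n) * (d * g x) = h * g x" "real (Suc n) * (e * d) = e * h"
        using nd by (simp_all only: mult.assoc[symmetric]) (simp only: mult.commute[of _ e] mult.assoc nd)
      ultimately show ?case by (simp only: d_def funpow_0)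
    qed
    then show "\<exists>N. \<forall>n\<ge>N. \<bar>(step (h / Suc n) ^^ Suc n) u x - u x - h * g x\<bar> \<le> e * h"
      by (simp only: eventually_sequentially)
  qed
  then show "\<exists>h>0. \<forall>t x. 0 < t \<longrightarrow> t < h \<longrightarrow> 0 \<le> x \<longrightarrow> \<bar>refl_op t u x - u x - t * g x\<bar> \<le> e * t"
    using h1(1) by blast
qed

definition lipschitz_C0 :: "real \<Rightarrow> (real \<Rightarrow> real) set" where
  "lipschitz_C0 L = {f \<in> C0. \<forall>x\<ge>0. \<forall>y\<ge>0. \<bar>f x - f y\<bar> \<le> L * \<bar>x - y\<bar>}"

lemma rand_op_lipschitz:
  assumes R: "random_contraction M \<phi>" and f: "f \<in> lipschitz_C0 L" and L: "0 \<le> L"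
  shows "rand_op M \<phi> f \<in> lipschitz_C0 L"
proof -
  interpret random_contraction M \<phi> by (rule R)
  have fC: "f \<in> C0" and fL: "\<And>x y. 0 \<le> x \<Longrightarrow> 0 \<le> y \<Longrightarrow> \<bar>f x - f y\<bar> \<le> L * \<bar>x - y\<bar>"
    using f by (auto simp: lipschitz_C0_def)
  have "\<bar>rand_op M \<phi> f x - rand_op M \<phi> f y\<bar> \<le> L * \<bar>x - y\<bar>" if "0 \<le> x" "0 \<le> y" for x y
  proof (rule rand_op_modulus[OF fC _ that order_refl])
    fix x' y' assume "0 \<le> x'" "0 \<le> y'" "\<bar>x' - y'\<bar> \<le> \<bar>x - y\<bar>"
    then show "\<bar>f x' - f y'\<bar> \<le> L * \<bar>x - y\<bar>"
      using fL[of x' y'] L mult_left_mono[of "\<bar>x' - y'\<bar>" "\<bar>x - y\<bar>" L] by linarith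
  qed
  then show ?thesis using rand_op_C0[OF fC] by (simp add: lipschitz_C0_def)
qed

lemma step_pow_lipschitz: "0 \<le> h \<Longrightarrow> f \<in> lipschitz_C0 L \<Longrightarrow> 0 \<le> L \<Longrightarrow> (step h ^^ n) f \<in> lipschitz_C0 L"
  by (induction n) (auto simp: step_def intro: rand_op_lipschitz[OF step_contraction])

lemma U_lipschitz:
  assumes f: "f \<in> lipschitz_C0 L" and L: "0 \<le> L"
  shows "refl.U f \<in> lipschitz_C0 L"
proof -
  have fC: "f \<in> C0" using f by (simp add: lipschitz_C0_def)
  have "\<bar>refl.U f x - refl.U f y\<bar> \<le> L * \<bar>x - y\<bar>" if xy: "0 \<le> x" "0 \<le> y" for x y
  proof -
    have m: "(\<lambda>t. indicator {0..} t * (refl_op t f x - refl_op t f y)) \<in> borel_measurable borel"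
      using borel_measurable_diff[OF refl.T_time_measurable[OF fC xy(1)] refl.T_time_measurable[OF fC xy(2)]]
      by (simp add: right_diff_distrib)
    have "refl.U f x - refl.U f y = (LBINT t:{0..}. exp (- (1 * t)) * (refl_op t f x - refl_op t f y))"
      using refl.U_integrable[OF fC xy(1)] refl.U_integrable[OF fC xy(2)] xy by (simp add: refl.U_def right_diff_distrib)
    moreover have "\<bar>LBINT t:{0..}. exp (- (1 * t)) * (refl_op t f x - refl_op t f y)\<bar> \<le> L * \<bar>x - y\<bar> / 1"
    proof (rule set_integral_exp_bounded_le[OF _ m])
      fix t :: real assume t: "0 \<le> t"
      have "refl_op t f \<in> lipschitz_C0 L" unfolding refl_op_def by (rule rand_op_lipschitz[OF refl_contraction[OF t] f L])
      then show "\<bar>refl_op t f x - refl_op t f y\<bar> \<le> L * \<bar>x - y\<bar>" using xy by (simp add: lipschitz_C0_def)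
    qed simp
    ultimately show ?thesis by simp
  qed
  then show ?thesis using refl.U_C0[OF fC] by (simp add: lipschitz_C0_def)
qed

text \<open>The same telescoping under a functional: \<open>l (P\<^sup>n u) - l u\<close> is a sum of increments
  \<open>h \<psi> (P\<^sup>k u) + o(h)\<close>, and \<open>\<psi>\<close> is nearly constant along the orbit. The class \<open>lipschitz_C0 L\<close> contains the
  orbit and makes the \<open>o(h)\<close> uniform.\<close>

lemma functional_derivative_of_step:
  assumes u: "u \<in> lipschitz_C0 L" and L: "0 \<le> L" and gen: "refl.generator_limit u g"
    and l: "C0_functional l"
    and \<psi>: "0 < C" "\<And>f k B. f \<in> C0 \<Longrightarrow> k \<in> C0 \<Longrightarrow> (\<And>x. 0 \<le> x \<Longrightarrow> \<bar>f x - k x\<bar> \<le> B) \<Longrightarrow> \<bar>\<psi> f - \<psi> k\<bar> \<le> C * B"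
    and cons: "\<And>e. 0 < e \<Longrightarrow> \<exists>h0>0. \<forall>h. 0 < h \<longrightarrow> h < h0 \<longrightarrow> (\<forall>w\<in>lipschitz_C0 L. (\<forall>x\<ge>0. \<bar>w x\<bar> \<le> B) \<longrightarrow> \<bar>l (step h w) - l w - h * \<psi> w\<bar> \<le> e * h)"
    and B: "\<And>x. 0 \<le> x \<Longrightarrow> \<bar>u x\<bar> \<le> B"
  shows "l (\<lambda>x\<in>{0..}. g x) = \<psi> u"
proof -
  interpret l: C0_functional l by (rule l)
  have uC: "u \<in> C0" using u by (simp add: lipschitz_C0_def)
  have gC: "(\<lambda>x\<in>{0..}. g x) \<in> C0" by (rule refl.generator_limit_C0[OF uC gen])
  have "\<bar>l (\<lambda>x\<in>{0..}. g x) - \<psi> u\<bar> \<le> 0 + e" if e: "0 < e" for e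
  proof -
    define e' where "e' = e / (2 + C)"
    have e': "0 < e'" using e \<psi>(1) by (simp add: e'_def)
    obtain h1 where h1: "0 < h1" "\<And>d k x. 0 \<le> d \<Longrightarrow> real k * d \<le> h1 \<Longrightarrow> 0 \<le> x \<Longrightarrow> \<bar>(step d ^^ k) u x - u x\<bar> \<le> e'"
      using step_pow_small[OF uC e'] by blast
    obtain h0 where h0: "0 < h0" "\<And>h w. 0 < h \<Longrightarrow> h < h0 \<Longrightarrow> w \<in> lipschitz_C0 L \<Longrightarrow> (\<And>x. 0 \<le> x \<Longrightarrow> \<bar>w x\<bar> \<le> B) \<Longrightarrow> \<bar>l (step h w) - l w - h * \<psi> w\<bar> \<le> e' * h"
      using cons[OF e'] by blast
    obtain h2 where h2: "0 < h2" "\<And>t x. 0 < t \<Longrightarrow> t < h2 \<Longrightarrow> 0 \<le> x \<Longrightarrow> \<bar>refl_op t u x - u x - t * g x\<bar> \<le> e' * t"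
      using gen e' unfolding refl.generator_limit_iff by blast
    define h where "h = min h1 h2 / 2"
    have h: "0 < h" "h < h1" "h < h2" using h1(1) h2(1) by (auto simp: h_def)
    have TC: "refl_op h u \<in> C0" using h uC by (intro refl_op_C0) auto
    have a: "\<bar>l (refl_op h u) - l u - h * \<psi> u\<bar> \<le> (1 + C) * e' * h"
    proof (rule LIMSEQ_le_const2)
      have "(\<lambda>n. l ((step (h / Suc n) ^^ Suc n) u)) \<longlonglongrightarrow> l (refl_op h u)"
      proof (rule tendstoI)
        fix \<epsilon> :: real assume \<epsilon>: "0 < \<epsilon>"
        have "\<forall>\<^sub>F n in sequentially. \<forall>x\<in>{0..}. dist ((step (h / Suc n) ^^ Suc n) u x) (refl_op h u x) < \<epsilon>/2"
          by (rule uniform_limitD[OF refl_op_limit_single[OF _ uC]]) (use \<epsilon> h in auto)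
        then show "\<forall>\<^sub>F n in sequentially. dist (l ((step (h / Suc n) ^^ Suc n) u)) (l (refl_op h u)) < \<epsilon>"
        proof eventually_elim
          case (elim n)
          have "\<bar>l ((step (h / Suc n) ^^ Suc n) u) - l (refl_op h u)\<bar> \<le> \<epsilon>/2"
          proof (rule l.diff_bound[OF step_pow_C0[OF _ uC] TC])
            show "0 \<le> h / real (Suc n)" using h by simp
            fix x :: real assume "0 \<le> x"
            then show "\<bar>(step (h / Suc n) ^^ Suc n) u x - refl_op h u x\<bar> \<le> \<epsilon>/2"
              using elim by (auto simp: dist_real_def simp del: funpow.simps intro: less_imp_le)
          qed
          then show ?case using \<epsilon> by (simp add: dist_real_def del: funpow.simps)
        qed
      qed
      then show "(\<lambda>n. \<bar>l ((step (h / Suc n) ^^ Suc n) u) - l u - h * \<psi> u\<bar>) \<longlonglongrightarrow> \<bar>l (refl_op h u) - l u - h * \<psi> u\<bar>"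
        by (intro tendsto_intros)
      have "(\<lambda>n. h / real (Suc n)) \<longlonglongrightarrow> 0"
        using tendsto_mult_left[OF LIMSEQ_inverse_real_of_nat, of h] by (simp add: field_simps)
      then have "\<forall>\<^sub>F n in sequentially. h / real (Suc n) < h0"
        by (rule order_tendstoD) (rule h0(1))
      then have "\<forall>\<^sub>F n in sequentially. \<bar>l ((step (h / Suc n) ^^ Suc n) u) - l u - h * \<psi> u\<bar> \<le> (1 + C) * e' * h"
      proof eventually_elim
        case (elim n)
        define d where "d = h / Suc n"
        have d: "0 < d" "d < h0" "0 \<le> d" using h elim by (auto simp: d_def)
        have nd: "real (Suc n) * d = h" by (simp add: d_def del: of_nat_Suc)
        have "\<bar>l ((step d ^^ Suc n) u) - l ((step d ^^ 0) u) - real (Suc n) * (d * \<psi> u)\<bar> \<le> real (Suc n) * ((1 + C) * e' * d)"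
        proof (rule telescope_bound[where a = "\<lambda>k. l ((step d ^^ k) u)"])
          fix k assume k: "k < Suc n"
          have "real k * d \<le> real (Suc n) * d" using k d by (intro mult_right_mono) auto
          then have kd: "real k * d \<le> h1" using nd h by linarith
          let ?w = "(step d ^^ k) u"
          have wC: "?w \<in> C0" by (rule step_pow_C0[OF d(3) uC])
          have wB: "\<bar>?w x\<bar> \<le> B" if "0 \<le> x" for x
            using that
          proof (induction k arbitrary: x)
            case (Suc k)
            show ?case using step_bound[OF d(3) step_pow_C0[OF d(3) uC] Suc.IH Suc.prems] by simp
          qed (use B in auto)
          have 1: "\<bar>l (step d ?w) - l ?w - d * \<psi> ?w\<bar> \<le> e' * d"
            by (rule h0(2)[OF d(1,2) step_pow_lipschitz[OF d(3) u L] wB])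
          have 2: "\<bar>d * \<psi> ?w - d * \<psi> u\<bar> \<le> d * (C * e')"
            unfolding right_diff_distrib[symmetric] abs_mult using \<psi>(2)[OF wC uC h1(2)[OF d(3) kd]] d by (intro mult_mono) auto
          have "(1 + C) * e' * d = e' * d + d * (C * e')" by (simp add: algebra_simps)
          then show "\<bar>l ((step d ^^ Suc k) u) - l ?w - d * \<psi> u\<bar> \<le> (1 + C) * e' * d"
            using 1 2 by simp
        qed
        moreover have "real (Suc n) * (d * \<psi> u) = h * \<psi> u" by (simp only: mult.assoc[symmetric] nd)
        moreover have "real (Suc n) * ((1 + C) * e' * d) = (1 + C) * e' * h"
          unfolding nd[symmetric] by simp
        ultimately show ?case by (simp only: d_def funpow_0)
      qed
      then show "\<exists>N. \<forall>n\<ge>N. \<bar>l ((step (h / Suc n) ^^ Suc n) u) - l u - h * \<psi> u\<bar> \<le> (1 + C) * e' * h"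
        by (simp only: eventually_sequentially)
    qed
    have b: "\<bar>l (refl_op h u) - (l u + h * l (\<lambda>x\<in>{0..}. g x))\<bar> \<le> e' * h"
    proof -
      have "\<bar>l (refl_op h u) - l (\<lambda>x\<in>{0..}. 1 * u x + h * (\<lambda>x\<in>{0..}. g x) x)\<bar> \<le> e' * h"
      proof (rule l.diff_bound[OF TC C0_lincomb[OF uC gC]])
        fix x :: real assume x: "0 \<le> x"
        show "\<bar>refl_op h u x - (\<lambda>x\<in>{0..}. 1 * u x + h * (\<lambda>x\<in>{0..}. g x) x) x\<bar> \<le> e' * h"
          using h2(2)[OF h(1,3) x] x by (simp add: diff_diff_eq)
      qed
      then show ?thesis unfolding l.lincomb[OF uC gC] by simp
    qed
    have "h * \<bar>l (\<lambda>x\<in>{0..}. g x) - \<psi> u\<bar> = \<bar>h * l (\<lambda>x\<in>{0..}. g x) - h * \<psi> u\<bar>"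
      using h by (simp add: abs_mult right_diff_distrib[symmetric])
    also have "\<dots> \<le> (1 + C) * e' * h + e' * h" using a b by linarith
    also have "\<dots> = h * ((2 + C) * e')" by (simp add: algebra_simps)
    finally have "\<bar>l (\<lambda>x\<in>{0..}. g x) - \<psi> u\<bar> \<le> (2 + C) * e'" using h by simp
    also have "\<dots> = e" using \<psi>(1) by (simp add: e'_def)
    finally show ?thesis by simp
  qed
  from field_le_epsilon[OF this] show ?thesis by simp
qed

end

text \<open>Negation exchanges the two reflections.\<close>

lemma (in levy_process) neg_levy_process: "levy_process M (\<lambda>t \<omega>. - Z t \<omega>)"
proof
  show "(\<lambda>\<omega>. - Z t \<omega>) \<in> borel_measurable M" if "0 \<le> t" for t using measurable_Z[OF that] by simp
  show "AE \<omega> in M. - Z 0 \<omega> = 0" using start by simp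
  show "indep_vars (\<lambda>_. borel) (\<lambda>i \<omega>. - Z (\<tau> (Suc i)) \<omega> - - Z (\<tau> i) \<omega>) {..<n::nat}"
    if "0 \<le> \<tau> 0" "mono \<tau>" for \<tau> n
    using indep_vars_compose2[OF indep_increments[OF that], where Y = "\<lambda>_. uminus" and N = "\<lambda>_. borel"] by simp
  show "distr M borel (\<lambda>\<omega>. - Z (s + t) \<omega> - - Z s \<omega>) = distr M borel (\<lambda>\<omega>. - Z t \<omega>)" if st: "0 \<le> s" "0 \<le> t" for s t
  proof -
    note m[measurable] = measurable_Z[OF st(1)] measurable_Z[OF st(2)] measurable_Z[of "s + t"]
    have st': "0 \<le> s + t" using st by simp
    note [measurable] = measurable_Z[OF st']
    have "distr (distr M borel (\<lambda>\<omega>. Z (s + t) \<omega> - Z s \<omega>)) borel uminus = distr (distr M borel (Z t)) borel uminus"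
      by (simp add: stationary_increments[OF st])
    then show ?thesis by (subst (asm) (1 2) distr_distr) (simp_all add: comp_def)
  qed
  show "((\<lambda>s. - Z s \<omega>) \<longlongrightarrow> - Z t \<omega>) (at_right t)" if "\<omega> \<in> space M" "0 \<le> t" for \<omega> t
    by (intro tendsto_minus right_continuous that)
  show "\<exists>l. ((\<lambda>s. - Z s \<omega>) \<longlongrightarrow> l) (at_left t)" if "\<omega> \<in> space M" "0 < t" for \<omega> t
    using left_limits[OF that] tendsto_minus by blast
qed

lemma refl_sup_eq_refl_inf: "refl_sup Z = refl_inf (\<lambda>t \<omega>. - Z t \<omega>)"
  by (simp add: fun_eq_iff refl_sup_def refl_inf_def running_sup_def running_inf_def Inf_real_def image_image)

section \<open>Moments of the spectrally negative stable process\<close>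

lemma exp_taylor_le:
  fixes a :: real assumes "0 \<le> a"
  shows "0 \<le> exp a - 1 - a" "exp a - 1 - a \<le> a\<^sup>2 * exp a"
proof -
  show "0 \<le> exp a - 1 - a" using exp_ge_add_one_self[of a] by linarith
  have "exp a * (1 + - a) \<le> exp a * exp (- a)" by (intro mult_left_mono exp_ge_add_one_self) auto
  then have 1: "exp a - 1 \<le> a * exp a" by (simp add: algebra_simps flip: exp_add)
  have "exp a - 1 - a \<le> a * (exp a - 1)" using 1 by (simp add: algebra_simps)
  also have "\<dots> \<le> a * (a * exp a)" using 1 assms by (intro mult_left_mono)
  finally show "exp a - 1 - a \<le> a\<^sup>2 * exp a" by (simp add: power2_eq_square mult_ac)
qed

lemma exp_linear_small:
  fixes a e :: real assumes "0 \<le> a" "0 < e"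
  shows "\<exists>h0>0. \<forall>h. 0 < h \<longrightarrow> h < h0 \<longrightarrow> \<bar>exp (h * a) - 1 - h * a\<bar> \<le> e * h"
proof (intro exI[of _ "min 1 (e / ((a\<^sup>2 + 1) * exp a))"] conjI allI impI)
  have pos: "0 < (a\<^sup>2 + 1) * exp a" by (intro mult_pos_pos) (auto intro: add_nonneg_pos)
  then show "0 < min 1 (e / ((a\<^sup>2 + 1) * exp a))" using assms by simp
  fix h :: real assume h: "0 < h" "h < min 1 (e / ((a\<^sup>2 + 1) * exp a))"
  have ha: "0 \<le> h * a" "h * a \<le> a" using h assms mult_right_mono[of h 1 a] by auto
  have "exp (h * a) - 1 - h * a \<le> (h * a)\<^sup>2 * exp (h * a)" by (rule exp_taylor_le[OF ha(1)])
  also have "\<dots> \<le> (h * a)\<^sup>2 * exp a" using ha by (intro mult_left_mono) auto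
  also have "\<dots> \<le> h * (h * ((a\<^sup>2 + 1) * exp a))" using h by (simp add: power2_eq_square algebra_simps)
  also have "\<dots> \<le> h * e"
  proof -
    have "h * ((a\<^sup>2 + 1) * exp a) \<le> e" using h(2) pos by (simp add: pos_less_divide_eq)
    then show ?thesis using h(1) by (intro mult_left_mono) auto
  qed
  finally show "\<bar>exp (h * a) - 1 - h * a\<bar> \<le> e * h"
    using exp_taylor_le(1)[OF ha(1)] by (simp add: mult.commute)
qed

lemma powr_gt_one_small:
  fixes p C e :: real assumes p: "1 < p" and C: "0 < C" and e: "0 < e"
  shows "\<exists>h0>0. \<forall>h. 0 < h \<longrightarrow> h < h0 \<longrightarrow> C * h powr p \<le> e * h"
proof (intro exI[of _ "(e / C) powr (1 / (p - 1))"] conjI allI impI)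
  show "0 < (e / C) powr (1 / (p - 1))" using C e by simp
  fix h :: real assume h: "0 < h" "h < (e / C) powr (1 / (p - 1))"
  have "h powr (p - 1) \<le> ((e / C) powr (1 / (p - 1))) powr (p - 1)"
    using h p by (intro powr_mono2) auto
  also have "\<dots> = e / C" using p C e by (simp add: powr_powr)
  finally have "h powr (p - 1) * C \<le> e" using C by (simp add: field_simps)
  moreover have "h powr p = h powr (p - 1) * h" using h by (simp add: powr_diff)
  ultimately show "C * h powr p \<le> e * h" using mult_right_mono[of "h powr (p - 1) * C" e h] h by (simp add: mult_ac)
qed

text \<open>The convolution theorem at a fixed value of the transform variable, the exponentials being part of \<open>a\<close> and \<open>b\<close>.\<close>

lemma convolution_integral:
  fixes a b :: "real \<Rightarrow> real"
  assumes a: "integrable lborel a" and b: "integrable lborel b"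
  shows "has_bochner_integral lborel (\<lambda>x. \<integral>y. a (x - y) * b y \<partial>lborel) (integral\<^sup>L lborel a * integral\<^sup>L lborel b)"
proof -
  note [measurable] = borel_measurable_integrable[OF a] borel_measurable_integrable[OF b]
  have shift: "integrable lborel (\<lambda>x. a (x - y))" "(\<integral>x. a (x - y) \<partial>lborel) = integral\<^sup>L lborel a"
    and nshift: "(\<integral>x. \<bar>a (x - y)\<bar> \<partial>lborel) = (\<integral>x. \<bar>a x\<bar> \<partial>lborel)" for y
    using lborel_integrable_real_affine[OF a, of 1 "- y"] lborel_integral_real_affine[of 1 a "- y"]
      lborel_integral_real_affine[of 1 "\<lambda>x. \<bar>a x\<bar>" "- y"] by (simp_all add: algebra_simps)
  have int: "integrable (lborel \<Otimes>\<^sub>M lborel) (\<lambda>(y, x). a (x - y) * b y)"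
  proof (rule lborel_pair.Fubini_integrable)
    show "integrable lborel (\<lambda>y. \<integral>x. norm (case (y, x) of (y, x) \<Rightarrow> a (x - y) * b y) \<partial>lborel)"
      using b by (simp add: abs_mult nshift)
    show "AE y in lborel. integrable lborel (\<lambda>x. case (y, x) of (y, x) \<Rightarrow> a (x - y) * b y)"
      using shift(1) by (intro AE_I2) simp
  qed measurable
  have "(\<integral>x. \<integral>y. a (x - y) * b y \<partial>lborel \<partial>lborel) = (\<integral>y. \<integral>x. a (x - y) * b y \<partial>lborel \<partial>lborel)"
    by (rule lborel_pair.Fubini_integral[OF int])
  also have "\<dots> = integral\<^sup>L lborel a * integral\<^sup>L lborel b" by (simp add: shift(2))
  finally show ?thesis using lborel_pair.integrable_snd[OF int] by (simp add: has_bochner_integral_iff)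
qed

lemma continuous_on_half_line:
  fixes f :: "real \<Rightarrow> real"
  assumes "\<And>b. continuous_on {0..b} f" shows "continuous_on {0..} f"
  unfolding continuous_on_iff
proof (intro ballI allI impI)
  fix x e :: real assume x: "x \<in> {0..}" and e: "0 < e"
  obtain d where d: "0 < d" "\<And>y. y \<in> {0..x+1} \<Longrightarrow> dist y x < d \<Longrightarrow> dist (f y) (f x) < e"
    using assms[of "x + 1"] x e unfolding continuous_on_iff by (metis atLeastAtMost_iff atLeast_iff le_add_same_cancel1 zero_le_one)
  show "\<exists>d>0. \<forall>y\<in>{0..}. dist y x < d \<longrightarrow> dist (f y) (f x) < e"
    by (rule exI[of _ "min d 1"]) (use d x in \<open>auto simp: dist_real_def\<close>)
qed

text \<open>The stable process enters through its Laplace exponent \<open>l\<^sup>\<alpha>\<close>.\<close>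

locale stable_levy = levy_process M Z
  for M :: "'a measure" and Z :: "real \<Rightarrow> 'a \<Rightarrow> real" +
  fixes \<alpha> :: real
  assumes \<alpha>: "1 < \<alpha>" "\<alpha> < 2"
    and exp_moment: "0 \<le> t \<Longrightarrow> 0 \<le> l \<Longrightarrow> (\<integral>\<omega>. exp (l * Z t \<omega>) \<partial>M) = exp (t * l powr \<alpha>)"

sublocale stable_levy \<subseteq> N: levy_process M "\<lambda>t \<omega>. - Z t \<omega>"
  by (rule neg_levy_process)

context stable_levy
begin

lemma exp_moment_integrable: "0 \<le> t \<Longrightarrow> 0 \<le> l \<Longrightarrow> integrable M (\<lambda>\<omega>. exp (l * Z t \<omega>))"
  using exp_moment[of t l] not_integrable_integral_eq[of M "\<lambda>\<omega>. exp (l * Z t \<omega>)"] by force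

text \<open>Use \<open>z\<^sup>2 \<le> 2 exp (s z) / s\<^sup>2\<close> with \<open>s = h\<^bsup>-1/\<alpha>\<^esup>\<close>, the scale of \<open>Z\<^sub>h\<close>: then \<open>h (q + s)\<^sup>\<alpha>\<close> stays bounded, and so does the exponential moment.\<close>

lemma positive_part_moment:
  fixes q :: real assumes q: "0 \<le> q"
  defines "P \<equiv> \<lambda>h \<omega>. (max 0 (Z h \<omega>))\<^sup>2 * exp (q * max 0 (Z h \<omega>))"
  shows "0 \<le> h \<Longrightarrow> integrable M (P h)"
    and "\<exists>C>0. \<forall>h. 0 < h \<longrightarrow> h < 1 \<longrightarrow> (\<integral>\<omega>. P h \<omega> \<partial>M) \<le> C * h powr (2 / \<alpha>)"
proof -
  have bound: "P h \<omega> \<le> 2 / s\<^sup>2 * (1 + exp ((q + s) * Z h \<omega>))" if s: "0 < s" for s h \<omega>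
  proof -
    define z where "z = max 0 (Z h \<omega>)"
    have z: "0 \<le> z" by (simp add: z_def)
    have "0 \<le> s * z" using s z by simp
    then have "(s * z)\<^sup>2 / 2 \<le> exp (s * z)" using exp_lower_Taylor_quadratic[of "s * z"] by linarith
    then have "z\<^sup>2 * s\<^sup>2 \<le> 2 * exp (s * z)" by (simp add: power_mult_distrib mult.commute)
    then have "z\<^sup>2 \<le> 2 / s\<^sup>2 * exp (s * z)" using s by (simp add: pos_le_divide_eq)
    then have "z\<^sup>2 * exp (q * z) \<le> 2 / s\<^sup>2 * exp (s * z) * exp (q * z)" by (intro mult_right_mono) auto
    also have "\<dots> = 2 / s\<^sup>2 * exp ((q + s) * z)" by (simp add: algebra_simps flip: exp_add)
    also have "\<dots> \<le> 2 / s\<^sup>2 * (1 + exp ((q + s) * Z h \<omega>))"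
    proof (rule mult_left_mono)
      show "exp ((q + s) * z) \<le> 1 + exp ((q + s) * Z h \<omega>)"
        by (cases "0 \<le> Z h \<omega>") (auto simp: z_def max_def)
    qed simp
    finally show ?thesis unfolding P_def z_def .
  qed
  show int: "integrable M (P h)" if h: "0 \<le> h" for h
  proof (rule Bochner_Integration.integrable_bound)
    show "integrable M (\<lambda>\<omega>. 2 / 1\<^sup>2 * (1 + exp ((q + 1) * Z h \<omega>)))"
      using exp_moment_integrable[OF h, of "q + 1"] q by (intro integrable_mult_right Bochner_Integration.integrable_add) auto
    note [measurable] = measurable_Z[OF h]
    show "P h \<in> borel_measurable M" unfolding P_def by measurable
    show "AE \<omega> in M. norm (P h \<omega>) \<le> norm (2 / 1\<^sup>2 * (1 + exp ((q + 1) * Z h \<omega>)))"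
      using bound[of 1 h] by (intro AE_I2) (auto simp: P_def intro: order_trans[OF _ abs_ge_self])
  qed
  define C where "C = 2 * (1 + exp ((q + 1) powr \<alpha>))"
  have "(\<integral>\<omega>. P h \<omega> \<partial>M) \<le> C * h powr (2 / \<alpha>)" if h: "0 < h" "h < 1" for h
  proof -
    define s where "s = h powr (- 1 / \<alpha>)"
    have s: "0 < s" using h by (simp add: s_def)
    have s2: "2 / s\<^sup>2 = 2 * h powr (2 / \<alpha>)"
    proof -
      have "s\<^sup>2 = h powr (- (1 / \<alpha>) + - (1 / \<alpha>))" unfolding powr_add s_def by (simp add: power2_eq_square)
      also have "- (1 / \<alpha>) + - (1 / \<alpha>) = - (2 / \<alpha>)" by simp
      finally show ?thesis using h by (simp add: powr_minus divide_inverse)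
    qed
    have "h * (q + s) powr \<alpha> = (h powr (1 / \<alpha>) * (q + s)) powr \<alpha>"
      using h q s \<alpha> by (simp add: powr_mult powr_powr)
    also have "h powr (1 / \<alpha>) * (q + s) = q * h powr (1 / \<alpha>) + 1"
    proof -
      have "h powr (1 / \<alpha>) * s = h powr (1 / \<alpha> + - 1 / \<alpha>)" unfolding powr_add s_def ..
      also have "\<dots> = 1" using h by simp
      finally show ?thesis by (simp add: algebra_simps)
    qed
    also have "(q * h powr (1 / \<alpha>) + 1) powr \<alpha> \<le> (q + 1) powr \<alpha>"
      using q h \<alpha> powr_le1[of "1 / \<alpha>" h] by (intro powr_mono2) (auto intro!: mult_left_le)
    finally have le: "h * (q + s) powr \<alpha> \<le> (q + 1) powr \<alpha>" .
    have "(\<integral>\<omega>. P h \<omega> \<partial>M) \<le> (\<integral>\<omega>. 2 / s\<^sup>2 * (1 + exp ((q + s) * Z h \<omega>)) \<partial>M)"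
      using bound[OF s] h q s exp_moment_integrable[of h "q + s"]
      by (intro integral_mono int integrable_mult_right Bochner_Integration.integrable_add) auto
    also have "\<dots> = 2 / s\<^sup>2 * (1 + exp (h * (q + s) powr \<alpha>))"
      using h q s exp_moment_integrable[of h "q + s"] exp_moment[of h "q + s"] by (simp add: prob_space)
    also have "\<dots> \<le> 2 / s\<^sup>2 * (1 + exp ((q + 1) powr \<alpha>))" using le by (intro mult_left_mono) auto
    also have "\<dots> = C * h powr (2 / \<alpha>)" unfolding s2 C_def by simp
    finally show ?thesis .
  qed
  moreover have "0 < C" by (simp add: C_def add_pos_pos)
  ultimately show "\<exists>C>0. \<forall>h. 0 < h \<longrightarrow> h < 1 \<longrightarrow> (\<integral>\<omega>. P h \<omega> \<partial>M) \<le> C * h powr (2 / \<alpha>)" by blast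
qed

lemma positive_part_moment_small:
  fixes q A e :: real assumes q: "0 \<le> q" and A: "0 \<le> A" and e: "0 < e"
  shows "\<exists>h0>0. \<forall>h. 0 < h \<longrightarrow> h < h0 \<longrightarrow> A * (\<integral>\<omega>. (max 0 (Z h \<omega>))\<^sup>2 * exp (q * max 0 (Z h \<omega>)) \<partial>M) \<le> e * h"
proof -
  obtain C where C: "0 < C" "\<And>h. 0 < h \<Longrightarrow> h < 1 \<Longrightarrow>
      (\<integral>\<omega>. (max 0 (Z h \<omega>))\<^sup>2 * exp (q * max 0 (Z h \<omega>)) \<partial>M) \<le> C * h powr (2 / \<alpha>)"
    using positive_part_moment(2)[OF q] by blast
  have AC: "0 < (A + 1) * C" using A C(1) by simp
  have p: "1 < 2 / \<alpha>" using \<alpha> by simp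
  obtain h0 where h0: "0 < h0" "\<And>h. 0 < h \<Longrightarrow> h < h0 \<Longrightarrow> ((A + 1) * C) * h powr (2 / \<alpha>) \<le> e * h"
    using powr_gt_one_small[OF p AC e] by blast
  have "A * (\<integral>\<omega>. (max 0 (Z h \<omega>))\<^sup>2 * exp (q * max 0 (Z h \<omega>)) \<partial>M) \<le> e * h" if h: "0 < h" "h < min 1 h0" for h
  proof -
    have "A * (\<integral>\<omega>. (max 0 (Z h \<omega>))\<^sup>2 * exp (q * max 0 (Z h \<omega>)) \<partial>M) \<le> (A + 1) * (C * h powr (2 / \<alpha>))"
      using A C h by (intro mult_mono C(2)) (auto intro!: Bochner_Integration.integral_nonneg)
    also have "\<dots> = ((A + 1) * C) * h powr (2 / \<alpha>)" by simp
    also have "\<dots> \<le> e * h" using h by (intro h0(2)) auto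
    finally show ?thesis .
  qed
  then show ?thesis using h0(1) by (intro exI[of _ "min 1 h0"]) auto
qed

text \<open>The derivative of \<open>F\<^sub>\<alpha>\<close>, extended continuously by \<open>0\<close> at the origin; the value of \<open>FML'\<close> there is arbitrary.\<close>

definition dF :: "real \<Rightarrow> real" where "dF x = \<alpha> * x powr (\<alpha> - 1) * ml1 \<alpha> (x powr \<alpha>)"

lemma dF_0: "dF 0 = 0" using \<alpha> by (simp add: dF_def)

lemma dF_eq: "0 < x \<Longrightarrow> dF x = FML' \<alpha> x" using \<alpha> by (simp add: dF_def deriv_FML)

lemma dF_continuous: "continuous_on {0..} dF"
  unfolding dF_def[abs_def] by (rule continuous_on_deriv_FML[OF \<alpha>(1)])

lemma dF_max_continuous: "continuous_on UNIV (\<lambda>x. dF (max 0 x))"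
  by (intro continuous_on_compose2[OF dF_continuous] continuous_intros) auto

lemma laplace_dF:
  assumes \<theta>: "1 < \<theta>"
  shows "has_bochner_integral lborel (\<lambda>x. indicator {0..} x * (exp (- (\<theta> * x)) * dF x)) (1 / (\<theta> powr \<alpha> - 1))"
  using laplace_FML'[OF \<alpha>(1) \<theta>]
  by (subst has_bochner_integral_discrete_difference[of "{0}" _ _ "\<lambda>x. indicator {0..} x * (exp (- (\<theta> * x)) * FML' \<alpha> x)"])
     (auto simp: dF_eq indicator_def)

lemma laplace_dF_shift:
  assumes \<theta>: "1 < \<theta>" and x: "0 \<le> x"
  shows "has_bochner_integral lborel (\<lambda>y. indicator {0..} y * (exp (- (\<theta> * y)) * dF (max 0 (y - x)))) (exp (- (\<theta> * x)) / (\<theta> powr \<alpha> - 1))"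
proof -
  have "has_bochner_integral lborel (\<lambda>y. indicator {0..} (- x + 1 * y) * (exp (- (\<theta> * (- x + 1 * y))) * dF (- x + 1 * y))) (1 / (\<theta> powr \<alpha> - 1))"
    using laplace_dF[OF \<theta>] by (subst (asm) lborel_has_bochner_integral_real_affine_iff[of 1 _ _ "- x"]) auto
  from has_bochner_integral_mult_right[OF this, of "exp (- (\<theta> * x))"]
  have "has_bochner_integral lborel (\<lambda>y. exp (- (\<theta> * x)) * (indicator {0..} (- x + 1 * y) * (exp (- (\<theta> * (- x + 1 * y))) * dF (- x + 1 * y))))
     (exp (- (\<theta> * x)) / (\<theta> powr \<alpha> - 1))" by simp
  also have "(\<lambda>y. exp (- (\<theta> * x)) * (indicator {0..} (- x + 1 * y) * (exp (- (\<theta> * (- x + 1 * y))) * dF (- x + 1 * y)))) =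
      (\<lambda>y. indicator {0..} y * (exp (- (\<theta> * y)) * dF (max 0 (y - x))))"
  proof
    fix y
    show "exp (- (\<theta> * x)) * (indicator {0..} (- x + 1 * y) * (exp (- (\<theta> * (- x + 1 * y))) * dF (- x + 1 * y))) =
      indicator {0..} y * (exp (- (\<theta> * y)) * dF (max 0 (y - x)))"
    proof (cases "x \<le> y")
      case True
      have "exp (- (\<theta> * x)) * exp (- (\<theta> * (- x + 1 * y))) = exp (- (\<theta> * y))" by (simp add: algebra_simps flip: exp_add)
      then show ?thesis using True x by (simp add: mult.assoc[symmetric] max_def)
    next
      case False
      then show ?thesis by (simp add: dF_0 max_def)
    qed
  qed
  finally show ?thesis .
qed

section \<open>Reflection at the supremum\<close>

abbreviation E :: "real \<Rightarrow> real \<Rightarrow> real" where "E \<theta> \<equiv> (\<lambda>x\<in>{0..}. exp (- (\<theta> * x)))"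

text \<open>With \<open>y = max 0 (Z\<^sub>h - x)\<close> the overshoot, \<open>exp (- \<theta> max 0 (x - Z\<^sub>h)) = exp (- \<theta> (x - Z\<^sub>h)) - (exp (\<theta> y) - 1)\<close>. The subtracted multiple of \<open>exp (- x)\<close> cancels the first-order term \<open>\<theta> y\<close> of the correction, which leaves the quadratic remainder \<open>R\<close>.\<close>

lemma sup_step_consistent:
  assumes \<theta>: "1 < \<theta>" and e: "0 < e"
  defines "u \<equiv> \<lambda>x\<in>{0..}. exp (- (\<theta> * x)) - \<theta> * exp (- x)"
    and "g \<equiv> \<lambda>x\<in>{0..}. \<theta> powr \<alpha> * exp (- (\<theta> * x)) - \<theta> * exp (- x)"
  shows "\<exists>h0>0. \<forall>h x. 0 < h \<longrightarrow> h < h0 \<longrightarrow> 0 \<le> x \<longrightarrow> \<bar>N.step h u x - u x - h * g x\<bar> \<le> e * h"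
proof -
  obtain h1 where h1: "0 < h1" "\<And>h. 0 < h \<Longrightarrow> h < h1 \<Longrightarrow> \<bar>exp (h * \<theta> powr \<alpha>) - 1 - h * \<theta> powr \<alpha>\<bar> \<le> e/3 * h"
    using exp_linear_small[of "\<theta> powr \<alpha>" "e/3"] e by auto
  have e\<theta>: "0 < e/3/\<theta>" using e \<theta> by simp
  obtain h2 where h2: "0 < h2" "\<And>h. 0 < h \<Longrightarrow> h < h2 \<Longrightarrow> \<bar>exp (h * 1) - 1 - h * 1\<bar> \<le> e/3/\<theta> * h"
    using exp_linear_small[OF zero_le_one e\<theta>] by blast
  obtain h3 where h3: "0 < h3" "\<And>h. 0 < h \<Longrightarrow> h < h3 \<Longrightarrow> \<theta>\<^sup>2 * (\<integral>\<omega>. (max 0 (Z h \<omega>))\<^sup>2 * exp (\<theta> * max 0 (Z h \<omega>)) \<partial>M) \<le> e/3 * h"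
    using positive_part_moment_small[of \<theta> "\<theta>\<^sup>2" "e/3"] e \<theta> by auto
  have "\<bar>N.step h u x - u x - h * g x\<bar> \<le> e * h" if h: "0 < h" "h < min h1 (min h2 h3)" and x: "0 \<le> x" for h x
  proof -
    have h0: "0 \<le> h" using h by simp
    note [measurable] = measurable_Z[OF h0]
    define Y where "Y \<omega> = max 0 (Z h \<omega> - x)" for \<omega>
    define R where "R \<omega> = (exp (\<theta> * Y \<omega>) - 1) - \<theta> * (exp (Y \<omega>) - 1)" for \<omega>
    define P where "P \<omega> = (max 0 (Z h \<omega>))\<^sup>2 * exp (\<theta> * max 0 (Z h \<omega>))" for \<omega>
    have Pi: "integrable M P" unfolding P_def using positive_part_moment(1)[of \<theta> h] h0 \<theta> by simp
    have RP: "\<bar>R \<omega>\<bar> \<le> \<theta>\<^sup>2 * P \<omega>" for \<omega>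
    proof -
      let ?y = "Y \<omega>" and ?z = "max 0 (Z h \<omega>)"
      have y: "0 \<le> ?y" "?y \<le> ?z" using x by (auto simp: Y_def)
      have \<theta>y: "0 \<le> \<theta> * ?y" "?y \<le> \<theta> * ?y" using \<theta> y mult_right_mono[of 1 \<theta> ?y] by auto
      have a: "0 \<le> exp (\<theta> * ?y) - 1 - \<theta> * ?y" "exp (\<theta> * ?y) - 1 - \<theta> * ?y \<le> (\<theta> * ?y)\<^sup>2 * exp (\<theta> * ?y)"
        using exp_taylor_le[OF \<theta>y(1)] by auto
      have b: "0 \<le> \<theta> * (exp ?y - 1 - ?y)" using exp_taylor_le(1)[OF y(1)] \<theta> by simp
      have "\<theta> * (exp ?y - 1 - ?y) \<le> \<theta>\<^sup>2 * (?y\<^sup>2 * exp ?y)"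
        using exp_taylor_le[OF y(1)] \<theta> self_le_power[of \<theta> 2] by (intro mult_mono) auto
      also have "\<dots> \<le> \<theta>\<^sup>2 * (?y\<^sup>2 * exp (\<theta> * ?y))" using \<theta>y by (intro mult_left_mono) auto
      finally have c: "\<theta> * (exp ?y - 1 - ?y) \<le> (\<theta> * ?y)\<^sup>2 * exp (\<theta> * ?y)" by (simp add: power_mult_distrib)
      have "R \<omega> = (exp (\<theta> * ?y) - 1 - \<theta> * ?y) - \<theta> * (exp ?y - 1 - ?y)" by (simp add: R_def algebra_simps)
      then have "\<bar>R \<omega>\<bar> \<le> (\<theta> * ?y)\<^sup>2 * exp (\<theta> * ?y)" using a b c by linarith
      also have "\<dots> = \<theta>\<^sup>2 * (?y\<^sup>2 * exp (\<theta> * ?y))" by (simp add: power_mult_distrib)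
      also have "\<dots> \<le> \<theta>\<^sup>2 * P \<omega>" unfolding P_def using y \<theta>
        by (intro mult_left_mono mult_mono power_mono) auto
      finally show ?thesis .
    qed
    have Rm[measurable]: "R \<in> borel_measurable M" unfolding R_def Y_def by measurable
    have Ri: "integrable M R"
    proof (rule Bochner_Integration.integrable_bound[OF integrable_mult_right[OF Pi, of "\<theta>\<^sup>2"] Rm])
      show "AE \<omega> in M. norm (R \<omega>) \<le> norm (\<theta>\<^sup>2 * P \<omega>)"
        using RP by (intro AE_I2) (auto intro: order_trans[OF _ abs_ge_self])
    qed
    have Rint: "\<bar>\<integral>\<omega>. R \<omega> \<partial>M\<bar> \<le> e/3 * h"
    proof -
      have "\<bar>\<integral>\<omega>. R \<omega> \<partial>M\<bar> \<le> (\<integral>\<omega>. \<bar>R \<omega>\<bar> \<partial>M)" using integral_norm_bound[of M R] by simp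
      also have "\<dots> \<le> (\<integral>\<omega>. \<theta>\<^sup>2 * P \<omega> \<partial>M)" by (intro integral_mono integrable_abs Ri integrable_mult_right Pi RP)
      also have "\<dots> \<le> e/3 * h" using h3(2)[of h] h by (simp add: P_def)
      finally show ?thesis .
    qed
    have pw: "u (max 0 (x + - Z h \<omega>)) = exp (- (\<theta> * x)) * exp (\<theta> * Z h \<omega>) - \<theta> * exp (- x) * exp (1 * Z h \<omega>) - R \<omega>" for \<omega>
      by (cases "Z h \<omega> \<le> x") (auto simp: u_def R_def Y_def max_def algebra_simps simp flip: exp_add)
    have "N.step h u x = (\<integral>\<omega>. exp (- (\<theta> * x)) * exp (\<theta> * Z h \<omega>) - \<theta> * exp (- x) * exp (1 * Z h \<omega>) - R \<omega> \<partial>M)"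
      using x by (simp only: N.step_def rand_op_def pw restrict_apply' atLeast_iff)
    also have "\<dots> = exp (- (\<theta> * x)) * exp (h * \<theta> powr \<alpha>) - \<theta> * exp (- x) * exp (h * 1 powr \<alpha>) - (\<integral>\<omega>. R \<omega> \<partial>M)"
      using exp_moment_integrable[OF h0, of \<theta>] exp_moment_integrable[OF h0, of 1] exp_moment[OF h0, of \<theta>] exp_moment[OF h0, of 1] Ri \<theta>
      by simp
    finally have eq: "N.step h u x - u x - h * g x =
        exp (- (\<theta> * x)) * (exp (h * \<theta> powr \<alpha>) - 1 - h * \<theta> powr \<alpha>) - \<theta> * exp (- x) * (exp (h * 1) - 1 - h * 1) - (\<integral>\<omega>. R \<omega> \<partial>M)"
      using x by (simp add: u_def g_def algebra_simps)
    have "\<bar>exp (- (\<theta> * x)) * (exp (h * \<theta> powr \<alpha>) - 1 - h * \<theta> powr \<alpha>)\<bar> \<le> 1 * (e/3 * h)"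
      unfolding abs_mult using h1(2)[of h] h x \<theta> by (intro mult_mono) auto
    moreover have "\<bar>\<theta> * exp (- x) * (exp (h * 1) - 1 - h * 1)\<bar> \<le> (\<theta> * 1) * (e/3/\<theta> * h)"
      unfolding abs_mult using h2(2)[of h] h x \<theta> by (intro mult_mono) auto
    moreover have "(\<theta> * 1) * (e/3/\<theta> * h) = e/3 * h" using \<theta> by simp
    ultimately show ?thesis unfolding eq using Rint by linarith
  qed
  then show ?thesis using h1(1) h2(1) h3(1) by (intro exI[of _ "min h1 (min h2 h3)"]) auto
qed

lemma C0_E: "0 < \<theta> \<Longrightarrow> E \<theta> \<in> C0" by (rule C0_exp)

lemma sup_resolvent_exp:
  assumes \<theta>: "1 < \<theta>" and x: "0 \<le> x"
  shows "N.refl.U (E \<theta>) x = (exp (- (\<theta> * x)) - \<theta> * exp (- x)) / (1 - \<theta> powr \<alpha>)"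
proof -
  define u where "u = (\<lambda>x\<in>{0..}. exp (- (\<theta> * x)) - \<theta> * exp (- x))"
  define g where "g = (\<lambda>x\<in>{0..}. \<theta> powr \<alpha> * exp (- (\<theta> * x)) - \<theta> * exp (- x))"
  have EC: "E \<theta> \<in> C0" "E 1 \<in> C0" by (rule C0_E, use \<theta> in simp)+
  have "u = (\<lambda>x\<in>{0..}. 1 * E \<theta> x + (- \<theta>) * E 1 x)" unfolding u_def by (rule restrict_ext) simp
  then have uC: "u \<in> C0" using C0_lincomb[OF EC, of 1 "- \<theta>"] by metis
  have "g = (\<lambda>x\<in>{0..}. \<theta> powr \<alpha> * E \<theta> x + (- \<theta>) * E 1 x)" unfolding g_def by (rule restrict_ext) simp
  then have gC: "g \<in> C0" using C0_lincomb[OF EC, of "\<theta> powr \<alpha>" "- \<theta>"] by metis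
  have gen: "N.refl.generator_limit u g"
    by (rule N.generator_limit_of_step[OF uC gC]) (unfold u_def g_def, rule sup_step_consistent[OF \<theta>])
  have "(\<lambda>x\<in>{0..}. u x - g x) = (\<lambda>x\<in>{0..}. (1 - \<theta> powr \<alpha>) * E \<theta> x + 0 * E \<theta> x)"
    by (rule restrict_ext) (simp add: u_def g_def algebra_simps)
  then have "u = N.refl.U (\<lambda>x\<in>{0..}. (1 - \<theta> powr \<alpha>) * E \<theta> x + 0 * E \<theta> x)"
    using N.refl.generator_limit_imp_U[OF uC gen] by simp
  then have "u x = (1 - \<theta> powr \<alpha>) * N.refl.U (E \<theta>) x"
    unfolding N.refl.U_lincomb[OF EC(1) EC(1)] using x by simp
  moreover have "1 < \<theta> powr \<alpha>" using \<theta> \<alpha> by simp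
  ultimately show ?thesis using x by (simp add: u_def field_simps)
qed

text \<open>The kernel \<open>r\<close> has the Laplace transform \<open>(exp (- \<theta> x) - \<theta> exp (- x)) / (1 - \<theta>\<^sup>\<alpha>)\<close>, which is the resolvent of the exponential.\<close>

lemma sup_resolvent_formula:
  assumes f: "f \<in> C0" and x: "0 \<le> x"
  shows "N.refl.U f x = exp (- x) * (LBINT y:{0..x}. FML'' \<alpha> y * f y)
      + (LBINT y:{x..}. (exp (- x) * FML'' \<alpha> y - FML' \<alpha> (y - x)) * f y)"
proof -
  interpret \<Lambda>: C0_functional "\<lambda>f. N.refl.U f x" by (rule N.refl.C0_functional_U[OF x])
  define r where "r y = exp (- x) * FML'' \<alpha> y - dF (max 0 (y - x))" for y
  have lap: "has_bochner_integral lborel (\<lambda>y. indicator {0..} y * (exp (- (\<theta> * y)) * r y))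
      (exp (- x) * (\<theta> / (\<theta> powr \<alpha> - 1)) - exp (- (\<theta> * x)) / (\<theta> powr \<alpha> - 1))" if \<theta>: "1 < \<theta>" for \<theta>
  proof -
    have "has_bochner_integral lborel (\<lambda>y. exp (- x) * (indicator {0..} y * (exp (- (\<theta> * y)) * FML'' \<alpha> y))
          - indicator {0..} y * (exp (- (\<theta> * y)) * dF (max 0 (y - x))))
        (exp (- x) * (\<theta> / (\<theta> powr \<alpha> - 1)) - exp (- (\<theta> * x)) / (\<theta> powr \<alpha> - 1))"
      by (intro has_bochner_integral_diff has_bochner_integral_mult_right laplace_FML''[OF \<alpha>(1) \<theta>] laplace_dF_shift[OF \<theta> x])
    also have "(\<lambda>y. exp (- x) * (indicator {0..} y * (exp (- (\<theta> * y)) * FML'' \<alpha> y))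
          - indicator {0..} y * (exp (- (\<theta> * y)) * dF (max 0 (y - x)))) =
        (\<lambda>y. indicator {0..} y * (exp (- (\<theta> * y)) * r y))"
      by (simp add: fun_eq_iff r_def right_diff_distrib mult.left_commute)
    finally show ?thesis .
  qed
  have rep: "set_integrable lborel {0..} r" "N.refl.U f x = (LBINT y:{0..}. f y * r y)"
  proof -
    have pos: "0 \<le> N.refl.U f x" if "f \<in> C0" "\<And>x. 0 \<le> x \<Longrightarrow> 0 \<le> f x" for f
      by (rule N.refl.U_nonneg[OF that x])
    have cont: "isCont r y" if "0 < y" for y
    proof -
      have "continuous_on UNIV (\<lambda>y. dF (max 0 (y - x)))"
        using continuous_on_compose2[OF dF_max_continuous, of UNIV "\<lambda>y. y - x"] by (simp add: continuous_intros)
      then have "isCont (\<lambda>y. dF (max 0 (y - x))) y" by (simp add: continuous_on_eq_continuous_at)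
      then show ?thesis unfolding r_def[abs_def] by (intro continuous_intros isCont_deriv2_FML[OF \<alpha>(1) that])
    qed
    have int: "set_integrable lborel {0..} (\<lambda>y. exp (- (2 * y)) * r y)"
      using lap[of 2] by (simp add: set_integrable_def has_bochner_integral_iff)
    have eq: "N.refl.U (\<lambda>x\<in>{0..}. exp (- (real n * x))) x = (LBINT y:{0..}. exp (- (real n * y)) * r y)" if n: "3 \<le> n" for n
    proof -
      have n1: "1 < real n" using n by simp
      have alg: "(a - c * b) / (1 - p) = b * (c / (p - 1)) - a / (p - 1)" for a b c p :: real
        using minus_divide_divide[of "c * b - a" "p - 1"] by (simp add: diff_divide_distrib mult.commute)
      show ?thesis using sup_resolvent_exp[OF n1 x] lap[OF n1]
        unfolding alg by (simp add: set_lebesgue_integral_def has_bochner_integral_iff)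
    qed
    show "set_integrable lborel {0..} r" by (rule \<Lambda>.density_representation(1)[OF pos cont int eq])
    show "N.refl.U f x = (LBINT y:{0..}. f y * r y)" by (rule \<Lambda>.density_representation(2)[OF pos cont int eq f])
  qed
  obtain B where B: "\<And>x. 0 \<le> x \<Longrightarrow> \<bar>f x\<bar> \<le> B" using C0_bounded[OF f] by auto
  have fr: "set_integrable lborel {0..} (\<lambda>y. f y * r y)"
    unfolding set_integrable_def
  proof (rule Bochner_Integration.integrable_bound)
    show "integrable lborel (\<lambda>y. B * (indicator {0..} y *\<^sub>R r y))"
      using rep(1) unfolding set_integrable_def by (rule integrable_mult_right)
    have "(\<lambda>y. f y * (indicator {0..} y *\<^sub>R r y)) \<in> borel_measurable lborel"
      using C0_borel_measurable[OF f] borel_measurable_integrable[OF rep(1)[unfolded set_integrable_def]] by measurable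
    then show "(\<lambda>y. indicat_real {0..} y *\<^sub>R (f y * r y)) \<in> borel_measurable lborel" by (simp add: mult_ac)
    show "AE y in lborel. norm (indicat_real {0..} y *\<^sub>R (f y * r y)) \<le> norm (B * (indicat_real {0..} y *\<^sub>R r y))"
      using order_trans[OF B abs_ge_self] by (intro AE_I2) (auto simp: indicator_def abs_mult intro!: mult_right_mono)
  qed
  have "(LBINT y:{0..x} \<union> {x<..}. f y * r y) = (LBINT y:{0..x}. f y * r y) + (LBINT y:{x<..}. f y * r y)"
    by (intro set_integral_Un) (use x in \<open>auto intro: set_integrable_subset[OF fr]\<close>)
  moreover have "{0..x} \<union> {x<..} = {0..}" using x by auto
  moreover have "(LBINT y:{0..x}. f y * r y) = (LBINT y:{0..x}. exp (- x) * (FML'' \<alpha> y * f y))"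
    by (intro set_lebesgue_integral_cong) (auto simp: r_def max_def dF_0)
  moreover have "(LBINT y:{x<..}. f y * r y) = (LBINT y:{x..}. (exp (- x) * FML'' \<alpha> y - FML' \<alpha> (y - x)) * f y)"
    unfolding set_lebesgue_integral_def
    by (rule integral_discrete_difference[of "{x}"]) (auto simp: indicator_def r_def dF_eq max_def)
  ultimately show ?thesis using rep(2) by simp
qed

section \<open>Reflection at the infimum\<close>

text \<open>The normalisation by \<open>q\<close> makes the transform a contraction.\<close>

definition lapl :: "real \<Rightarrow> (real \<Rightarrow> real) \<Rightarrow> real" where
  "lapl q w = q * (LBINT x:{0..}. exp (- (q * x)) * w x)"

lemma C0_indicator_measurable: "w \<in> C0 \<Longrightarrow> (\<lambda>t. indicator {0..} t * w t) \<in> borel_measurable borel"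
  using C0_borel_measurable[of w] by measurable

lemma C0_exp_integrable: "w \<in> C0 \<Longrightarrow> 0 < q \<Longrightarrow> set_integrable lborel {0..} (\<lambda>x. exp (- (q * x)) * w x)"
  by (metis C0_bounded C0_indicator_measurable set_integrable_exp_bounded)

lemma C0_functional_lapl:
  assumes q: "0 < q" shows "C0_functional (lapl q)"
proof
  fix f g :: "real \<Rightarrow> real" and a b :: real assume fg: "f \<in> C0" "g \<in> C0"
  have "(LBINT x:{0..}. exp (- (q * x)) * (\<lambda>x\<in>{0..}. a * f x + b * g x) x) =
      (LBINT x:{0..}. a * (exp (- (q * x)) * f x) + b * (exp (- (q * x)) * g x))"
    by (intro set_lebesgue_integral_cong) (auto simp: algebra_simps)
  then show "lapl q (\<lambda>x\<in>{0..}. a * f x + b * g x) = a * lapl q f + b * lapl q g"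
    using C0_exp_integrable[OF fg(1) q] C0_exp_integrable[OF fg(2) q] by (simp add: lapl_def algebra_simps)
next
  fix f :: "real \<Rightarrow> real" and B :: real assume f: "f \<in> C0" "\<And>x. 0 \<le> x \<Longrightarrow> \<bar>f x\<bar> \<le> B"
  have "\<bar>LBINT x:{0..}. exp (- (q * x)) * f x\<bar> \<le> B / q"
    by (rule set_integral_exp_bounded_le[OF q C0_indicator_measurable[OF f(1)] f(2)])
  then show "\<bar>lapl q f\<bar> \<le> B" using q by (simp add: lapl_def abs_mult field_simps)
qed

text \<open>Laplace transforms in the starting point turn the step operator into multiplication by
  \<open>exp (h q\<^sup>\<alpha>)\<close>, up to the effect of positive jumps over the origin, which is of second order.\<close>

lemma shifted_laplace_bound:
  fixes v :: "real \<Rightarrow> real"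
  assumes q: "0 < q" and L: "0 \<le> L" and vm: "v \<in> borel_measurable borel"
    and vL: "\<And>y. \<bar>v y\<bar> \<le> L * max 0 y" and vB: "\<And>y. \<bar>v y\<bar> \<le> B"
  shows "\<bar>(LBINT x:{0..}. exp (- (q * x)) * v (x + z)) - exp (q * z) * (LBINT y:{0..}. exp (- (q * y)) * v y)\<bar>
    \<le> L * ((max 0 z)\<^sup>2 * exp (q * max 0 z))"
proof -
  define g where "g y = exp (- (q * y)) * v y" for y
  have v0: "v y = 0" if "y \<le> 0" for y using vL[of y] that by simp
  have i0: "integrable lborel (\<lambda>y. indicator {0..} y * g y)"
    using set_integrable_exp_bounded[OF q, of v B] vm vB by (simp add: set_integrable_def g_def)
  define D where "D y = (indicator {0..} y - indicator {z..} y) * g y" for y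
  have Db: "\<bar>D y\<bar> \<le> L * max 0 z * indicator {0..max 0 z} y" for y
  proof (cases "0 \<le> y \<and> y < z")
    case True
    have "\<bar>g y\<bar> \<le> 1 * (L * max 0 z)"
      unfolding g_def abs_mult using True q L
      by (intro mult_mono order_trans[OF vL] mult_left_mono) auto
    then show ?thesis using True by (simp add: D_def)
  next
    case False
    then have "D y = 0" by (cases "y \<le> 0") (auto simp: D_def g_def v0 indicator_def)
    then show ?thesis using L by (simp add: indicator_def)
  qed
  have vm'[measurable]: "v \<in> borel_measurable borel" by (rule vm)
  have iI: "integrable lborel (\<lambda>y. L * max 0 z * indicator {0..max 0 z} y)" by simp
  have iD: "integrable lborel D"
    by (rule Bochner_Integration.integrable_bound[OF iI])
       (use order_trans[OF Db abs_ge_self] in \<open>auto simp: D_def[abs_def] g_def[abs_def]\<close>)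
  have "(LBINT x:{0..}. exp (- (q * x)) * v (x + z)) = (\<integral>y. exp (q * z) * (indicator {z..} y * g y) \<partial>lborel)"
    unfolding set_lebesgue_integral_def
    by (subst lborel_integral_real_affine[of 1 "\<lambda>y. exp (q * z) * (indicator {z..} y * g y)" z])
       (auto simp: indicator_def g_def algebra_simps mult_exp_exp intro!: Bochner_Integration.integral_cong simp flip: exp_add)
  also have "\<dots> = exp (q * z) * (\<integral>y. indicator {0..} y * g y - D y \<partial>lborel)"
    by (simp add: D_def left_diff_distrib)
  also have "(\<integral>y. indicator {0..} y * g y - D y \<partial>lborel) = (LBINT y:{0..}. exp (- (q * y)) * v y) - (\<integral>y. D y \<partial>lborel)"
    using i0 iD by (simp add: set_lebesgue_integral_def g_def)
  finally have "(LBINT x:{0..}. exp (- (q * x)) * v (x + z)) - exp (q * z) * (LBINT y:{0..}. exp (- (q * y)) * v y) = - (exp (q * z) * (\<integral>y. D y \<partial>lborel))"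
    by (simp add: right_diff_distrib)
  moreover have "\<bar>exp (q * z) * (\<integral>y. D y \<partial>lborel)\<bar> \<le> exp (q * max 0 z) * (L * max 0 z * max 0 z)"
    unfolding abs_mult
  proof (intro mult_mono)
    show "\<bar>exp (q * z)\<bar> \<le> exp (q * max 0 z)" using q by simp
    have "\<bar>\<integral>y. D y \<partial>lborel\<bar> \<le> (\<integral>y. \<bar>D y\<bar> \<partial>lborel)" using integral_norm_bound[of lborel D] by simp
    also have "\<dots> \<le> (\<integral>y. L * max 0 z * indicator {0..max 0 z} y \<partial>lborel)"
      by (intro integral_mono integrable_abs iD iI Db)
    also have "\<dots> = L * max 0 z * max 0 z" by simp
    finally show "\<bar>\<integral>y. D y \<partial>lborel\<bar> \<le> L * max 0 z * max 0 z" .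
  qed auto
  ultimately show ?thesis by (simp add: power2_eq_square mult_ac)
qed

text \<open>Subtracting \<open>w 0\<close> makes \<open>w\<close> vanish at the barrier, so that its extension by \<open>0\<close> to the negative half-line is transformed exactly; the Lipschitz constant controls what crosses the origin.\<close>

lemma inf_step_consistent:
  assumes q: "0 < q" and L: "0 \<le> L" and B: "0 \<le> B" and e: "0 < e"
  shows "\<exists>h0>0. \<forall>h. 0 < h \<longrightarrow> h < h0 \<longrightarrow> (\<forall>w\<in>lipschitz_C0 L. (\<forall>x\<ge>0. \<bar>w x\<bar> \<le> B) \<longrightarrow>
      \<bar>lapl q (step h w) - lapl q w - h * (q powr \<alpha> * (lapl q w - w 0))\<bar> \<le> e * h)"
proof -
  have eB: "0 < e / 2 / (2 * B + 1)" using e B by simp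
  obtain h1 where h1: "0 < h1" "\<And>h. 0 < h \<Longrightarrow> h < h1 \<Longrightarrow> \<bar>exp (h * q powr \<alpha>) - 1 - h * q powr \<alpha>\<bar> \<le> e/2/(2 * B + 1) * h"
    using exp_linear_small[OF _ eB, of "q powr \<alpha>"] by auto
  obtain h2 where h2: "0 < h2" "\<And>h. 0 < h \<Longrightarrow> h < h2 \<Longrightarrow> (q * L) * (\<integral>\<omega>. (max 0 (Z h \<omega>))\<^sup>2 * exp (q * max 0 (Z h \<omega>)) \<partial>M) \<le> e/2 * h"
    using positive_part_moment_small[of q "q * L" "e/2"] q L e by auto
  have "\<bar>lapl q (step h w) - lapl q w - h * (q powr \<alpha> * (lapl q w - w 0))\<bar> \<le> e * h"
    if h: "0 < h" "h < min h1 h2" and w: "w \<in> lipschitz_C0 L" and wB: "\<forall>x\<ge>0. \<bar>w x\<bar> \<le> B" for h w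
  proof -
    have h0: "0 \<le> h" using h by simp
    note Zm[measurable] = measurable_Z[OF h0]
    have wC: "w \<in> C0" and wL: "\<And>x y. 0 \<le> x \<Longrightarrow> 0 \<le> y \<Longrightarrow> \<bar>w x - w y\<bar> \<le> L * \<bar>x - y\<bar>"
      using w by (auto simp: lipschitz_C0_def)
    note wm[measurable] = C0_borel_measurable[OF wC]
    define v where "v y = w (max 0 y) - w 0" for y
    have vm[measurable]: "v \<in> borel_measurable borel" unfolding v_def by measurable
    have vL: "\<bar>v y\<bar> \<le> L * max 0 y" for y using wL[of "max 0 y" 0] by (simp add: v_def)
    have vB: "\<bar>v y\<bar> \<le> 2 * B" for y
    proof -
      have "\<bar>w (max 0 y)\<bar> \<le> B" "\<bar>w 0\<bar> \<le> B" using wB by auto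
      then show ?thesis unfolding v_def by linarith
    qed
    define V where "V = (LBINT y:{0..}. exp (- (q * y)) * v y)"
    define J where "J z = (LBINT x:{0..}. exp (- (q * x)) * v (x + z))" for z
    have vi: "set_integrable lborel {0..} (\<lambda>x. exp (- (q * x)) * v x)"
      by (rule set_integrable_exp_bounded[OF q _ vB]) measurable
    have lw: "lapl q w = w 0 + q * V"
    proof -
      have "(LBINT x:{0..}. exp (- (q * x)) * w x) = (LBINT x:{0..}. w 0 * exp (- (q * x)) + exp (- (q * x)) * v x)"
        by (intro set_lebesgue_integral_cong) (auto simp: v_def algebra_simps)
      also have "\<dots> = w 0 * (1 / q) + V"
        using set_integrable_exp[OF q] vi by (simp add: V_def set_integral_exp[OF q])
      finally show ?thesis using q by (simp add: lapl_def distrib_left)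
    qed
    have vZm: "(\<lambda>(\<omega>, x). v (x + Z h \<omega>)) \<in> borel_measurable (M \<Otimes>\<^sub>M lborel)"
      by measurable
    note swap = expectation_exp_integral_swap[OF q vZm vB, folded J_def]
    have ls: "lapl q (step h w) = w 0 + q * (\<integral>\<omega>. J (Z h \<omega>) \<partial>M)"
    proof -
      have iv: "integrable M (\<lambda>\<omega>. v (x + Z h \<omega>))" for x
        by (rule integrable_const_bound[of _ "2 * B"]) (use vB in auto)
      have sw: "step h w x = w 0 + (\<integral>\<omega>. v (x + Z h \<omega>) \<partial>M)" if "0 \<le> x" for x
      proof -
        have "(\<integral>\<omega>. w (max 0 (x + Z h \<omega>)) \<partial>M) = (\<integral>\<omega>. w 0 + v (x + Z h \<omega>) \<partial>M)" by (simp add: v_def)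
        also have "\<dots> = w 0 + (\<integral>\<omega>. v (x + Z h \<omega>) \<partial>M)"
          by (subst Bochner_Integration.integral_add[OF _ iv]) (simp_all add: prob_space)
        finally show ?thesis using that by (simp add: step_def rand_op_def)
      qed
      have m: "(\<lambda>x. indicator {0..} x * (\<integral>\<omega>. v (x + Z h \<omega>) \<partial>M)) \<in> borel_measurable borel"
      proof -
        have "(\<lambda>x. indicator {0..} x * (step h w x - w 0)) \<in> borel_measurable borel"
          using C0_borel_measurable[OF step_C0[OF h0 wC]] by measurable
        also have "(\<lambda>x. indicator {0..} x * (step h w x - w 0)) = (\<lambda>x. indicator {0..} x * (\<integral>\<omega>. v (x + Z h \<omega>) \<partial>M))"
          by (auto simp: fun_eq_iff indicator_def sw)
        finally show ?thesis .
      qed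
      have ib: "\<bar>\<integral>\<omega>. v (x + Z h \<omega>) \<partial>M\<bar> \<le> 2 * B" for x
      proof -
        have "\<bar>\<integral>\<omega>. v (x + Z h \<omega>) \<partial>M\<bar> \<le> (\<integral>\<omega>. \<bar>v (x + Z h \<omega>)\<bar> \<partial>M)" using integral_norm_bound[of M "\<lambda>\<omega>. v (x + Z h \<omega>)"] by simp
        also have "\<dots> \<le> (\<integral>\<omega>. 2 * B \<partial>M)" by (intro integral_mono integrable_abs iv vB) simp
        finally show ?thesis by (simp add: prob_space)
      qed
      have "(LBINT x:{0..}. exp (- (q * x)) * step h w x) =
          (LBINT x:{0..}. w 0 * exp (- (q * x)) + exp (- (q * x)) * (\<integral>\<omega>. v (x + Z h \<omega>) \<partial>M))"
        by (intro set_lebesgue_integral_cong) (auto simp: sw algebra_simps)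
      also have "\<dots> = w 0 * (1 / q) + (LBINT x:{0..}. exp (- (q * x)) * (\<integral>\<omega>. v (x + Z h \<omega>) \<partial>M))"
        using set_integrable_exp[OF q] set_integrable_exp_bounded[OF q m ib] by (simp add: set_integral_exp[OF q])
      also have "(LBINT x:{0..}. exp (- (q * x)) * (\<integral>\<omega>. v (x + Z h \<omega>) \<partial>M)) = (\<integral>\<omega>. J (Z h \<omega>) \<partial>M)"
        by (rule swap(2))
      finally show ?thesis using q by (simp add: lapl_def distrib_left)
    qed
    define m where "m = (\<integral>\<omega>. (max 0 (Z h \<omega>))\<^sup>2 * exp (q * max 0 (Z h \<omega>)) \<partial>M)"
    have JV: "\<bar>(\<integral>\<omega>. J (Z h \<omega>) \<partial>M) - exp (h * q powr \<alpha>) * V\<bar> \<le> L * m"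
    proof -
      have iJ: "integrable M (\<lambda>\<omega>. J (Z h \<omega>))" by (rule swap(1))
      have iE: "integrable M (\<lambda>\<omega>. exp (q * Z h \<omega>))" using exp_moment_integrable[OF h0] q by simp
      have iP: "integrable M (\<lambda>\<omega>. (max 0 (Z h \<omega>))\<^sup>2 * exp (q * max 0 (Z h \<omega>)))"
        by (rule positive_part_moment(1)[OF _ h0]) (use q in simp)
      have "(\<integral>\<omega>. J (Z h \<omega>) \<partial>M) - exp (h * q powr \<alpha>) * V = (\<integral>\<omega>. J (Z h \<omega>) - exp (q * Z h \<omega>) * V \<partial>M)"
        using iJ iE exp_moment[OF h0, of q] q by simp
      also have "\<bar>\<dots>\<bar> \<le> (\<integral>\<omega>. \<bar>J (Z h \<omega>) - exp (q * Z h \<omega>) * V\<bar> \<partial>M)"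
        using integral_norm_bound[of M "\<lambda>\<omega>. J (Z h \<omega>) - exp (q * Z h \<omega>) * V"] by simp
      also have "\<dots> \<le> (\<integral>\<omega>. L * ((max 0 (Z h \<omega>))\<^sup>2 * exp (q * max 0 (Z h \<omega>))) \<partial>M)"
      proof (rule integral_mono)
        show "integrable M (\<lambda>\<omega>. \<bar>J (Z h \<omega>) - exp (q * Z h \<omega>) * V\<bar>)"
          by (intro integrable_abs Bochner_Integration.integrable_diff iJ integrable_mult_left iE)
        show "integrable M (\<lambda>\<omega>. L * ((max 0 (Z h \<omega>))\<^sup>2 * exp (q * max 0 (Z h \<omega>))))"
          by (rule integrable_mult_right[OF iP])
        show "\<bar>J (Z h \<omega>) - exp (q * Z h \<omega>) * V\<bar> \<le> L * ((max 0 (Z h \<omega>))\<^sup>2 * exp (q * max 0 (Z h \<omega>)))" for \<omega>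
          unfolding J_def V_def by (rule shifted_laplace_bound[OF q L vm vL vB])
      qed
      also have "\<dots> = L * m" by (simp add: m_def)
      finally show ?thesis .
    qed
    have qV: "\<bar>q * V\<bar> \<le> 2 * B"
    proof -
      have "\<bar>V\<bar> \<le> 2 * B / q" unfolding V_def by (rule set_integral_exp_bounded_le[OF q _ vB]) measurable
      then show ?thesis using q by (simp add: abs_mult field_simps)
    qed
    have eq: "lapl q (step h w) - lapl q w - h * (q powr \<alpha> * (lapl q w - w 0)) =
        q * ((\<integral>\<omega>. J (Z h \<omega>) \<partial>M) - exp (h * q powr \<alpha>) * V) + (q * V) * (exp (h * q powr \<alpha>) - 1 - h * q powr \<alpha>)"
      unfolding lw ls by (simp add: algebra_simps)
    have "\<bar>q * ((\<integral>\<omega>. J (Z h \<omega>) \<partial>M) - exp (h * q powr \<alpha>) * V)\<bar> \<le> q * (L * m)"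
      unfolding abs_mult using JV q by (intro mult_mono) auto
    also have "\<dots> \<le> e/2 * h" using h2(2)[of h] h by (simp add: m_def mult.assoc)
    finally have a: "\<bar>q * ((\<integral>\<omega>. J (Z h \<omega>) \<partial>M) - exp (h * q powr \<alpha>) * V)\<bar> \<le> e/2 * h" .
    have "\<bar>(q * V) * (exp (h * q powr \<alpha>) - 1 - h * q powr \<alpha>)\<bar> \<le> (2 * B + 1) * (e/2/(2 * B + 1) * h)"
      unfolding abs_mult[of "q * V"] using qV h1(2)[of h] h B by (intro mult_mono) auto
    also have "\<dots> = e/2 * h"
    proof -
      have "c * (e/2/c * h) = e/2 * h" if "c \<noteq> 0" for c :: real using that by simp
      then show ?thesis using B by (metis add_nonneg_pos less_numeral_extra(1) less_irrefl mult_nonneg_nonneg zero_le_numeral)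
    qed
    finally have b: "\<bar>(q * V) * (exp (h * q powr \<alpha>) - 1 - h * q powr \<alpha>)\<bar> \<le> e/2 * h" .
    show ?thesis unfolding eq using a b by linarith
  qed
  then show ?thesis using h1(1) h2(1) by (intro exI[of _ "min h1 h2"]) auto
qed

text \<open>Differentiate the transform of \<open>T h (U f)\<close> at \<open>h = 0\<close> in two ways: through the generator, which gives \<open>U f - f\<close>, and through the one-step operators.\<close>

lemma inf_resolvent_laplace:
  assumes f: "f \<in> lipschitz_C0 L" and L: "0 \<le> L" and q: "0 < q"
  shows "lapl q (refl.U f) - lapl q f = q powr \<alpha> * (lapl q (refl.U f) - refl.U f 0)"
proof -
  have fC: "f \<in> C0" using f by (simp add: lipschitz_C0_def)
  let ?u = "refl.U f"
  have uC: "?u \<in> C0" by (rule refl.U_C0[OF fC])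
  interpret l: C0_functional "lapl q" by (rule C0_functional_lapl[OF q])
  obtain B where B: "0 < B" "\<And>x. 0 \<le> x \<Longrightarrow> \<bar>?u x\<bar> \<le> B" using C0_bounded[OF uC] by auto
  have "lapl q (\<lambda>x\<in>{0..}. ?u x - f x) = q powr \<alpha> * (lapl q ?u - ?u 0)"
  proof (rule functional_derivative_of_step[OF U_lipschitz[OF f L] L refl.generator_limit_U[OF fC] C0_functional_lapl[OF q],
        where \<psi> = "\<lambda>w. q powr \<alpha> * (lapl q w - w 0)" and C = "2 * q powr \<alpha>" and B = B])
    show "0 < 2 * q powr \<alpha>" using q by simp
    show "\<bar>q powr \<alpha> * (lapl q f - f 0) - q powr \<alpha> * (lapl q k - k 0)\<bar> \<le> 2 * q powr \<alpha> * D"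
      if "f \<in> C0" "k \<in> C0" and d: "\<And>x. 0 \<le> x \<Longrightarrow> \<bar>f x - k x\<bar> \<le> D" for f k D
    proof -
      have "\<bar>(lapl q f - f 0) - (lapl q k - k 0)\<bar> \<le> 2 * D"
        using l.diff_bound[OF that] d[OF order_refl] by linarith
      then have "q powr \<alpha> * \<bar>(lapl q f - f 0) - (lapl q k - k 0)\<bar> \<le> q powr \<alpha> * (2 * D)" by (intro mult_left_mono) auto
      moreover have "\<bar>q powr \<alpha> * (lapl q f - f 0) - q powr \<alpha> * (lapl q k - k 0)\<bar> = q powr \<alpha> * \<bar>(lapl q f - f 0) - (lapl q k - k 0)\<bar>"
        unfolding right_diff_distrib[of "q powr \<alpha>" "lapl q f - f 0" "lapl q k - k 0", symmetric] abs_mult by simp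
      ultimately show ?thesis by linarith
    qed
    show "\<exists>h0>0. \<forall>h. 0 < h \<longrightarrow> h < h0 \<longrightarrow> (\<forall>w\<in>lipschitz_C0 L. (\<forall>x\<ge>0. \<bar>w x\<bar> \<le> B) \<longrightarrow>
        \<bar>lapl q (step h w) - lapl q w - h * (q powr \<alpha> * (lapl q w - w 0))\<bar> \<le> e * h)" if "0 < e" for e
      by (rule inf_step_consistent[OF q L less_imp_le[OF B(1)] that])
    show "\<bar>?u x\<bar> \<le> B" if "0 \<le> x" for x by (rule B(2)[OF that])
  qed
  moreover have "(\<lambda>x\<in>{0..}. ?u x - f x) = (\<lambda>x\<in>{0..}. 1 * ?u x + - 1 * f x)" by (rule restrict_ext) simp
  ultimately have "q powr \<alpha> * (lapl q ?u - ?u 0) = 1 * lapl q ?u + - 1 * lapl q f"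
    using l.lincomb[OF uC fC, of 1 "- 1"] by metis
  then show ?thesis by linarith
qed

lemma lapl_one: "lapl 1 f = exp_mean f"
  by (simp add: lapl_def exp_mean_def)

lemma inf_resolvent_transform:
  assumes f: "f \<in> lipschitz_C0 L" and L: "0 \<le> L"
  shows "refl.U f 0 = exp_mean f"
    and "1 < q \<Longrightarrow> (LBINT x:{0..}. exp (- (q * x)) * refl.U f x) =
      exp_mean f * (q powr (\<alpha> - 1) / (q powr \<alpha> - 1)) - (LBINT x:{0..}. exp (- (q * x)) * f x) * (1 / (q powr \<alpha> - 1))"
proof -
  show u0: "refl.U f 0 = exp_mean f"
    using inf_resolvent_laplace[OF f L, of 1] lapl_one[of f] by simp
  show "(LBINT x:{0..}. exp (- (q * x)) * refl.U f x) =
      exp_mean f * (q powr (\<alpha> - 1) / (q powr \<alpha> - 1)) - (LBINT x:{0..}. exp (- (q * x)) * f x) * (1 / (q powr \<alpha> - 1))"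
    if q: "1 < q"
  proof -
    define a where "a = (LBINT x:{0..}. exp (- (q * x)) * refl.U f x)"
    define b where "b = (LBINT x:{0..}. exp (- (q * x)) * f x)"
    define p where "p = q powr \<alpha>"
    have p: "1 < p" using q \<alpha> by (simp add: p_def)
    have p1: "q powr (\<alpha> - 1) = p / q" using q by (simp add: p_def powr_diff)
    have "q * a - q * b = p * (q * a - exp_mean f)"
      using inf_resolvent_laplace[OF f L, of q] q u0 by (simp add: lapl_def a_def b_def p_def)
    then have "q * (a * (p - 1)) = exp_mean f * p - q * b" by (simp add: algebra_simps)
    then have "a * (p - 1) = exp_mean f * (p / q) - b" using q by (simp add: field_simps)
    then have "a = (exp_mean f * (p / q) - b) / (p - 1)" using p by (simp add: field_simps)
    then show ?thesis unfolding a_def[symmetric] b_def[symmetric] p1 p_def[symmetric] by (simp add: diff_divide_distrib)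
  qed
qed

lemma half_line_conv_exp:
  assumes x: "0 \<le> x"
  shows "(LBINT y:{0..x}. dF (x - y) * exp (- (c * y))) = exp (- (c * x)) * integral {0..x} (\<lambda>z. dF z * exp (c * z))"
proof -
  have cont: "continuous_on {0..x} (\<lambda>z. dF z * exp (c * z))"
    by (intro continuous_intros continuous_on_subset[OF dF_continuous]) auto
  have "(LBINT y:{0..x}. dF (x - y) * exp (- (c * y))) = (LBINT z:{0..x}. exp (- (c * x)) * (dF z * exp (c * z)))"
    unfolding set_lebesgue_integral_def
    by (subst lborel_integral_real_affine[of "-1" "\<lambda>z. indicator {0..x} z *\<^sub>R (exp (- (c * x)) * (dF z * exp (c * z)))" x])
       (auto simp: indicator_def algebra_simps intro!: Bochner_Integration.integral_cong simp flip: exp_add)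
  also have "\<dots> = exp (- (c * x)) * (LBINT z:{0..x}. dF z * exp (c * z))" by simp
  also have "(LBINT z:{0..x}. dF z * exp (c * z)) = integral {0..x} (\<lambda>z. dF z * exp (c * z))"
    by (rule set_borel_integral_eq_integral(2)[OF borel_integrable_atLeastAtMost'[OF cont]])
  finally show ?thesis .
qed

text \<open>Both sides are continuous in \<open>x\<close> and have the same Laplace transform.\<close>

lemma inf_resolvent_exp:
  assumes c: "1 \<le> c" and x: "0 \<le> x"
  shows "refl.U (E c) x = exp_mean (E c) * FML \<alpha> x - (LBINT y:{0..x}. dF (x - y) * exp (- (c * y)))"
proof -
  have c0: "0 < c" using c by simp
  have EC: "E c \<in> C0" by (rule C0_E[OF c0])
  have EL: "E c \<in> lipschitz_C0 c"
  proof -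
    have *: "exp (- (c * x)) - exp (- (c * y)) \<le> c * \<bar>x - y\<bar>" if "0 \<le> x" "x \<le> y" for x y
    proof -
      have "exp (- (c * x)) - exp (- (c * y)) = exp (- (c * x)) * (1 - exp (- (c * (y - x))))"
        by (simp add: algebra_simps flip: exp_add)
      also have "\<dots> \<le> 1 * (c * (y - x))"
        using that c0 exp_ge_add_one_self[of "- (c * (y - x))"] by (intro mult_mono) auto
      finally show ?thesis using that by simp
    qed
    have "\<bar>exp (- (c * x)) - exp (- (c * y))\<bar> \<le> c * \<bar>x - y\<bar>" if "0 \<le> x" "0 \<le> y" for x y
    proof (cases "x \<le> y")
      case True
      then have "exp (- (c * y)) \<le> exp (- (c * x))" using c0 by simp
      then show ?thesis using *[of x y] that True by simp
    next
      case False
      then have "exp (- (c * x)) \<le> exp (- (c * y))" using c0 by simp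
      then show ?thesis using *[of y x] that False by (simp add: abs_minus_commute)
    qed
    then show ?thesis using EC by (simp add: lipschitz_C0_def)
  qed
  have UC: "refl.U (E c) \<in> C0" by (rule refl.U_C0[OF EC])
  define K where "K x = (LBINT y:{0..x}. dF (x - y) * exp (- (c * y)))" for x
  define R where "R x = exp_mean (E c) * FML \<alpha> x - K x" for x
  have Kc: "continuous_on {0..} K"
  proof (rule continuous_on_half_line)
    fix b :: real
    have "continuous_on {0..b} (\<lambda>z. dF z * exp (c * z))"
      by (intro continuous_intros continuous_on_subset[OF dF_continuous]) auto
    from indefinite_integral_continuous_1[OF integrable_continuous_interval[OF this]]
    have "continuous_on {0..b} (\<lambda>x. exp (- (c * x)) * integral {0..x} (\<lambda>z. dF z * exp (c * z)))"
      by (rule continuous_on_mult[rotated]) (intro continuous_intros)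
    then show "continuous_on {0..b} K"
      by (rule continuous_on_eq) (auto simp: K_def half_line_conv_exp)
  qed
  have Klap: "has_bochner_integral lborel (\<lambda>x. indicator {0..} x * (exp (- (q * x)) * K x))
      ((1 / (q powr \<alpha> - 1)) * (LBINT x:{0..}. exp (- (q * x)) * E c x))" if q: "1 < q" for q
  proof -
    define a where "a z = indicator {0..} z * (exp (- (q * z)) * dF z)" for z
    define b where "b y = indicator {0..} y * (exp (- (q * y)) * exp (- (c * y)))" for y
    have a: "integrable lborel a" "integral\<^sup>L lborel a = 1 / (q powr \<alpha> - 1)"
      using laplace_dF[OF q] unfolding a_def has_bochner_integral_iff by auto
    have b_eq: "b = (\<lambda>y. indicator {0..} y * (exp (- (q * y)) * E c y))" by (auto simp: b_def fun_eq_iff indicator_def)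
    have b: "integrable lborel b"
      using C0_exp_integrable[OF EC, of q] q unfolding b_eq by (simp add: set_integrable_def)
    have eq: "(\<integral>y. a (x - y) * b y \<partial>lborel) = indicator {0..} x * (exp (- (q * x)) * K x)" for x
    proof -
      have "(\<integral>y. a (x - y) * b y \<partial>lborel) = (\<integral>y. (indicator {0..} x * exp (- (q * x))) * (indicator {0..x} y * (dF (x - y) * exp (- (c * y)))) \<partial>lborel)"
      proof (rule Bochner_Integration.integral_cong[OF refl])
        fix y
        have "exp (- (q * (x - y))) * exp (- (q * y)) = exp (- (q * x))" by (simp add: algebra_simps flip: exp_add)
        then have "exp (- (q * (x - y))) * dF (x - y) * (exp (- (q * y)) * exp (- (c * y))) = exp (- (q * x)) * (dF (x - y) * exp (- (c * y)))"
          by (metis mult.assoc mult.left_commute)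
        then show "a (x - y) * b y = (indicator {0..} x * exp (- (q * x))) * (indicator {0..x} y * (dF (x - y) * exp (- (c * y))))"
          by (auto simp: a_def b_def indicator_def)
      qed
      then show ?thesis by (simp add: K_def set_lebesgue_integral_def)
    qed
    show ?thesis
      using convolution_integral[OF a(1) b] unfolding eq a(2) unfolding b_eq by (simp add: set_lebesgue_integral_def)
  qed
  have Rlap: "has_bochner_integral lborel (\<lambda>x. indicator {0..} x * (exp (- (q * x)) * R x))
      (exp_mean (E c) * (q powr (\<alpha> - 1) / (q powr \<alpha> - 1)) - (1 / (q powr \<alpha> - 1)) * (LBINT x:{0..}. exp (- (q * x)) * E c x))"
    if q: "1 < q" for q
  proof -
    have "has_bochner_integral lborel (\<lambda>x. exp_mean (E c) * (indicator {0..} x * (exp (- (q * x)) * FML \<alpha> x)) - indicator {0..} x * (exp (- (q * x)) * K x))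
      (exp_mean (E c) * (q powr (\<alpha> - 1) / (q powr \<alpha> - 1)) - (1 / (q powr \<alpha> - 1)) * (LBINT x:{0..}. exp (- (q * x)) * E c x))"
      by (intro has_bochner_integral_diff has_bochner_integral_mult_right laplace_FML[OF \<alpha>(1) q] Klap[OF q])
    also have "(\<lambda>x. exp_mean (E c) * (indicator {0..} x * (exp (- (q * x)) * FML \<alpha> x)) - indicator {0..} x * (exp (- (q * x)) * K x)) =
        (\<lambda>x. indicator {0..} x * (exp (- (q * x)) * R x))"
      by (simp add: fun_eq_iff R_def right_diff_distrib mult.left_commute)
    finally show ?thesis .
  qed
  define w where "w x = refl.U (E c) x - R x" for x
  have split: "set_integrable lborel {0..} (\<lambda>y. exp (- (q * y)) * w y)"
    "(LBINT y:{0..}. exp (- (q * y)) * w y) = 0" if q: "1 < q" for q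
  proof -
    have q0: "0 < q" using q by simp
    have iU: "set_integrable lborel {0..} (\<lambda>y. exp (- (q * y)) * refl.U (E c) y)" by (rule C0_exp_integrable[OF UC q0])
    have iR: "set_integrable lborel {0..} (\<lambda>y. exp (- (q * y)) * R y)"
      using Rlap[OF q] by (simp add: set_integrable_def has_bochner_integral_iff)
    show "set_integrable lborel {0..} (\<lambda>y. exp (- (q * y)) * w y)"
      using set_integral_diff(1)[OF iU iR] by (simp add: w_def right_diff_distrib)
    have "(LBINT y:{0..}. exp (- (q * y)) * w y) = (LBINT y:{0..}. exp (- (q * y)) * refl.U (E c) y) - (LBINT y:{0..}. exp (- (q * y)) * R y)"
      using set_integral_diff(2)[OF iU iR] by (simp add: w_def right_diff_distrib)
    also have "(LBINT y:{0..}. exp (- (q * y)) * R y) =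
        exp_mean (E c) * (q powr (\<alpha> - 1) / (q powr \<alpha> - 1)) - (1 / (q powr \<alpha> - 1)) * (LBINT x:{0..}. exp (- (q * x)) * E c x)"
      using Rlap[OF q] unfolding has_bochner_integral_iff set_lebesgue_integral_def real_scaleR_def by blast
    also have "(LBINT y:{0..}. exp (- (q * y)) * refl.U (E c) y) =
        exp_mean (E c) * (q powr (\<alpha> - 1) / (q powr \<alpha> - 1)) - (LBINT x:{0..}. exp (- (q * x)) * E c x) * (1 / (q powr \<alpha> - 1))"
      by (rule inf_resolvent_transform(2)[OF EL less_imp_le[OF c0] q])
    finally show "(LBINT y:{0..}. exp (- (q * y)) * w y) = 0" by (simp only: mult.commute)
  qed
  have "w x = 0"
  proof (rule laplace_unique[OF _ _ _ x])
    show "continuous_on {0..} w" unfolding w_def R_def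
      by (intro continuous_intros C0_D(1)[OF UC] continuous_on_FML[OF \<alpha>(1)] Kc)
    show "set_integrable lborel {0..} (\<lambda>y. exp (- (2 * y)) * w y)" by (rule split(1)) simp
    show "(LBINT y:{0..}. exp (- (real n * y)) * w y) = 0" if "3 \<le> n" for n
      by (rule split(2)) (use that in simp)
  qed
  then show ?thesis by (simp add: w_def R_def K_def)
qed

text \<open>For fixed \<open>x\<close> the right-hand side is integration of \<open>f\<close> against \<open>r y = exp (- y) F\<^sub>\<alpha> x - dF (max 0 (x - y))\<close>.\<close>

lemma inf_resolvent_formula:
  assumes f: "f \<in> C0" and x: "0 \<le> x"
  shows "refl.U f x = exp_mean f * FML \<alpha> x - half_line_conv (FML' \<alpha>) f x"
proof -
  interpret \<Lambda>: C0_functional "\<lambda>f. refl.U f x" by (rule refl.C0_functional_U[OF x])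
  define r where "r y = exp (- y) * FML \<alpha> x - dF (max 0 (x - y))" for y
  have i1: "set_integrable lborel {0..} (\<lambda>y. exp (- (1 * y)) * h y)" if "h \<in> C0" for h
    by (rule C0_exp_integrable[OF that]) simp
  have ic: "set_integrable lborel {0..x} (\<lambda>y. dF (x - y) * h y)" if "continuous_on {0..} h" for h
    by (rule borel_integrable_atLeastAtMost')
       (intro continuous_intros continuous_on_subset[OF that] continuous_on_compose2[OF dF_continuous], auto)
  have i2: "set_integrable lborel {0..} (\<lambda>y. dF (max 0 (x - y)) * h y)"
    and e2: "(LBINT y:{0..}. dF (max 0 (x - y)) * h y) = (LBINT y:{0..x}. dF (x - y) * h y)"
    if "continuous_on {0..} h" for h
  proof -
    have "(\<lambda>y. indicator {0..} y *\<^sub>R (dF (max 0 (x - y)) * h y)) = (\<lambda>y. indicator {0..x} y *\<^sub>R (dF (x - y) * h y))"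
      by (auto simp: fun_eq_iff indicator_def dF_0 max_def)
    then show "set_integrable lborel {0..} (\<lambda>y. dF (max 0 (x - y)) * h y)"
      "(LBINT y:{0..}. dF (max 0 (x - y)) * h y) = (LBINT y:{0..x}. dF (x - y) * h y)"
      using ic[OF that] by (simp_all add: set_integrable_def set_lebesgue_integral_def)
  qed
  have formula: "set_integrable lborel {0..} (\<lambda>y. h y * r y)"
    "(LBINT y:{0..}. h y * r y) = exp_mean h * FML \<alpha> x - (LBINT y:{0..x}. dF (x - y) * h y)" if h: "h \<in> C0" for h
  proof -
    have eq: "(\<lambda>y. h y * r y) = (\<lambda>y. FML \<alpha> x * (exp (- (1 * y)) * h y) - dF (max 0 (x - y)) * h y)"
      by (simp add: fun_eq_iff r_def algebra_simps)
    note ii = set_integrable_mult_right[OF i1[OF h], of "FML \<alpha> x"] i2[OF C0_D(1)[OF h]]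
    show "set_integrable lborel {0..} (\<lambda>y. h y * r y)" unfolding eq by (rule set_integral_diff(1)[OF ii])
    show "(LBINT y:{0..}. h y * r y) = exp_mean h * FML \<alpha> x - (LBINT y:{0..x}. dF (x - y) * h y)"
      unfolding eq set_integral_diff(2)[OF ii] e2[OF C0_D(1)[OF h]] by (simp add: exp_mean_def)
  qed
  have "refl.U f x = (LBINT y:{0..}. f y * r y)"
  proof (rule \<Lambda>.density_representation(2)[OF _ _ _ _ f])
    show "0 \<le> refl.U f x" if "f \<in> C0" "\<And>x. 0 \<le> x \<Longrightarrow> 0 \<le> f x" for f
      by (rule refl.U_nonneg[OF that x])
    show "isCont r y" for y
    proof -
      have "continuous_on UNIV (\<lambda>y. dF (max 0 (x - y)))"
        using continuous_on_compose2[OF dF_max_continuous, of UNIV "\<lambda>y. x - y"] by (simp add: continuous_intros)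
      then have "isCont (\<lambda>y. dF (max 0 (x - y))) y" by (simp add: continuous_on_eq_continuous_at)
      then show ?thesis unfolding r_def[abs_def] by (intro continuous_intros)
    qed
    have E_eq: "(LBINT y:{0..}. exp (- (c * y)) * r y) = (LBINT y:{0..}. E c y * r y)" for c
      by (intro set_lebesgue_integral_cong) auto
    show "set_integrable lborel {0..} (\<lambda>y. exp (- (2 * y)) * r y)"
    proof -
      have "set_integrable lborel {0..} (\<lambda>y. E 2 y * r y)" by (rule formula(1)[OF C0_E]) simp
      then show ?thesis by (rule set_integrable_cong[THEN iffD1, rotated 3]) auto
    qed
    show "refl.U (\<lambda>x\<in>{0..}. exp (- (real n * x))) x = (LBINT y:{0..}. exp (- (real n * y)) * r y)" if n: "3 \<le> n" for n
    proof -
      have n1: "1 \<le> real n" "0 < real n" using n by auto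
      have "(LBINT y:{0..x}. dF (x - y) * E (real n) y) = (LBINT y:{0..x}. dF (x - y) * exp (- (real n * y)))"
        by (intro set_lebesgue_integral_cong) auto
      then show ?thesis using inf_resolvent_exp[OF n1(1) x] formula(2)[OF C0_E[OF n1(2)]] unfolding E_eq by simp
    qed
  qed
  also have "\<dots> = exp_mean f * FML \<alpha> x - (LBINT y:{0..x}. dF (x - y) * f y)" by (rule formula(2)[OF f])
  also have "(LBINT y:{0..x}. dF (x - y) * f y) = half_line_conv (FML' \<alpha>) f x"
    unfolding half_line_conv_def set_lebesgue_integral_def
    by (rule integral_discrete_difference[of "{x}"]) (auto simp: indicator_def dF_eq)
  finally show ?thesis .
qed

lemma feller_domain_refl_inf:
  "feller_domain M (refl_inf Z) = {(\<lambda>x\<in>{0..}. exp_mean f * FML \<alpha> x - half_line_conv (FML' \<alpha>) f x) | f. f \<in> C0}"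
proof -
  have "refl.U f = (\<lambda>x\<in>{0..}. exp_mean f * FML \<alpha> x - half_line_conv (FML' \<alpha>) f x)" if "f \<in> C0" for f
    by (subst C0_restrict[OF refl.U_C0[OF that], symmetric], rule restrict_ext) (simp add: inf_resolvent_formula[OF that])
  then show ?thesis unfolding feller_domain_eq_range_U by (metis (mono_tags, lifting))
qed

lemma feller_domain_refl_sup:
  "feller_domain M (refl_sup Z) = {(\<lambda>x\<in>{0..}. exp (- x) * (LBINT y:{0..x}. FML'' \<alpha> y * f y)
      + (LBINT y:{x..}. (exp (- x) * FML'' \<alpha> y - FML' \<alpha> (y - x)) * f y)) | f. f \<in> C0}"
proof -
  have "N.refl.U f = (\<lambda>x\<in>{0..}. exp (- x) * (LBINT y:{0..x}. FML'' \<alpha> y * f y)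
      + (LBINT y:{x..}. (exp (- x) * FML'' \<alpha> y - FML' \<alpha> (y - x)) * f y))" if "f \<in> C0" for f
    by (subst C0_restrict[OF N.refl.U_C0[OF that], symmetric], rule restrict_ext) (simp add: sup_resolvent_formula[OF that])
  then show ?thesis unfolding refl_sup_eq_refl_inf N.feller_domain_eq_range_U by (metis (mono_tags, lifting))
qed

end

theorem proposition2p2:
  fixes \<alpha> :: real and M :: "'a measure" and Z :: "real \<Rightarrow> 'a \<Rightarrow> real"
  assumes "1 < \<alpha>" and "\<alpha> < 2"
    and "spectrally_negative_stable M Z \<alpha>"
  shows "feller_domain M (refl_inf Z) =
           {(\<lambda>x\<in>{0..}. exp_mean f * FML \<alpha> x - half_line_conv (FML' \<alpha>) f x) | f. f \<in> C0}
       \<and> feller_domain M (refl_sup Z) =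
           {(\<lambda>x\<in>{0..}. exp (- x) * (LBINT y:{0..x}. FML'' \<alpha> y * f y)
               + (LBINT y:{x..}. (exp (- x) * FML'' \<alpha> y - FML' \<alpha> (y - x)) * f y)) | f. f \<in> C0}"
proof -
  interpret levy_process M Z using assms(3) by (simp add: spectrally_negative_stable_def)
  interpret stable_levy M Z \<alpha>
    by unfold_locales (use assms in \<open>auto simp: spectrally_negative_stable_def\<close>)
  show ?thesis using feller_domain_refl_inf feller_domain_refl_sup by (rule conjI)
qed

end
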